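(* Let $\pi$ be a probability density on $\mathbb{R}^d$ whose log-density $\log\pi$ belongs to $C^3(\mathbb{R}^d)$, let $h>0$, and let $f=\nabla\log\pi$ with Jacobian $Df$. Let $q$ be the transition density of the boosted Ozaki (bO) proposal with step $h$, $\alpha$ the corresponding Metropolis–Hastings acceptance probability, and assume $\liminf_{\|x\|\to+\infty}\int_{\mathbb{R}^d}\alpha(x,y)q(x,y)\,dy>0$. Assume moreover: 1. $\limsup_{\|x\|\to+\infty}\lambda_{\max}(Df(x))<0$; 2. $\lim_{\|x\|\to+\infty}Df(x)^{-2}\{\mathrm{I}_d:D^2f(x)\}=0$; 3. there exists a function $c:\mathbb{S}^d\to\mathbb{R}$ such that $\lim_{\|x\|\to+\infty}\left\|\frac{Df(x)^{-1}f(x)}{\|x\|}-c(\vec n_x)\,\vec n_x\right\|=0$. If $$0<\inf_{n\in\mathbb{S}^d}c(n)\le\sup_{n\in\mathbb{S}^d}c(n)<6/5,$$ then the bOMA Markov kernel $P$ (Metropolis–Hastings with the bO proposal and target $\pi$) is geometrically ergodic.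
   Context: $\mathbb{S}^d=\{x\in\mathbb{R}^d:\|x\|=1\}$, $\vec n_x=x/\|x\|$. $\lambda_{\max}(M)$ is the largest eigenvalue of $M$. $\{\mathrm{I}_d:D^2f(x)\}\in\mathbb{R}^d$ is the vector with $i$-th entry $\Delta f_i(x)$ (Laplacian of the $i$-th component of $f$). $\mathrm I_d$ is the identity matrix. For a real symmetric $d\times d$ matrix $M$, $h>0$, put (defined via power series, so that $M$ need not be invertible) $$T_1(M,h)=M^{-1}(e^{(h/2)M}-\mathrm{I}_d),\quad T_2(M,h)=M^{-1}(e^{-(h^2/4)M^2}-\mathrm{I}_d),\quad T_3(M,h)=M^{-2}(e^{(h/2)M}-\mathrm{I}_d-(h/2)M).$$ The bO proposal from $x$ is $y=\mu(x)+S(x)\xi$, $\xi\sim\mathcal{N}(0,\mathrm{I}_d)$, with $$\mu(x)=x+T_1(Df(x),h)f(x)+\tfrac23T_2(Df(x),h)f(x)-\tfrac13T_3(Df(x),h)\{\mathrm{I}_d:D^2f(x)\},$$ $$S(x)=\left(T_1(Df(x),2h)+\tfrac13T_2(Df(x),2h)\right)^{1/2}$$ (symmetric square root; the matrix inside is positive definite). Its transition density $q(x,\cdot)$ is the density of $\mathcal N(\mu(x),S(x)S(x)^T)$, $\alpha(x,y)=\min\left(1,\frac{\pi(y)q(y,x)}{\pi(x)q(x,y)}\right)$, and $$P(x,dy)=\alpha(x,y)q(x,y)\,dy+\delta_x(dy)\int_{\mathbb{R}^d}(1-\alpha(x,z))q(x,z)\,dz.$$ A Markov kernel $P$ with invariant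 probability $\pi$ is $V$-geometrically ergodic, for measurable $V:\mathbb{R}^d\to[1,+\infty)$, if there exist $C\ge0$, $\rho\in[0,1)$ with $\|P^n(x,\cdot)-\pi\|_V\le C\rho^nV(x)$ for all $x\in\mathbb{R}^d$, $n\ge0$, where $\|\nu\|_V=\sup_{|\phi|\le V}\int\phi\,d\nu$; it is geometrically ergodic if it is $V$-geometrically ergodic for some such $V$. *)

theory Defs
  imports "HOL-Probability.Probability"
begin

section \<open>Derivatives on Euclidean space\<close>

definition partial_deriv :: "'d \<Rightarrow> (real ^ 'd \<Rightarrow> real) \<Rightarrow> real ^ 'd \<Rightarrow> real" where
  "partial_deriv i g x = frechet_derivative g (at x) (axis i 1)"

text \<open>\<open>C_k k g\<close>: \<open>g\<close> is of class \<open>C\<^sup>k\<close> on the whole space.\<close>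

primrec C_k :: "nat \<Rightarrow> (real ^ 'd \<Rightarrow> real) \<Rightarrow> bool" where
  "C_k 0 g \<longleftrightarrow> continuous_on UNIV g"
| "C_k (Suc k) g \<longleftrightarrow> (\<forall>x. g differentiable (at x)) \<and> (\<forall>i. C_k k (partial_deriv i g))"

definition laplacian :: "(real ^ 'd \<Rightarrow> real) \<Rightarrow> real ^ 'd \<Rightarrow> real" where
  "laplacian g x = (\<Sum>j\<in>UNIV. partial_deriv j (partial_deriv j g) x)"

definition vec_laplacian :: "(real ^ 'd \<Rightarrow> real ^ 'd) \<Rightarrow> real ^ 'd \<Rightarrow> real ^ 'd" where
  "vec_laplacian f x = (\<chi> i. laplacian (\<lambda>y. f y $ i) x)"


section \<open>Matrix functions\<close>

text \<open>Only used for symmetric matrices, for which the set of real eigenvalues is finite and nonempty.\<close>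

definition lambda_max :: "real ^ 'd ^ 'd \<Rightarrow> real" where
  "lambda_max M = Max {l. \<exists>v. v \<noteq> 0 \<and> M *v v = l *\<^sub>R v}"

text \<open>The library operations \<open>*\<close> and \<open>^\<close> on matrices act entrywise, so the powers with
  respect to the matrix product \<open>**\<close> are introduced here.\<close>

primrec mpow :: "real ^ 'd ^ 'd \<Rightarrow> nat \<Rightarrow> real ^ 'd ^ 'd" where
  "mpow M 0 = mat 1"
| "mpow M (Suc k) = M ** mpow M k"

definition mat_exp :: "real ^ 'd ^ 'd \<Rightarrow> real ^ 'd ^ 'd" where
  "mat_exp M = (\<Sum>k. (1 / fact k) *\<^sub>R mpow M k)"

text \<open>Power series of \<open>M\<^sup>-\<^sup>1 (exp((h/2) M) - I)\<close>, \<open>M\<^sup>-\<^sup>1 (exp(-(h\<^sup>2/4) M\<^sup>2) - I)\<close> and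
  \<open>M\<^sup>-\<^sup>2 (exp((h/2) M) - I - (h/2) M)\<close>; the lemmas \<open>T1_exp\<close>, \<open>T2_exp\<close>, \<open>T3_exp\<close> below confirm this.\<close>

definition T1 :: "real ^ 'd ^ 'd \<Rightarrow> real \<Rightarrow> real ^ 'd ^ 'd" where
  "T1 M h = (\<Sum>k. ((h / 2) ^ (k + 1) / fact (k + 1)) *\<^sub>R mpow M k)"

definition T2 :: "real ^ 'd ^ 'd \<Rightarrow> real \<Rightarrow> real ^ 'd ^ 'd" where
  "T2 M h = (\<Sum>k. ((- (h\<^sup>2 / 4)) ^ (k + 1) / fact (k + 1)) *\<^sub>R mpow M (2 * k + 1))"

definition T3 :: "real ^ 'd ^ 'd \<Rightarrow> real \<Rightarrow> real ^ 'd ^ 'd" where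
  "T3 M h = (\<Sum>k. ((h / 2) ^ (k + 2) / fact (k + 2)) *\<^sub>R mpow M k)"

text \<open>The unique symmetric positive semidefinite square root of a symmetric positive semidefinite
  matrix.\<close>

definition mat_sqrt :: "real ^ 'd ^ 'd \<Rightarrow> real ^ 'd ^ 'd" where
  "mat_sqrt A = (THE B. transpose B = B \<and> (\<forall>v. 0 \<le> v \<bullet> (B *v v)) \<and> B ** B = A)"

lemma scaleR_matrix_mult:
  "(c *\<^sub>R A) ** B = c *\<^sub>R (A ** B)" "A ** (c *\<^sub>R B) = c *\<^sub>R (A ** B)"
  for A B :: "real ^ 'd ^ 'd"
  by (simp_all add: matrix_matrix_mult_def vec_eq_iff sum_distrib_left mult_ac)

lemma mpow_scaleR: "mpow (c *\<^sub>R M) k = c ^ k *\<^sub>R mpow M k"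
  by (induction k) (simp_all add: scaleR_matrix_mult)

lemma mpow_square: "mpow (M ** M) k = mpow M (2 * k)"
  by (induction k) (simp_all add: matrix_mul_assoc)

lemma bounded_linear_matrix_mult:
  fixes M :: "real ^ 'd ^ 'd"
  shows "bounded_linear (\<lambda>A :: real ^ 'd ^ 'd. M ** A)"
proof -
  have "linear (\<lambda>A :: real ^ 'd ^ 'd. M ** A)"
    by (rule linearI) (simp_all add: matrix_add_ldistrib scaleR_matrix_mult)
  then show ?thesis by (simp add: linear_conv_bounded_linear)
qed

lemma mpow_norm_bound:
  fixes M :: "real ^ 'd ^ 'd"
  shows "\<exists>K. \<forall>k. norm (mpow M k) \<le> K ^ k * norm (mat 1 :: real ^ 'd ^ 'd)"
proof -
  from bounded_linear.pos_bounded[OF bounded_linear_matrix_mult, of M]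
  obtain K where K: "K > 0" "\<And>A :: real ^ 'd ^ 'd. norm (M ** A) \<le> norm A * K"
    by blast
  have "norm (mpow M k) \<le> K ^ k * norm (mat 1 :: real ^ 'd ^ 'd)" for k
  proof (induction k)
    case (Suc k)
    have "norm (mpow M (Suc k)) \<le> norm (mpow M k) * K"
      unfolding mpow.simps by (rule K(2))
    also have "\<dots> \<le> (K ^ k * norm (mat 1 :: real ^ 'd ^ 'd)) * K"
      by (rule mult_right_mono[OF Suc less_imp_le[OF K(1)]])
    also have "\<dots> = K ^ Suc k * norm (mat 1 :: real ^ 'd ^ 'd)" by simp
    finally show ?case .
  qed simp
  then show ?thesis by (intro exI allI)
qed

lemma summable_mpow_series:
  fixes M :: "real ^ 'd ^ 'd"
  assumes a: "\<And>k. \<bar>a k\<bar> \<le> B * (c ^ k / fact k)"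
  shows "summable (\<lambda>k. a k *\<^sub>R mpow M k)"
proof -
  obtain K where K: "\<forall>k. norm (mpow M k) \<le> K ^ k * norm (mat 1 :: real ^ 'd ^ 'd)"
    using mpow_norm_bound[of M] ..
  define m where "m = mpow M"
  define n where "n = norm (mat 1 :: real ^ 'd ^ 'd)"
  have m: "norm (m k) \<le> K ^ k * n" for k
    using K by (simp add: m_def n_def)
  have "norm (a k *\<^sub>R m k) \<le> (B * n) * ((c * K) ^ k /\<^sub>R fact k)" if "k \<ge> 0" for k
  proof -
    have "norm (a k *\<^sub>R m k) \<le> (B * (c ^ k / fact k)) * (K ^ k * n)"
      unfolding norm_scaleR
      by (rule mult_mono[OF a m order_trans[OF abs_ge_zero a] norm_ge_zero])
    also have "\<dots> = (B * n) * ((c * K) ^ k /\<^sub>R fact k)"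
      by (simp add: field_simps)
    finally show ?thesis .
  qed
  from summable_comparison_test'[OF summable_mult[OF summable_exp_generic] this]
  have "summable (\<lambda>k. a k *\<^sub>R m k)" .
  then show ?thesis by (simp add: m_def)
qed

lemma fact_shift_bound:
  fixes c :: real
  shows "\<bar>c ^ (k + m) / fact (k + m)\<bar> \<le> \<bar>c\<bar> ^ m * (\<bar>c\<bar> ^ k / fact k)"
proof -
  have "\<bar>c ^ (k + m) / fact (k + m)\<bar> = \<bar>c\<bar> ^ (k + m) / fact (k + m)"
    by (simp only: abs_divide power_abs abs_of_nonneg[OF fact_ge_zero])
  also have "\<dots> \<le> \<bar>c\<bar> ^ (k + m) / fact k"
    by (rule divide_left_mono) (simp_all add: fact_mono)
  also have "\<dots> = \<bar>c\<bar> ^ m * (\<bar>c\<bar> ^ k / fact k)"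
    by (simp add: power_add)
  finally show ?thesis .
qed

lemma summable_shifted:
  fixes M :: "real ^ 'd ^ 'd"
  shows "summable (\<lambda>k. (c ^ (k + m) / fact (k + m)) *\<^sub>R mpow M k)"
  by (rule summable_mpow_series[where a = "\<lambda>k. c ^ (k + m) / fact (k + m)" and B = "\<bar>c\<bar> ^ m"
        and c = "\<bar>c\<bar>", OF fact_shift_bound])

lemma summable_mat_exp: "summable (\<lambda>k. (c ^ k / fact k) *\<^sub>R mpow M k)"
  using summable_shifted[of c 0 M] by simp

lemma mat_exp_scaleR: "mat_exp (c *\<^sub>R M) = (\<Sum>k. (c ^ k / fact k) *\<^sub>R mpow M k)"
  by (simp add: mat_exp_def mpow_scaleR mult.commute)

lemma T1_exp: "M ** T1 M h = mat_exp ((h / 2) *\<^sub>R M) - mat 1"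
proof -
  have "summable (\<lambda>k. ((h / 2) ^ (k + 1) / fact (k + 1)) *\<^sub>R mpow M k)"
    by (rule summable_shifted)
  from bounded_linear.suminf[OF bounded_linear_matrix_mult[of M] this]
  have "M ** T1 M h = (\<Sum>k. ((h / 2) ^ Suc k / fact (Suc k)) *\<^sub>R mpow M (Suc k))"
    by (simp add: T1_def scaleR_matrix_mult)
  then show ?thesis
    using suminf_split_head[OF summable_mat_exp[of "h / 2" M]] by (simp add: mat_exp_scaleR)
qed

lemma T3_exp: "M ** M ** T3 M h = mat_exp ((h / 2) *\<^sub>R M) - mat 1 - (h / 2) *\<^sub>R M"
proof -
  have "summable (\<lambda>k. ((h / 2) ^ (k + 2) / fact (k + 2)) *\<^sub>R mpow M k)"
    by (rule summable_shifted)
  from bounded_linear.suminf[OF bounded_linear_matrix_mult[of "M ** M"] this]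
  have "M ** M ** T3 M h = (\<Sum>k. ((h / 2) ^ (k + 2) / fact (k + 2)) *\<^sub>R mpow M (k + 2))"
    by (simp add: T3_def scaleR_matrix_mult matrix_mul_assoc)
  then show ?thesis
    using suminf_minus_initial_segment[OF summable_mat_exp[of "h / 2" M], of 2]
    by (simp add: mat_exp_scaleR numeral_2_eq_2 algebra_simps)
qed

lemma T2_exp: "M ** T2 M h = mat_exp ((- (h\<^sup>2 / 4)) *\<^sub>R (M ** M)) - mat 1"
proof -
  let ?c = "- (h\<^sup>2 / 4)"
  have "summable (\<lambda>k. (?c ^ (k + 1) / fact (k + 1)) *\<^sub>R mpow (M ** M) k)"
    by (rule summable_shifted)
  from bounded_linear.summable[OF bounded_linear_matrix_mult[of M] this]
  have "summable (\<lambda>k. (?c ^ (k + 1) / fact (k + 1)) *\<^sub>R mpow M (2 * k + 1))"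
    by (simp add: scaleR_matrix_mult mpow_square del: power_Suc fact_Suc)
  from bounded_linear.suminf[OF bounded_linear_matrix_mult[of M] this]
  have "M ** T2 M h = (\<Sum>k. (?c ^ Suc k / fact (Suc k)) *\<^sub>R mpow (M ** M) (Suc k))"
    by (simp add: T2_def scaleR_matrix_mult mpow_square matrix_mul_assoc[symmetric]
        del: power_Suc fact_Suc)
  then show ?thesis
    using suminf_split_head[OF summable_mat_exp[of ?c "M ** M"]]
    unfolding mat_exp_scaleR by (simp del: power_Suc fact_Suc)
qed


section \<open>The boosted Ozaki proposal\<close>

definition bO_mean :: "(real ^ 'd \<Rightarrow> real ^ 'd) \<Rightarrow> real \<Rightarrow> real ^ 'd \<Rightarrow> real ^ 'd" where
  "bO_mean f h x =
     (let J = jacobian f (at x) in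
       x + T1 J h *v f x + (2 / 3) *\<^sub>R (T2 J h *v f x) - (1 / 3) *\<^sub>R (T3 J h *v vec_laplacian f x))"

definition bO_scale :: "(real ^ 'd \<Rightarrow> real ^ 'd) \<Rightarrow> real \<Rightarrow> real ^ 'd \<Rightarrow> real ^ 'd ^ 'd" where
  "bO_scale f h x =
     (let J = jacobian f (at x) in mat_sqrt (T1 J (2 * h) + (1 / 3) *\<^sub>R T2 J (2 * h)))"

definition gaussian_density :: "real ^ 'd \<Rightarrow> real ^ 'd ^ 'd \<Rightarrow> real ^ 'd \<Rightarrow> real" where
  "gaussian_density m \<Sigma> y =
     exp (- ((y - m) \<bullet> (matrix_inv \<Sigma> *v (y - m))) / 2) / sqrt ((2 * pi) ^ CARD('d) * det \<Sigma>)"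

definition bO_density :: "(real ^ 'd \<Rightarrow> real ^ 'd) \<Rightarrow> real \<Rightarrow> real ^ 'd \<Rightarrow> real ^ 'd \<Rightarrow> real" where
  "bO_density f h x y =
     gaussian_density (bO_mean f h x) (bO_scale f h x ** transpose (bO_scale f h x)) y"


section \<open>The Metropolis--Hastings kernel\<close>

definition mh_accept :: "('a \<Rightarrow> real) \<Rightarrow> ('a \<Rightarrow> 'a \<Rightarrow> real) \<Rightarrow> 'a \<Rightarrow> 'a \<Rightarrow> real" where
  "mh_accept p q x y = min 1 (p y * q y x / (p x * q x y))"

definition mh_kernel ::
  "('a::euclidean_space \<Rightarrow> real) \<Rightarrow> ('a \<Rightarrow> 'a \<Rightarrow> real) \<Rightarrow> 'a \<Rightarrow> 'a measure" where
  "mh_kernel p q x = measure_of UNIV (sets borel) (\<lambda>A.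
     (\<integral>\<^sup>+y\<in>A. ennreal (mh_accept p q x y * q x y) \<partial>lborel) +
     indicator A x * (\<integral>\<^sup>+z. ennreal ((1 - mh_accept p q x z) * q x z) \<partial>lborel))"

text \<open>\<^const>\<open>measure_of\<close> returns the null measure unless its argument is a measure; here it is.\<close>

lemma emeasure_mh_kernel:
  assumes "mh_accept p q x \<in> borel_measurable borel" "q x \<in> borel_measurable borel" "A \<in> sets borel"
  shows "emeasure (mh_kernel p q x) A =
     (\<integral>\<^sup>+y\<in>A. ennreal (mh_accept p q x y * q x y) \<partial>lborel) +
     indicator A x * (\<integral>\<^sup>+z. ennreal ((1 - mh_accept p q x z) * q x z) \<partial>lborel)"
proof -
  let ?a = "\<lambda>y. ennreal (mh_accept p q x y * q x y)"
  let ?r = "\<integral>\<^sup>+z. ennreal ((1 - mh_accept p q x z) * q x z) \<partial>lborel"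
  let ?\<mu> = "\<lambda>A. (\<integral>\<^sup>+y\<in>A. ?a y \<partial>lborel) + indicator A x * ?r"
  note [measurable] = assms
  have eq: "?\<mu> B = emeasure (density lborel ?a) B + ?r * emeasure (return borel x) B"
    if "B \<in> sets borel" for B
    using that by (simp add: emeasure_density mult.commute)
  have "countably_additive (sets borel) ?\<mu>"
    unfolding countably_additive_def
  proof (intro allI impI)
    fix B :: "nat \<Rightarrow> 'a set"
    assume B: "range B \<subseteq> sets borel" "disjoint_family B" "(\<Union>i. B i) \<in> sets borel"
    then have "(\<Sum>i. ?\<mu> (B i)) =
        (\<Sum>i. emeasure (density lborel ?a) (B i) + ?r * emeasure (return borel x) (B i))"
      by (intro suminf_cong eq) auto
    also have "\<dots> = (\<Sum>i. emeasure (density lborel ?a) (B i)) +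
        ?r * (\<Sum>i. emeasure (return borel x) (B i))"
      by (subst suminf_add[symmetric]) (simp_all add: ennreal_suminf_cmult)
    also have "\<dots> = emeasure (density lborel ?a) (\<Union>i. B i) + ?r * emeasure (return borel x) (\<Union>i. B i)"
      using B by (subst (1 2) suminf_emeasure) auto
    finally show "(\<Sum>i. ?\<mu> (B i)) = ?\<mu> (\<Union>i. B i)" using eq[OF B(3)] by simp
  qed
  moreover have "positive (sets borel) ?\<mu>" by (simp add: positive_def)
  moreover have "sigma_algebra UNIV (sets (borel :: 'a measure))"
    using sets.sigma_algebra_axioms[of borel] by simp
  ultimately show ?thesis
    unfolding mh_kernel_def using assms(3)
    by (intro emeasure_measure_of_sigma) auto
qed


section \<open>Geometric ergodicity\<close>

primrec kernel_pow :: "('a::euclidean_space \<Rightarrow> 'a measure) \<Rightarrow> nat \<Rightarrow> 'a \<Rightarrow> 'a measure" where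
  "kernel_pow P 0 x = return borel x"
| "kernel_pow P (Suc n) x = kernel_pow P n x \<bind> P"

text \<open>\<open>V_dist V \<mu> \<nu>\<close> is the \<open>V\<close>-norm of \<open>\<mu> - \<nu>\<close> for probability measures \<open>\<mu>\<close> and \<open>\<nu>\<close>. Since the Bochner
  integral of a non-integrable function is \<open>0\<close>, the case where \<open>V\<close> is not integrable with respect to
  both measures is set apart and the value there is infinite.\<close>

definition V_dist ::
  "('a::euclidean_space \<Rightarrow> real) \<Rightarrow> 'a measure \<Rightarrow> 'a measure \<Rightarrow> ereal" where
  "V_dist V \<mu> \<nu> =
     (if integrable \<mu> V \<and> integrable \<nu> V
      then (SUP \<phi> \<in> {\<phi> \<in> borel_measurable borel. \<forall>x. \<bar>\<phi> x\<bar> \<le> V x}.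
              ereal (integral\<^sup>L \<mu> \<phi> - integral\<^sup>L \<nu> \<phi>))
      else \<infinity>)"

definition V_geometrically_ergodic ::
  "('a::euclidean_space \<Rightarrow> real) \<Rightarrow> ('a \<Rightarrow> 'a measure) \<Rightarrow> 'a measure \<Rightarrow> bool" where
  "V_geometrically_ergodic V P \<nu> \<longleftrightarrow>
     (\<exists>C\<ge>0. \<exists>\<rho>\<in>{0..<1}. \<forall>x n. V_dist V (kernel_pow P n x) \<nu> \<le> ereal (C * \<rho> ^ n * V x))"

text \<open>The first two conjuncts say that \<open>P\<close> is a Markov kernel and that \<open>\<nu>\<close> is an invariant
  probability of \<open>P\<close>.\<close>

definition geometrically_ergodic ::
  "('a::euclidean_space \<Rightarrow> 'a measure) \<Rightarrow> 'a measure \<Rightarrow> bool" where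
  "geometrically_ergodic P \<nu> \<longleftrightarrow>
     P \<in> borel \<rightarrow>\<^sub>M prob_algebra borel \<and>
     \<nu> \<in> space (prob_algebra borel) \<and> \<nu> \<bind> P = \<nu> \<and>
     (\<exists>V \<in> borel_measurable borel. (\<forall>x. 1 \<le> V x) \<and> V_geometrically_ergodic V P \<nu>)"

end

theory Submission
  imports Defs
begin

text \<open>The argument works for an arbitrary proposal mean \<open>\<mu>\<close>. Let \<open>U = - ln p\<close>, which outside a ball is
  convex with Hessian \<open>H\<close>, and let \<open>V = exp (s (U - inf U))\<close> for a small \<open>s > 0\<close>. In the coordinate \<open>y = \<mu> x + S x \<xi>\<close>
  with \<open>\<xi>\<close> standard Gaussian, the acceptance probability is at most
  \<open>min 1 (exp (- \<Delta>) D exp (|\<xi>|\<^sup>2 / 2))\<close> with \<open>\<Delta> = U y - U x\<close> and \<open>D = det (S x) / det (S y)\<close>, so an accepted move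
  contributes at most \<open>exp (- s |\<Delta>| / 2) (D powr (s / 2) + D powr (3 s / 2))\<close>, up to a Gaussian factor, to
  \<open>P V x / V x\<close>. Since \<open>S y ^ (-2) \<le> C H y\<close>, the number \<open>D\<^sup>2\<close> is at most a multiple of the Hessian
  determinant of \<open>u \<xi> = U (\<mu> x + S x \<xi>)\<close>. The Newton decrement \<open>\<nabla>u \<bullet> (D\<^sup>2u)\<^sup>-\<^sup>1 \<nabla>u\<close> does not depend on \<open>S x\<close> and, by the
  radial condition on \<open>Df\<^sup>-\<^sup>1 f\<close>, tends to infinity with \<open>|y|\<close>. Hence the Hessian has an
  eigenvalue much smaller than \<open>|\<nabla>u|\<^sup>2\<close>, and a small power of \<open>D\<close> is bounded by a small constant times
  a sum of terms \<open>|\<partial>\<^sub>iu|\<close> and \<open>\<partial>\<^sub>i\<^sub>iu / (1 + (\<partial>\<^sub>iu)\<^sup>2)\<close>. For a function convex along a line, the integrals of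
  these terms against \<open>exp (- s |\<Delta>| / 2)\<close> are bounded by an absolute constant. So the accepted part of
  \<open>P V / V\<close> tends to \<open>0\<close>, and because the acceptance rate stays away from \<open>0\<close>, \<open>V\<close> is a Lyapunov function;
  Harris' theorem concludes.\<close>

section \<open>Spectral theory of real symmetric matrices\<close>

text \<open>Nothing here compares \<open>Df y\<close> with \<open>Df x\<close>: the Hessian at
  \<open>y\<close> may be far larger than at \<open>x\<close>, so \<open>D\<close> is not bounded
  pointwise and only its Gaussian average is estimated. What is available on average comes from the
  fundamental theorem of calculus along lines: the product of \<open>arctan \<Delta> + 3\<close>
  with \<open>arctan \<Delta>'\<close> is bounded by an absolute constant, whatever the function and
  the base point. Such a bound is linear in the integrand, so the determinant has to be raised to a
  power that makes it linear in the integrated quantities. In dimension d it is bounded by a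
  polynomial of degree less than 3d in them, and this is the origin of \<open>s = 1 / (3 d)\<close>.
  The powers s/2 and 3s/2 lie on either side of s: choosing one or the other according to the sign
  of \<Delta> makes \<open>exp ((s - k) * \<Delta>)\<close> decay in both directions.\<close>

lemma symmetric_inner_commute:
  fixes M :: "real ^ 'n ^ 'n"
  assumes "transpose M = M"
  shows "u \<bullet> (M *v v) = (M *v u) \<bullet> v"
  by (metis assms dot_lmul_matrix transpose_matrix_vector)

definition eigenbasis :: "real ^ 'n ^ 'n \<Rightarrow> ('n \<Rightarrow> real ^ 'n) \<Rightarrow> ('n \<Rightarrow> real) \<Rightarrow> bool" where
  "eigenbasis M b l \<longleftrightarrow>
     (\<forall>i j. b i \<bullet> b j = (if i = j then 1 else 0)) \<and> (\<forall>i. M *v b i = l i *\<^sub>R b i)"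

text \<open>First-order condition at a maximum: a linear term dominated by a quadratic one for
  \<open>t\<close> of either sign must vanish. Since \<open>k\<close> may be negative, the test
  value of \<open>t\<close> is built from \<open>\<bar>k\<bar>\<close>.\<close>

lemma linear_le_quadratic_imp_zero:
  fixes a k :: real
  assumes "\<And>t. t * a \<le> t\<^sup>2 * k"
  shows "a = 0"
proof (rule ccontr)
  assume "a \<noteq> 0"
  define t where "t = a / (1 + \<bar>k\<bar>)"
  have "t * a \<le> t\<^sup>2 * k" by (rule assms)
  also have "\<dots> \<le> t\<^sup>2 * \<bar>k\<bar>" by (intro mult_left_mono) auto
  finally have "t * a \<le> t\<^sup>2 * \<bar>k\<bar>" .
  moreover have "a = t * (1 + \<bar>k\<bar>)"
    unfolding t_def by simp
  then have "t * a = t\<^sup>2 * (1 + \<bar>k\<bar>)"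
    by (metis mult.assoc power2_eq_square)
  moreover have "t\<^sup>2 > 0" using \<open>a \<noteq> 0\<close> by (simp add: t_def)
  ultimately show False by (simp add: algebra_simps)
qed

text \<open>The Rayleigh quotient attains its maximum \<open>l\<close> on the compact unit sphere of
  \<open>W\<close>. The residual \<open>z = M v - l v\<close> lies in \<open>W\<close> by
  invariance, and a nonzero \<open>z\<close> would allow a first-order increase of the quotient
  along \<open>z\<close>.\<close>

lemma symmetric_eigenvector_exists:
  fixes M :: "real ^ 'n ^ 'n"
  assumes M: "transpose M = M" and W: "subspace W" "W \<noteq> {0}" "\<And>w. w \<in> W \<Longrightarrow> M *v w \<in> W"
  obtains v l where "v \<in> W" "norm v = 1" "M *v v = l *\<^sub>R v"
proof -
  let ?q = "\<lambda>v. v \<bullet> (M *v v)"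
  have "compact (W \<inter> sphere 0 1)"
    using closed_subspace[OF W(1)] by (simp add: closed_Int_compact)
  moreover have "W \<inter> sphere 0 1 \<noteq> {}"
  proof -
    obtain w where w: "w \<in> W" "w \<noteq> 0"
      using W(1,2) subspace_0 by blast
    then have "w /\<^sub>R norm w \<in> W \<inter> sphere 0 1"
      using subspace_scale[OF W(1)] by auto
    then show ?thesis by blast
  qed
  moreover have "continuous_on (W \<inter> sphere 0 1) ?q"
    by (intro continuous_intros matrix_vector_mult_linear_continuous_on)
  ultimately obtain v where "v \<in> W \<inter> sphere 0 1" and "\<forall>y \<in> W \<inter> sphere 0 1. ?q y \<le> ?q v"
    using continuous_attains_sup[of "W \<inter> sphere 0 1" ?q] by blast
  then have v: "v \<in> W" "norm v = 1"
    and max: "\<And>y. y \<in> W \<Longrightarrow> norm y = 1 \<Longrightarrow> ?q y \<le> ?q v"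
    by auto
  define l where "l = ?q v"
  have le: "?q w \<le> l * (w \<bullet> w)" if "w \<in> W" for w
  proof (cases "w = 0")
    case False
    have "?q (w /\<^sub>R norm w) \<le> l"
      unfolding l_def using that False by (intro max subspace_scale[OF W(1)]) auto
    moreover have "?q (w /\<^sub>R norm w) = ?q w / (norm w)\<^sup>2"
      by (simp add: matrix_vector_mult_scaleR power2_eq_square divide_inverse mult_ac)
    ultimately show ?thesis
      using False by (simp add: divide_le_eq dot_square_norm)
  qed simp
  define z where "z = M *v v - l *\<^sub>R v"
  have zW: "z \<in> W" unfolding z_def using v W by (simp add: subspace_diff subspace_scale)
  have "t * (2 * (z \<bullet> z)) \<le> t\<^sup>2 * (l * (z \<bullet> z) - ?q z)" for t :: real
  proof -
    have "v + t *\<^sub>R z \<in> W" using v zW W by (simp add: subspace_add subspace_scale)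
    note A = le[OF this]
    have B: "?q (v + t *\<^sub>R z) = l + 2 * t * (z \<bullet> (M *v v)) + t\<^sup>2 * ?q z"
      using symmetric_inner_commute[OF M, of v z]
      by (simp add: matrix_vector_right_distrib matrix_vector_mult_scaleR inner_add_left inner_add_right
          l_def power2_eq_square inner_commute[of z] algebra_simps)
    have C: "(v + t *\<^sub>R z) \<bullet> (v + t *\<^sub>R z) = 1 + 2 * t * (z \<bullet> v) + t\<^sup>2 * (z \<bullet> z)"
      using v(2) by (simp add: inner_add_left inner_add_right inner_commute[of z v] power2_eq_square
          norm_eq_1 algebra_simps)
    have D: "z \<bullet> (M *v v) = z \<bullet> z + l * (z \<bullet> v)"
      unfolding z_def by (simp add: inner_diff_left inner_diff_right algebra_simps)
    show ?thesis using A[unfolded B C D] by (simp add: algebra_simps)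
  qed
  then have "z = 0" using linear_le_quadratic_imp_zero by fastforce
  then show ?thesis using that v by (simp add: z_def)
qed

text \<open>An orthonormal set of eigenvectors of maximal cardinality spans: otherwise its
  orthogonal complement is nontrivial and, by symmetry, invariant under \<open>M\<close>, so it
  contains a further unit eigenvector.\<close>

lemma eigenbasis_exists:
  fixes M :: "real ^ 'n ^ 'n"
  assumes M: "transpose M = M"
  shows "\<exists>b l. eigenbasis M b l"
proof -
  define good where "good B \<longleftrightarrow> finite B \<and> pairwise orthogonal B \<and>
    (\<forall>v\<in>B. norm v = 1 \<and> (\<exists>l. M *v v = l *\<^sub>R v))" for B :: "(real ^ 'n) set"
  have indep: "independent B" if "good B" for B
    using that pairwise_orthogonal_independent[of B] by (force simp: good_def)
  have card_le: "card B \<le> CARD('n)" if "good B" for B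
    using independent_bound[OF indep[OF that]] by simp
  have "good {}" by (simp add: good_def)
  moreover have "\<forall>B. good B \<longrightarrow> card B < Suc CARD('n)" using card_le by (simp add: less_Suc_eq_le)
  ultimately obtain B where B: "good B" and Bmax: "\<And>B'. good B' \<Longrightarrow> card B' \<le> card B"
    using ex_has_greatest_nat[of good "{}" card "Suc CARD('n)"] by blast
  have "card B = CARD('n)"
  proof (rule ccontr)
    assume "card B \<noteq> CARD('n)"
    then have "dim (span B) < DIM(real ^ 'n)"
      using card_le[OF B] indep[OF B] by (simp add: dim_eq_card_independent)
    then obtain y where y: "y \<noteq> 0" "\<And>x. x \<in> span B \<Longrightarrow> orthogonal y x"
      using orthogonal_to_subspace_exists[of "span B"] by (auto simp: span_span)
    let ?W = "{w. \<forall>v\<in>B. v \<bullet> w = 0}"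
    have "subspace ?W" by (auto simp: subspace_def inner_add_right)
    moreover have "?W \<noteq> {0}"
      using y by (auto simp: orthogonal_def inner_commute span_base set_eq_iff)
    moreover have "M *v w \<in> ?W" if "w \<in> ?W" for w
    proof clarsimp
      fix v assume v: "v \<in> B"
      then obtain l where "M *v v = l *\<^sub>R v" using B by (auto simp: good_def)
      then show "v \<bullet> (M *v w) = 0"
        using that v by (simp add: symmetric_inner_commute[OF M])
    qed
    ultimately obtain v l where v: "v \<in> ?W" "norm v = 1" "M *v v = l *\<^sub>R v"
      using symmetric_eigenvector_exists[OF M] by blast
    have "v \<notin> B" using v by (auto simp: norm_eq_1)
    moreover have "good (insert v B)"
      using B v by (auto simp: good_def pairwise_insert orthogonal_def inner_commute)
    ultimately show False
      using Bmax[of "insert v B"] B by (simp add: good_def)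
  qed
  then obtain b :: "'n \<Rightarrow> real ^ 'n" where b: "bij_betw b UNIV B"
    using B finite_same_card_bij[of "UNIV :: 'n set" B] unfolding good_def by fastforce
  have bB: "b i \<in> B" for i using b by (auto simp: bij_betw_def)
  then have "\<forall>i. \<exists>r. M *v b i = r *\<^sub>R b i"
    using B unfolding good_def by blast
  then obtain l where "\<And>i. M *v b i = l i *\<^sub>R b i"
    by metis
  moreover have "b i \<bullet> b j = (if i = j then 1 else 0)" for i j
  proof (cases "i = j")
    case False
    then have "b i \<noteq> b j" using b by (auto simp: bij_betw_def inj_on_def)
    then show ?thesis
      using B bB False by (auto simp: good_def pairwise_def orthogonal_def)
  next
    case True
    then show ?thesis using B bB[of i] by (auto simp: good_def norm_eq_1)
  qed
  ultimately have "eigenbasis M b l" by (simp add: eigenbasis_def)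
  then show ?thesis by blast
qed

section \<open>Expansion, determinant, trace and spectrum in an orthonormal eigenbasis\<close>

context
  fixes M :: "real ^ 'n ^ 'n" and b :: "'n \<Rightarrow> real ^ 'n" and l :: "'n \<Rightarrow> real"
  assumes eb: "eigenbasis M b l"
begin

lemma eigenbasis_inner: "b i \<bullet> b j = (if i = j then 1 else 0)"
  using eb by (simp add: eigenbasis_def)

lemma eigenbasis_eigen: "M *v b i = l i *\<^sub>R b i"
  using eb by (simp add: eigenbasis_def)

lemma eigenbasis_nonzero: "b i \<noteq> 0"
  using eigenbasis_inner[of i i] by auto

lemma eigenbasis_orthogonal_matrix: "orthogonal_matrix (\<chi> i j. b j $ i)"
proof -
  have "column i (\<chi> i j. b j $ i) = b i" for i by (simp add: column_def vec_eq_iff)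
  then show ?thesis
    by (simp add: orthogonal_matrix_orthonormal_columns eigenbasis_inner norm_eq_1 orthogonal_def)
qed

lemma eigenbasis_expansion: "v = (\<Sum>i\<in>UNIV. (b i \<bullet> v) *\<^sub>R b i)"
proof -
  define Q :: "real ^ 'n ^ 'n" where "Q = (\<chi> i j. b j $ i)"
  have "v = Q *v (transpose Q *v v)"
    using eigenbasis_orthogonal_matrix
    by (simp add: Q_def orthogonal_matrix_def matrix_vector_mul_assoc del: transpose_matrix_vector)
  also have "\<dots> = (\<Sum>i\<in>UNIV. (b i \<bullet> v) *\<^sub>R b i)"
    by (simp add: vec_eq_iff matrix_vector_mult_def Q_def transpose_def inner_vec_def mult.commute
        del: transpose_matrix_vector)
  finally show ?thesis .
qed

lemma eigenbasis_matrix_eqI: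
  fixes A B :: "real ^ 'n ^ 'n"
  assumes "\<And>i. A *v b i = B *v b i"
  shows "A = B"
proof -
  have "A *v v = B *v v" for v
    by (subst (1 2) eigenbasis_expansion[of v])
      (simp add: linear_sum[OF matrix_vector_mul_linear] matrix_vector_mult_scaleR assms)
  then show ?thesis by (simp add: matrix_eq)
qed

lemma eigenbasis_inner_eq: "u \<bullet> v = (\<Sum>i\<in>UNIV. (b i \<bullet> u) * (b i \<bullet> v))"
  by (subst eigenbasis_expansion[of u]) (simp add: inner_sum_left)

lemma eigenbasis_mult: "M *v v = (\<Sum>i\<in>UNIV. (l i * (b i \<bullet> v)) *\<^sub>R b i)"
  by (subst eigenbasis_expansion[of v])
    (simp add: linear_sum[OF matrix_vector_mul_linear] matrix_vector_mult_scaleR eigenbasis_eigen mult.commute)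

lemma eigenbasis_quadratic: "v \<bullet> (M *v v) = (\<Sum>i\<in>UNIV. l i * (b i \<bullet> v)\<^sup>2)"
  by (simp add: eigenbasis_mult inner_sum_right power2_eq_square inner_commute[of v] mult_ac)

lemma eigenbasis_factorization:
  "M ** (\<chi> i j. b j $ i) = (\<chi> i j. b j $ i) ** (\<chi> i j. if i = j then l i else 0)"
proof -
  have "(\<Sum>k\<in>UNIV. M $ i $ k * b j $ k) = b j $ i * l j" for i j
    using eigenbasis_eigen[of j] by (simp add: vec_eq_iff matrix_vector_mult_def mult.commute)
  then show ?thesis
    by (simp add: vec_eq_iff matrix_matrix_mult_def if_distrib[of "(*) _"] cong: if_cong)
qed

lemma eigenbasis_det: "det M = prod l UNIV"
proof -
  let ?Q = "(\<chi> i j. b j $ i) :: real ^ 'n ^ 'n" and ?D = "(\<chi> i j. if i = j then l i else 0) :: real ^ 'n ^ 'n"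
  have "det M * det ?Q = det ?Q * det ?D"
    by (simp add: det_mul[symmetric] eigenbasis_factorization)
  moreover have "det ?Q \<noteq> 0" using det_orthogonal_matrix[OF eigenbasis_orthogonal_matrix] by auto
  moreover have "det ?D = prod l UNIV" by (subst det_diagonal) auto
  ultimately show ?thesis by simp
qed

lemma eigenbasis_trace: "trace M = sum l UNIV"
proof -
  let ?Q = "(\<chi> i j. b j $ i) :: real ^ 'n ^ 'n" and ?D = "(\<chi> i j. if i = j then l i else 0) :: real ^ 'n ^ 'n"
  have "trace M = trace (M ** ?Q ** transpose ?Q)"
    using eigenbasis_orthogonal_matrix by (simp add: orthogonal_matrix_def flip: matrix_mul_assoc)
  also have "\<dots> = trace (transpose ?Q ** ?Q ** ?D)"
    unfolding eigenbasis_factorization by (subst trace_mul_sym) (simp add: matrix_mul_assoc)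
  also have "\<dots> = sum l UNIV"
    using eigenbasis_orthogonal_matrix by (simp add: orthogonal_matrix_def trace_def)
  finally show ?thesis .
qed

lemma eigenvalue_in_eigenbasis:
  assumes "v \<noteq> 0" "M *v v = r *\<^sub>R v"
  shows "r \<in> range l"
proof (rule ccontr)
  assume "r \<notin> range l"
  have "b i \<bullet> v = 0" for i
  proof -
    have "b i \<bullet> (M *v v) = l i * (b i \<bullet> v)"
      by (simp add: eigenbasis_mult inner_sum_right eigenbasis_inner if_distrib cong: if_cong)
    then have "(r - l i) * (b i \<bullet> v) = 0" using assms(2) by (simp add: algebra_simps)
    moreover have "r \<noteq> l i" using \<open>r \<notin> range l\<close> by auto
    ultimately show ?thesis by simp
  qed
  then show False using eigenbasis_expansion[of v] assms(1) by simp
qed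

lemma lambda_max_eq: "lambda_max M = Max (range l)"
proof -
  have "{r. \<exists>v. v \<noteq> 0 \<and> M *v v = r *\<^sub>R v} = range l"
    using eigenvalue_in_eigenbasis eigenbasis_eigen eigenbasis_nonzero by fastforce
  then show ?thesis by (simp add: lambda_max_def)
qed

end

lemma quadratic_le_lambda_max:
  fixes M :: "real ^ 'n ^ 'n"
  assumes "transpose M = M"
  shows "v \<bullet> (M *v v) \<le> lambda_max M * (v \<bullet> v)"
proof -
  obtain b l where eb: "eigenbasis M b l" using eigenbasis_exists[OF assms] by blast
  have "l i \<le> lambda_max M" for i by (simp add: lambda_max_eq[OF eb])
  then show ?thesis
    unfolding eigenbasis_quadratic[OF eb] eigenbasis_inner_eq[OF eb, of v v] sum_distrib_left
    by (intro sum_mono) (simp add: power2_eq_square mult_right_mono)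
qed

text \<open>With \<open>l k\<close> the smallest eigenvalue, \<open>g \<bullet> g\<close> is the sum
  of \<open>(l i)\<^sup>2 * (b i \<bullet> z)\<^sup>2\<close>, hence at least
  \<open>l k * (g \<bullet> z) \<ge> l k * L\<close>. A large pairing thus forces one eigenvalue to
  be small against \<open>g \<bullet> g\<close>, while each of the others is at most the trace. In
  the application \<open>N\<close> is a Hessian, \<open>g\<close> a gradient up to sign and
  \<open>g \<bullet> z\<close> the Newton decrement.\<close>

lemma det_le_trace_power:
  fixes N :: "real ^ 'n ^ 'n"
  assumes N: "transpose N = N" "\<And>v. v \<noteq> 0 \<Longrightarrow> 0 < v \<bullet> (N *v v)"
    and z: "N *v z = g" "0 < L" "L \<le> g \<bullet> z"
  shows "det N \<le> (g \<bullet> g / L) * trace N ^ (CARD('n) - 1)"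
proof -
  obtain b l where eb: "eigenbasis N b l" using eigenbasis_exists[OF N(1)] by blast
  have pos: "0 < l i" for i
    using N(2)[OF eigenbasis_nonzero[OF eb, of i]]
    by (simp add: eigenbasis_eigen[OF eb] eigenbasis_inner[OF eb])
  have "Min (range l) \<in> range l" by (intro Min_in) auto
  then obtain k where "l k = Min (range l)" by (metis rangeE)
  then have k: "l k \<le> l i" for i by simp
  have bg: "b i \<bullet> g = l i * (b i \<bullet> z)" for i
    unfolding z(1)[symmetric]
    by (simp add: eigenbasis_mult[OF eb] inner_sum_right eigenbasis_inner[OF eb] if_distrib cong: if_cong)
  have "l k * L \<le> l k * (g \<bullet> z)" using pos[of k] z by simp
  also have "\<dots> = (\<Sum>i\<in>UNIV. l k * (l i * (b i \<bullet> z)\<^sup>2))"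
    unfolding eigenbasis_inner_eq[OF eb, of g z] sum_distrib_left
    by (simp add: bg power2_eq_square mult_ac)
  also have "\<dots> \<le> (\<Sum>i\<in>UNIV. l i * (l i * (b i \<bullet> z)\<^sup>2))"
    using k pos by (intro sum_mono mult_right_mono) (auto simp: less_imp_le)
  also have "\<dots> = g \<bullet> g"
    unfolding eigenbasis_inner_eq[OF eb, of g g] by (simp add: bg power2_eq_square mult_ac)
  finally have lk: "l k \<le> g \<bullet> g / L" using z by (simp add: field_simps)
  have lt: "l i \<le> trace N" for i
    unfolding eigenbasis_trace[OF eb] using pos by (intro member_le_sum) (auto simp: less_imp_le)
  have "det N = l k * prod l (UNIV - {k})"
    unfolding eigenbasis_det[OF eb] by (simp add: prod.remove)
  also have "\<dots> \<le> (g \<bullet> g / L) * prod (\<lambda>_. trace N) (UNIV - {k})"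
    using lk lt pos z by (intro mult_mono prod_mono prod_nonneg) (auto simp: less_imp_le)
  finally show ?thesis by (simp add: card_Diff_singleton)
qed

lemma symmetric_if_eigenbasis:
  assumes eb: "eigenbasis M b l"
  shows "transpose M = M"
proof -
  have "u \<bullet> (transpose M *v v) = u \<bullet> (M *v v)" for u v
  proof -
    have "u \<bullet> (transpose M *v v) = (M *v u) \<bullet> v"
      by (metis dot_lmul_matrix inner_commute transpose_matrix_vector)
    also have "\<dots> = u \<bullet> (M *v v)"
      unfolding eigenbasis_mult[OF eb]
      by (simp add: inner_sum_left inner_sum_right inner_commute[of u] mult_ac)
    finally show ?thesis .
  qed
  then have "transpose M *v v = M *v v" for v
    by (metis vector_eq_ldot)
  then show ?thesis by (simp add: matrix_eq)
qed

text \<open>With new weights on an eigenbasis of \<open>M\<close> this is the functional calculus of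
  \<open>M\<close>, used to construct square roots.\<close>

definition spectral_matrix :: "('n \<Rightarrow> real ^ 'n) \<Rightarrow> ('n \<Rightarrow> real) \<Rightarrow> real ^ 'n ^ 'n" where
  "spectral_matrix b l = (\<chi> r c. \<Sum>i\<in>UNIV. l i * b i $ r * b i $ c)"

lemma spectral_matrix_mult: "spectral_matrix b l *v v = (\<Sum>i\<in>UNIV. (l i * (b i \<bullet> v)) *\<^sub>R b i)"
  unfolding vec_eq_iff
proof
  fix r
  have "(spectral_matrix b l *v v) $ r = (\<Sum>c\<in>UNIV. \<Sum>i\<in>UNIV. l i * b i $ r * b i $ c * v $ c)"
    by (simp add: spectral_matrix_def matrix_vector_mult_def sum_distrib_right)
  also have "\<dots> = (\<Sum>i\<in>UNIV. \<Sum>c\<in>UNIV. l i * b i $ r * b i $ c * v $ c)"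
    by (rule sum.swap)
  also have "\<dots> = (\<Sum>i\<in>UNIV. (l i * (b i \<bullet> v)) *\<^sub>R b i) $ r"
    by (simp add: inner_vec_def sum_distrib_left sum_distrib_right mult_ac)
  finally show "(spectral_matrix b l *v v) $ r = (\<Sum>i\<in>UNIV. (l i * (b i \<bullet> v)) *\<^sub>R b i) $ r" .
qed

lemma eigenbasis_spectral_matrix:
  assumes eb: "eigenbasis M b l"
  shows "eigenbasis (spectral_matrix b k) b k"
  unfolding eigenbasis_def
  by (simp add: eigenbasis_inner[OF eb] spectral_matrix_mult if_distrib[of "(*) _"]
      if_distrib[of "\<lambda>x. x *\<^sub>R _"] cong: if_cong)

section \<open>Matrix square roots\<close>

lemma eigenbasis_nonneg:
  assumes eb: "eigenbasis A b s" and nonneg: "\<And>i. 0 \<le> s i"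
  shows "0 \<le> v \<bullet> (A *v v)"
  unfolding eigenbasis_quadratic[OF eb] by (intro sum_nonneg mult_nonneg_nonneg nonneg) auto

lemma eigenbasis_square:
  assumes eb: "eigenbasis B b r"
  shows "eigenbasis (B ** B) b (\<lambda>i. r i * r i)"
  unfolding eigenbasis_def
  by (simp add: eigenbasis_inner[OF eb] eigenbasis_eigen[OF eb] matrix_vector_mult_scaleR
      flip: matrix_vector_mul_assoc)

text \<open>If \<open>B v = r v\<close> then \<open>C (C v) = r\<^sup>2 v\<close>, so
  \<open>z = C v - r v\<close> satisfies \<open>C z = - r z\<close>, and positivity of
  \<open>C\<close> forces \<open>z = 0\<close> when \<open>r > 0\<close>. For \<open>r = 0\<close>
  the squared norm of \<open>C v\<close> is \<open>v \<bullet> C (C v) = 0\<close>. Hence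
  \<open>C\<close> agrees with \<open>B\<close> on an eigenbasis of \<open>B\<close>.\<close>

lemma square_root_unique:
  fixes B C :: "real ^ 'n ^ 'n"
  assumes B: "transpose B = B" "\<And>v. 0 \<le> v \<bullet> (B *v v)"
    and C: "transpose C = C" "\<And>v. 0 \<le> v \<bullet> (C *v v)"
    and eq: "B ** B = C ** C"
  shows "B = C"
proof -
  obtain b r where eb: "eigenbasis B b r" using eigenbasis_exists[OF B(1)] by blast
  have "B *v b i = C *v b i" for i
  proof -
    have r: "0 \<le> r i"
      using B(2)[of "b i"] by (simp add: eigenbasis_eigen[OF eb] eigenbasis_inner[OF eb])
    have CC: "C *v (C *v b i) = (r i * r i) *\<^sub>R b i"
      using eigenbasis_eigen[OF eigenbasis_square[OF eb], of i] by (simp add: eq matrix_vector_mul_assoc)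
    define z where "z = C *v b i - r i *\<^sub>R b i"
    have Cz: "C *v z = - r i *\<^sub>R z"
      unfolding z_def by (simp add: matrix_vector_mult_diff_distrib CC matrix_vector_mult_scaleR algebra_simps)
    have "z = 0"
    proof (cases "r i = 0")
      case True
      have "z \<bullet> z = (C *v b i) \<bullet> (C *v b i)" using True by (simp add: z_def)
      also have "\<dots> = b i \<bullet> (C *v (C *v b i))" using symmetric_inner_commute[OF C(1)] by metis
      finally show ?thesis using True CC by simp
    next
      case False
      have "0 \<le> - r i * (z \<bullet> z)" using C(2)[of z] Cz by simp
      then have "z \<bullet> z \<le> 0" using False r by (simp add: mult_le_0_iff)
      then show ?thesis by (metis inner_eq_zero_iff inner_ge_zero order_antisym)
    qed
    then show ?thesis by (simp add: z_def eigenbasis_eigen[OF eb])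
  qed
  then show ?thesis by (rule eigenbasis_matrix_eqI[OF eb])
qed

lemma eigenbasis_mat_sqrt:
  assumes eb: "eigenbasis A b s" and nonneg: "\<And>i. 0 \<le> s i"
  shows "eigenbasis (mat_sqrt A) b (\<lambda>i. sqrt (s i))" "mat_sqrt A ** mat_sqrt A = A"
proof -
  define B where "B = spectral_matrix b (\<lambda>i. sqrt (s i))"
  have ebB: "eigenbasis B b (\<lambda>i. sqrt (s i))"
    unfolding B_def by (rule eigenbasis_spectral_matrix[OF eb])
  have BB: "B ** B = A"
    using eigenbasis_eigen[OF eigenbasis_square[OF ebB]] nonneg
    by (intro eigenbasis_matrix_eqI[OF eb]) (simp add: eigenbasis_eigen[OF eb])
  have "mat_sqrt A = B"
    unfolding mat_sqrt_def
  proof (rule the_equality)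
    show "transpose B = B \<and> (\<forall>v. 0 \<le> v \<bullet> (B *v v)) \<and> B ** B = A"
      using symmetric_if_eigenbasis[OF ebB] eigenbasis_nonneg[OF ebB] nonneg BB by simp
    then show "C = B" if "transpose C = C \<and> (\<forall>v. 0 \<le> v \<bullet> (C *v v)) \<and> C ** C = A" for C
      using that square_root_unique[of C B] by simp
  qed
  then show "eigenbasis (mat_sqrt A) b (\<lambda>i. sqrt (s i))" "mat_sqrt A ** mat_sqrt A = A"
    using ebB BB by simp_all
qed

section \<open>Spectrum and continuity of the proposal covariance\<close>

lemma mpow_eigenvector:
  assumes "M *v v = l *\<^sub>R v"
  shows "mpow M k *v v = l ^ k *\<^sub>R v"
  by (induction k) (simp_all add: assms matrix_vector_mult_scaleR mult.commute flip: matrix_vector_mul_assoc)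

lemma bounded_linear_matrix_vector_left:
  "bounded_linear (\<lambda>A :: real ^ 'n ^ 'm. A *v v)"
proof -
  have "linear (\<lambda>A :: real ^ 'n ^ 'm. A *v v)"
    by (rule linearI) (simp_all add: matrix_vector_mult_add_rdistrib scaleR_matrix_vector_assoc)
  then show ?thesis by (simp add: linear_conv_bounded_linear)
qed

text \<open>On an eigenvector the matrix series acts as a scalar series. The scalar \<open>t\<close>
  is characterised through \<open>l * t\<close> instead of a quotient so that \<open>l = 0\<close>
  is covered; there the equation is void and the first term of the series gives
  \<open>h / 2\<close>.\<close>

lemma T1_eigenvector:
  assumes v: "v \<noteq> 0" "M *v v = l *\<^sub>R v"
  obtains t where "T1 M h *v v = t *\<^sub>R v" "l * t = exp (h / 2 * l) - 1" "l = 0 \<Longrightarrow> t = h / 2"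
proof -
  define a where "a k = (h / 2) ^ (k + 1) / fact (k + 1)" for k
  have "(\<lambda>k. a k *\<^sub>R mpow M k) sums T1 M h"
    unfolding T1_def a_def using summable_sums[OF summable_shifted[of "h / 2" 1 M]] by simp
  from bounded_linear.sums[OF bounded_linear_matrix_vector_left this, of v]
  have *: "(\<lambda>k. (a k * l ^ k) *\<^sub>R v) sums (T1 M h *v v)"
    by (simp add: mpow_eigenvector[OF v(2)] flip: scaleR_matrix_vector_assoc)
  from bounded_linear.sums[OF bounded_linear_inner_left this, of v]
  have "(\<lambda>k. (a k * l ^ k) * (v \<bullet> v) / (v \<bullet> v)) sums ((T1 M h *v v) \<bullet> v / (v \<bullet> v))"
    by (intro sums_divide) simp
  then have t: "(\<lambda>k. a k * l ^ k) sums ((T1 M h *v v) \<bullet> v / (v \<bullet> v))" (is "_ sums ?t")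
    using v(1) by simp
  have T1v: "T1 M h *v v = ?t *\<^sub>R v"
    by (rule sums_unique2[OF * bounded_linear.sums[OF bounded_linear_scaleR_left t]])
  have "(\<lambda>k. l * (a k * l ^ k)) sums (l * ?t)" by (intro sums_mult t)
  moreover have "l * (a k * l ^ k) = (h / 2 * l) ^ Suc k /\<^sub>R fact (Suc k)" for k
    unfolding a_def power_mult_distrib real_scaleR_def power_Suc[of l] divide_inverse Suc_eq_plus1[symmetric]
    by (simp only: mult_ac)
  ultimately have "(\<lambda>k. (h / 2 * l) ^ Suc k /\<^sub>R fact (Suc k)) sums (l * ?t)" by (simp only:)
  moreover have "(\<lambda>k. (h / 2 * l) ^ Suc k /\<^sub>R fact (Suc k)) sums (exp (h / 2 * l) - 1)"
    using exp_converges[of "h / 2 * l"] by (subst sums_Suc_iff) simp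
  ultimately have "l * ?t = exp (h / 2 * l) - 1" by (rule sums_unique2)
  moreover have "?t = h / 2" if "l = 0"
  proof -
    have "(\<lambda>k. a k * l ^ k) sums (\<Sum>k\<in>{0}. a k * l ^ k)"
      by (rule sums_finite) (auto simp: that)
    then show ?thesis using sums_unique2[OF t] by (simp add: a_def)
  qed
  ultimately show ?thesis using that T1v by blast
qed

text \<open>\<open>T2\<close> is \<open>M\<close> times the series of \<open>T1\<close> with
  \<open>M ** M\<close> for \<open>M\<close> and \<open>- (h\<^sup>2 / 4)\<close> for
  \<open>h / 2\<close>, so eigenvalue and continuity results for \<open>T1\<close> carry
  over.\<close>

lemma T2_eq_T1: "T2 M h = M ** T1 (M ** M) (- (h\<^sup>2 / 2))"
proof -
  let ?c = "- (h\<^sup>2 / 4)"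
  have "summable (\<lambda>k. (?c ^ (k + 1) / fact (k + 1)) *\<^sub>R mpow (M ** M) k)"
    by (rule summable_shifted)
  from bounded_linear.suminf[OF bounded_linear_matrix_mult[of M] this]
  show ?thesis
    by (simp add: T1_def T2_def scaleR_matrix_mult mpow_square del: power_Suc fact_Suc)
qed

text \<open>Eigenvalue of the proposal covariance belonging to an eigenvalue \<open>l\<close> of
  \<open>Df\<close>. At \<open>l = 0\<close> the quotient has a removable singularity: its numerator
  is \<open>h * l\<close> up to second order.\<close>

definition cov_eig :: "real \<Rightarrow> real \<Rightarrow> real" where
  "cov_eig h l = (if l = 0 then h else ((exp (h * l) - 1) + (exp (- (h * l)\<^sup>2) - 1) / 3) / l)"

lemma eigenbasis_bO_cov:
  assumes eb: "eigenbasis M b l"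
  shows "eigenbasis (T1 M (2 * h) + (1 / 3) *\<^sub>R T2 M (2 * h)) b (\<lambda>i. cov_eig h (l i))"
proof -
  have *: "(T1 M (2 * h) + (1 / 3) *\<^sub>R T2 M (2 * h)) *v b i = cov_eig h (l i) *\<^sub>R b i" for i
  proof -
    note M = eigenbasis_nonzero[OF eb, of i] eigenbasis_eigen[OF eb, of i]
    have MM: "(M ** M) *v b i = (l i * l i) *\<^sub>R b i"
      by (rule eigenbasis_eigen[OF eigenbasis_square[OF eb]])
    obtain t where t: "T1 M (2 * h) *v b i = t *\<^sub>R b i" "l i * t = exp (h * l i) - 1"
      "l i = 0 \<Longrightarrow> t = h"
      by (rule T1_eigenvector[OF M, of "2 * h"]) auto
    obtain s where s: "T1 (M ** M) (- ((2 * h)\<^sup>2 / 2)) *v b i = s *\<^sub>R b i"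
      "l i * l i * s = exp (- (h\<^sup>2) * (l i * l i)) - 1"
      by (rule T1_eigenvector[OF M(1) MM, of "- ((2 * h)\<^sup>2 / 2)"]) (auto simp: power2_eq_square)
    have "T2 M (2 * h) *v b i = (l i * s) *\<^sub>R b i"
      unfolding T2_eq_T1 matrix_vector_mul_assoc[symmetric] s(1)
      by (simp add: M(2) matrix_vector_mult_scaleR mult.commute)
    then have "(T1 M (2 * h) + (1 / 3) *\<^sub>R T2 M (2 * h)) *v b i = (t + l i * s / 3) *\<^sub>R b i"
      unfolding matrix_vector_mult_add_rdistrib t(1) scaleR_matrix_vector_assoc[symmetric]
      by (simp add: scaleR_add_left mult.commute)
    moreover have "t + l i * s / 3 = cov_eig h (l i)"
    proof (cases "l i = 0")
      case False
      have "l i * (t + l i * s / 3) = (exp (h * l i) - 1) + (exp (- (h * l i)\<^sup>2) - 1) / 3"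
        using t(2) s(2) by (simp add: distrib_left power2_eq_square mult_ac)
      then show ?thesis using False by (simp add: cov_eig_def field_simps)
    next
      case True
      then show ?thesis using t(3)[OF True] by (simp add: cov_eig_def)
    qed
    ultimately show ?thesis by (simp only:)
  qed
  show ?thesis
    unfolding eigenbasis_def by (intro conjI allI eigenbasis_inner[OF eb] *)
qed

section \<open>Bounds on the covariance eigenvalues\<close>

context
  fixes h :: real
  assumes h: "0 < h"
begin

lemma one_minus_exp_square_bound:
  fixes u :: real
  assumes "0 \<le> u"
  shows "1 - exp (- u\<^sup>2) \<le> u" "0 \<le> 1 - exp (- u\<^sup>2)"
proof -
  show "1 - exp (- u\<^sup>2) \<le> u"
  proof (cases "u \<le> 1")
    case True
    have "u * u \<le> u" using assms True by (simp add: mult_left_le)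
    then show ?thesis using exp_ge_add_one_self[of "- u\<^sup>2"] by (simp add: power2_eq_square)
  next
    case False
    then show ?thesis using exp_gt_zero[of "- u\<^sup>2"] by linarith
  qed
qed simp

text \<open>For negative eigenvalues the two exponential terms have the same sign: dropping the
  second gives the lower bound, and bounding them by \<open>h * m\<close> and
  \<open>h * m / 3\<close> gives the factor \<open>4 / 3\<close>.\<close>

lemma cov_eig_neg:
  assumes "0 < m"
  shows "1 - exp (- (h * m)) \<le> m * cov_eig h (- m)" "m * cov_eig h (- m) \<le> 4 / 3 * (h * m)"
proof -
  have eq: "m * cov_eig h (- m) = (1 - exp (- (h * m))) + (1 - exp (- (h * m)\<^sup>2)) / 3"
    using assms by (simp add: cov_eig_def field_simps)
  have "0 \<le> h * m" using h assms by simp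
  note * = one_minus_exp_square_bound[OF this]
  show "1 - exp (- (h * m)) \<le> m * cov_eig h (- m)"
    unfolding eq using *(2) by simp
  show "m * cov_eig h (- m) \<le> 4 / 3 * (h * m)"
    unfolding eq using *(1) exp_ge_add_one_self[of "- (h * m)"] by argo
qed

text \<open>For positive eigenvalues the second term is negative, but it removes at most a third of
  \<open>h * l\<close> while \<open>exp (h * l) - 1 \<ge> h * l\<close>; this leaves
  \<open>2 / 3\<close>. The upper bound is \<open>exp u - 1 \<le> u * exp u\<close>.\<close>

lemma cov_eig_nonneg:
  assumes "0 < l"
  shows "2 / 3 * (h * l) \<le> l * cov_eig h l" "l * cov_eig h l \<le> h * l * exp (h * l)"
proof -
  have eq: "l * cov_eig h l = (exp (h * l) - 1) - (1 - exp (- (h * l)\<^sup>2)) / 3"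
    using assms by (simp add: cov_eig_def field_simps)
  have "0 \<le> h * l" using h assms by simp
  note * = one_minus_exp_square_bound[OF this]
  show "2 / 3 * (h * l) \<le> l * cov_eig h l"
    unfolding eq using *(1) exp_ge_add_one_self[of "h * l"] by argo
  have "exp (h * l) * (1 + - (h * l)) \<le> exp (h * l) * exp (- (h * l))"
    by (intro mult_left_mono exp_ge_add_one_self) simp
  then have "exp (h * l) - h * l * exp (h * l) \<le> 1" by (simp add: algebra_simps flip: exp_add)
  then show "l * cov_eig h l \<le> h * l * exp (h * l)"
    unfolding eq using *(2) by argo
qed

lemma cov_eig_pos: "0 < cov_eig h l"
proof (cases l "0 :: real" rule: linorder_cases)
  case less
  have "0 < 1 - exp (- (h * - l))" using h less by (simp add: mult_pos_neg)
  also have "\<dots> \<le> - l * cov_eig h l" using cov_eig_neg(1)[of "- l"] less by simp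
  finally show ?thesis using less by (simp add: mult_less_0_iff)
next
  case greater
  have "0 < 2 / 3 * (h * l)" using h greater by simp
  also have "\<dots> \<le> l * cov_eig h l" by (rule cov_eig_nonneg[OF greater])
  finally show ?thesis using greater by (simp add: zero_less_mult_iff)
qed (simp add: cov_eig_def h)

lemma cov_eig_upper:
  assumes "l \<le> K" "0 \<le> K"
  shows "cov_eig h l \<le> 4 / 3 * h * exp (h * K)"
proof (cases l "0 :: real" rule: linorder_cases)
  case less
  have "- l * cov_eig h l \<le> - l * (4 / 3 * h)" using cov_eig_neg(2)[of "- l"] less by (simp add: mult_ac)
  then have "cov_eig h l \<le> 4 / 3 * h * 1" using less by simp
  also have "\<dots> \<le> 4 / 3 * h * exp (h * K)" using h assms by (intro mult_left_mono) auto
  finally show ?thesis .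
next
  case greater
  have "l * cov_eig h l \<le> l * (h * exp (h * l))" using cov_eig_nonneg(2)[OF greater] by (simp add: mult_ac)
  then have "cov_eig h l \<le> h * exp (h * l)" using greater by simp
  also have "\<dots> \<le> 4 / 3 * h * exp (h * K)" using h assms by (intro mult_mono) auto
  finally show ?thesis .
next
  case equal
  have "h * 1 \<le> 4 / 3 * h * exp (h * K)" using h assms by (intro mult_mono) auto
  then show ?thesis using equal by (simp add: cov_eig_def)
qed

text \<open>Eigenvalue form of the comparison of the inverse covariance with \<open>- Df\<close>.
  For \<open>l \<le> - d\<close> the product \<open>- l * cov_eig h l\<close> is at least
  \<open>1 - exp (h * l)\<close>, hence at least the constant
  \<open>1 - exp (- (h * d))\<close>.\<close>

lemma cov_eig_lower:
  assumes "l \<le> - d" "0 < d"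
  shows "1 / cov_eig h l \<le> - l / (1 - exp (- (h * d)))"
proof -
  define e where "e = 1 - exp (- (h * d))"
  have e: "0 < e" using h assms by (simp add: e_def)
  have "h * l \<le> h * - d" using h assms by (intro mult_left_mono) auto
  then have "e \<le> 1 - exp (- (h * - l))" by (simp add: e_def)
  also have "\<dots> \<le> - l * cov_eig h l"
    using cov_eig_neg(1)[of "- l"] assms by simp
  finally have "e / cov_eig h l \<le> - l" using cov_eig_pos[of l] by (simp add: divide_le_eq)
  then have "(e / cov_eig h l) / e \<le> - l / e" using e by (intro divide_right_mono) auto
  then have "1 / cov_eig h l \<le> - l / e" using e by simp
  then show ?thesis by (simp only: e_def)
qed

end

section \<open>Continuity of matrix power series\<close>

lemma bounded_bilinear_matrix_mult:
  "bounded_bilinear ((**) :: real ^ 'n ^ 'n \<Rightarrow> real ^ 'n ^ 'n \<Rightarrow> real ^ 'n ^ 'n)"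
proof -
  have "bilinear ((**) :: real ^ 'n ^ 'n \<Rightarrow> real ^ 'n ^ 'n \<Rightarrow> real ^ 'n ^ 'n)"
    by (auto simp: bilinear_def intro!: linearI simp: matrix_add_ldistrib scaleR_matrix_mult)
      (simp add: matrix_matrix_mult_def vec_eq_iff sum.distrib distrib_right)
  then show ?thesis by (simp add: bilinear_conv_bounded_bilinear)
qed

lemma bounded_bilinear_matrix_vector_mult:
  "bounded_bilinear ((*v) :: real ^ 'n ^ 'n \<Rightarrow> real ^ 'n \<Rightarrow> real ^ 'n)"
proof -
  have "bilinear ((*v) :: real ^ 'n ^ 'n \<Rightarrow> real ^ 'n \<Rightarrow> real ^ 'n)"
    by (auto simp: bilinear_def intro!: linearI simp: matrix_vector_mult_add_rdistrib
        matrix_vector_right_distrib matrix_vector_mult_scaleR scaleR_matrix_vector_assoc)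
  then show ?thesis by (simp add: bilinear_conv_bounded_bilinear)
qed

lemmas continuous_on_matrix_mult = bounded_bilinear.continuous_on[OF bounded_bilinear_matrix_mult]
lemmas continuous_on_matrix_vector_mult = bounded_bilinear.continuous_on[OF bounded_bilinear_matrix_vector_mult]

lemma continuous_on_mpow:
  "continuous_on S (\<lambda>M :: real ^ 'n ^ 'n. mpow M k)"
  by (induction k) (simp_all add: continuous_on_matrix_mult)

lemma mpow_locally_bounded:
  obtains K where "\<And>(M :: real ^ 'n ^ 'n) k. norm M \<le> r \<Longrightarrow> norm (mpow M k) \<le> K ^ k * norm (mat 1 :: real ^ 'n ^ 'n)"
proof -
  from bounded_bilinear.pos_bounded[OF bounded_bilinear_matrix_mult[where 'n = 'n]]
  obtain C where *: "0 < C \<and> (\<forall>(A :: real ^ 'n ^ 'n) (B :: real ^ 'n ^ 'n). norm (A ** B) \<le> norm A * norm B * C)" ..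
  note C = *[THEN conjunct1] *[THEN conjunct2, THEN spec, THEN spec]
  have "norm (mpow M k) \<le> (\<bar>r\<bar> * C) ^ k * norm (mat 1 :: real ^ 'n ^ 'n)" if "norm M \<le> r" for M :: "real ^ 'n ^ 'n" and k
  proof (induction k)
    case (Suc k)
    have "norm (mpow M (Suc k)) \<le> norm M * norm (mpow M k) * C"
      unfolding mpow.simps by (rule C(2))
    also have "\<dots> \<le> \<bar>r\<bar> * ((\<bar>r\<bar> * C) ^ k * norm (mat 1 :: real ^ 'n ^ 'n)) * C"
    proof (rule mult_right_mono[OF _ less_imp_le[OF C(1)]])
      show "norm M * norm (mpow M k) \<le> \<bar>r\<bar> * ((\<bar>r\<bar> * C) ^ k * norm (mat 1 :: real ^ 'n ^ 'n))"
        by (rule mult_mono[OF _ Suc]) (use that in simp_all)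
    qed
    finally show ?case by (simp add: mult_ac)
  qed simp
  then show ?thesis by (rule that)
qed

text \<open>The coefficients decay factorially and the powers are bounded by a multiple of
  \<open>K ^ k\<close> uniformly on a ball, so the Weierstrass test gives uniform convergence on
  each ball.\<close>

lemma continuous_on_mpow_series:
  assumes a: "\<And>k. \<bar>a k\<bar> \<le> B * (c ^ k / fact k)"
  shows "continuous_on UNIV (\<lambda>M :: real ^ 'n ^ 'n. \<Sum>k. a k *\<^sub>R mpow M k)"
proof -
  let ?f = "\<lambda>M :: real ^ 'n ^ 'n. \<Sum>k. a k *\<^sub>R mpow M k"
  have "isCont ?f M" for M
  proof -
    define r where "r = norm M + 1"
    obtain K where K: "\<And>(N :: real ^ 'n ^ 'n) k. norm N \<le> r \<Longrightarrow> norm (mpow N k) \<le> K ^ k * norm (mat 1 :: real ^ 'n ^ 'n)"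
      by (rule mpow_locally_bounded[of r]) (rule that)
    have le: "norm (a k *\<^sub>R mpow N k) \<le> B * norm (mat 1 :: real ^ 'n ^ 'n) * ((c * K) ^ k /\<^sub>R fact k)"
      if "N \<in> ball 0 r" for k and N :: "real ^ 'n ^ 'n"
    proof -
      have N: "norm N \<le> r" using that by simp
      have "norm (a k *\<^sub>R mpow N k) \<le> (B * (c ^ k / fact k)) * (K ^ k * norm (mat 1 :: real ^ 'n ^ 'n))"
        unfolding norm_scaleR
        by (rule mult_mono[OF a K[OF N] order_trans[OF abs_ge_zero a] norm_ge_zero])
      then show ?thesis by (simp add: field_simps)
    qed
    have "uniform_limit (ball 0 r) (\<lambda>n N. \<Sum>k<n. a k *\<^sub>R mpow N k) ?f sequentially"
      by (rule Weierstrass_m_test[OF le summable_mult[OF summable_exp_generic]])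
    then have "continuous_on (ball 0 r) ?f"
      by (rule uniform_limit_theorem[rotated])
        (auto intro!: always_eventually continuous_intros continuous_on_mpow)
    moreover have "M \<in> ball 0 r" by (simp add: r_def)
    ultimately show ?thesis by (simp add: continuous_on_eq_continuous_at)
  qed
  then show ?thesis by (simp add: continuous_at_imp_continuous_on)
qed

lemma continuous_on_T1: "continuous_on UNIV (\<lambda>M :: real ^ 'n ^ 'n. T1 M h)"
  unfolding T1_def by (rule continuous_on_mpow_series[OF fact_shift_bound])

lemma continuous_on_T3: "continuous_on UNIV (\<lambda>M :: real ^ 'n ^ 'n. T3 M h)"
  unfolding T3_def by (rule continuous_on_mpow_series[OF fact_shift_bound])

lemma continuous_on_T2: "continuous_on UNIV (\<lambda>M :: real ^ 'n ^ 'n. T2 M h)"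
  unfolding T2_eq_T1
  by (intro continuous_on_matrix_mult continuous_intros continuous_on_compose2[OF continuous_on_T1]) auto

section \<open>A Harris-type theorem\<close>

lemma integrable_dominated_affine:
  fixes \<phi> V :: "'a::euclidean_space \<Rightarrow> real"
  assumes "prob_space M" "sets M = sets borel" "integrable M V"
    and "\<phi> \<in> borel_measurable borel" "\<And>x. \<bar>\<phi> x\<bar> \<le> A + B * V x"
  shows "integrable M \<phi>"
proof -
  interpret prob_space M by fact
  have [measurable_cong]: "sets M = sets borel" by fact
  note [measurable] = assms(4)
  show ?thesis
    by (rule Bochner_Integration.integrable_bound[of M "\<lambda>x. A + B * V x"])
      (use assms in \<open>auto intro!: AE_I2 order_trans[OF _ abs_ge_self]\<close>)
qed

lemma integrable_if_nn_integral_le: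
  fixes \<psi> :: "'a::euclidean_space \<Rightarrow> real"
  assumes "sets M = sets borel" "\<psi> \<in> borel_measurable borel" "\<And>x. 0 \<le> \<psi> x"
    and "(\<integral>\<^sup>+x. ennreal (\<psi> x) \<partial>M) \<le> ennreal r" "0 \<le> r"
  shows "integrable M \<psi>" "integral\<^sup>L M \<psi> \<le> r"
proof -
  have m: "\<psi> \<in> borel_measurable M" using assms(1,2) by (simp cong: measurable_cong_sets)
  show int: "integrable M \<psi>"
    using assms(3,4) m by (intro integrableI_nonneg) (auto simp: order_le_less_trans)
  have "ennreal (integral\<^sup>L M \<psi>) \<le> ennreal r"
    using assms(3,4) nn_integral_eq_integral[OF int] by simp
  then show "integral\<^sup>L M \<psi> \<le> r" using assms(5) by simp
qed

text \<open>Drift and minorization are stated with nonnegative integrals, so that integrability of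
  \<open>V\<close> under \<open>P x\<close> is a consequence. The minorization is required on every
  sublevel set of \<open>V\<close>; the one that is used depends on the drift constants
  \<open>r\<close> and \<open>b\<close>.\<close>

locale harris_kernel =
  fixes P :: "'a::euclidean_space \<Rightarrow> 'a measure" and V :: "'a \<Rightarrow> real" and \<nu> :: "'a measure"
    and r b :: real
  assumes kernel: "P \<in> borel \<rightarrow>\<^sub>M prob_algebra borel"
    and V_meas [measurable]: "V \<in> borel_measurable borel" and V_ge_1: "\<And>x. 1 \<le> V x"
    and rate: "0 \<le> r" "r < 1" "0 < b"
    and drift: "\<And>x. (\<integral>\<^sup>+y. ennreal (V y) \<partial>P x) \<le> ennreal (r * V x + b)"
    and minor: "\<And>R. \<exists>\<epsilon> \<eta>. 0 < \<epsilon> \<and> \<epsilon> \<le> 1 \<and> prob_space \<eta> \<and> sets \<eta> = sets borel \<and>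
       (\<forall>x \<psi>. V x \<le> R \<longrightarrow> \<psi> \<in> borel_measurable borel \<longrightarrow>
          ennreal \<epsilon> * (\<integral>\<^sup>+y. \<psi> y \<partial>\<eta>) \<le> (\<integral>\<^sup>+y. \<psi> y \<partial>P x))"
    and invariant_space: "\<nu> \<in> space (prob_algebra borel)"
    and invariant: "\<nu> \<bind> P = \<nu>"
begin

abbreviation "E x \<equiv> integral\<^sup>L (P x)"
abbreviation "En n x \<equiv> integral\<^sup>L (kernel_pow P n x)"

lemma V_nonneg: "0 \<le> V x"
  using V_ge_1[of x] by linarith

lemma kernel_subprob: "P \<in> borel \<rightarrow>\<^sub>M subprob_algebra borel"
  using kernel by (rule measurable_prob_algebraD)

lemma prob_kernel: "prob_space (P x)" "sets (P x) = sets borel"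
  using measurable_space[OF kernel, of x] by (simp_all add: space_prob_algebra)

lemma prob_invariant: "prob_space \<nu>" "sets \<nu> = sets borel"
  using invariant_space by (simp_all add: space_prob_algebra)

lemma integrable_kernel_V: "integrable (P x) V" and integral_kernel_V: "E x V \<le> r * V x + b"
  using integrable_if_nn_integral_le[OF prob_kernel(2) V_meas V_nonneg drift] rate V_nonneg[of x]
  by auto

lemma integrable_kernel:
  assumes "F \<in> borel_measurable borel" "\<And>x. \<bar>F x\<bar> \<le> A + B * V x"
  shows "integrable (P x) F"
  by (rule integrable_dominated_affine[OF prob_kernel integrable_kernel_V assms])

lemma measurable_kernel_integral:
  fixes F :: "'a \<Rightarrow> real"
  assumes "F \<in> borel_measurable borel"
  shows "(\<lambda>x. E x F) \<in> borel_measurable borel"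
  using measurable_compose[OF kernel_subprob integral_measurable_subprob_algebra[OF assms]] .

text \<open>The hypothesis on \<open>F\<close> says that its oscillation, measured against the
  weight \<open>2 + c * V x + c * V y\<close>, is at most 1; \<open>P\<close> contracts this
  weighted oscillation. If \<open>V x + V y\<close> exceeds \<open>R\<close>, the drift contracts
  the weight itself; otherwise the mass shared by \<open>P x\<close> and \<open>P y\<close> through
  the minorization reduces the constant 2.\<close>

lemma kernel_integral_contraction:
  obtains c \<alpha> where "0 < c" "0 < \<alpha>" "\<alpha> < 1"
    and "\<And>F x y. F \<in> borel_measurable borel \<Longrightarrow> (\<And>x y. F x - F y \<le> 2 + c * V x + c * V y) \<Longrightarrow>
      E x F - E y F \<le> \<alpha> * (2 + c * V x + c * V y)"
proof -
  \<comment> \<open>When \<open>V x + V y > R\<close>, the additive drift terms \<open>2 * b\<close>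
    use up at most half of the decay \<open>(1 - r) * (V x + V y)\<close>; what remains is the rate
    \<open>r'\<close>.\<close>
  define R where "R = 4 * b / (1 - r)"
  have R: "0 < R" "(1 - r) * R = 4 * b" using rate by (simp_all add: R_def)
  obtain \<epsilon> \<eta> where \<epsilon>: "0 < \<epsilon>" "\<epsilon> \<le> 1" and \<eta>: "prob_space \<eta>" "sets \<eta> = sets borel"
    and min: "\<And>x \<psi>. V x \<le> R \<Longrightarrow> \<psi> \<in> borel_measurable borel \<Longrightarrow>
       ennreal \<epsilon> * (\<integral>\<^sup>+y. \<psi> y \<partial>\<eta>) \<le> (\<integral>\<^sup>+y. \<psi> y \<partial>P x)"
    using minor[of R] by blast
  interpret \<eta>: prob_space \<eta> by fact
  \<comment> \<open>The weight is so small that the additive drift terms cost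
    \<open>2 * c * b = \<epsilon>\<close>, against a gain of \<open>2 * \<epsilon>\<close> from the
    minorization.\<close>
  define c where "c = \<epsilon> / (2 * b)"
  have c: "0 < c" "2 * c * b = \<epsilon>" using \<epsilon> rate by (simp_all add: c_def)
  define r' where "r' = (1 + r) / 2"
  have r': "0 < r'" "r' < 1" using rate by (simp_all add: r'_def)
  define \<alpha>1 where "\<alpha>1 = (2 + c * (r' * R)) / (2 + c * R)"
  define \<alpha>2 where "\<alpha>2 = max (1 - \<epsilon> / 2) r"
  define \<alpha> where "\<alpha> = max \<alpha>1 \<alpha>2"
  have den: "0 < 2 + c * R" using c R by (simp add: add_pos_pos)
  have "\<alpha>1 < 1" unfolding \<alpha>1_def using c R r' den by (simp add: divide_less_eq)
  moreover have "0 < \<alpha>1" unfolding \<alpha>1_def using c R r' den by (simp add: add_pos_pos)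
  moreover have "\<alpha>2 < 1" using \<epsilon> rate by (simp add: \<alpha>2_def)
  ultimately have \<alpha>: "0 < \<alpha>" "\<alpha> < 1" by (simp_all add: \<alpha>_def less_max_iff_disj)
  have main: "E x F - E y F \<le> \<alpha> * (2 + c * V x + c * V y)"
    if F [measurable]: "F \<in> borel_measurable borel"
      and osc: "\<And>x y. F x - F y \<le> 2 + c * V x + c * V y" for F x y
  proof -
    interpret Px: prob_space "P x" by (rule prob_kernel)
    interpret Py: prob_space "P y" by (rule prob_kernel)
    have [measurable_cong]: "sets (P x) = sets borel" "sets (P y) = sets borel" "sets \<eta> = sets borel"
      by (simp_all add: prob_kernel \<eta>)
    define w where "w z = 1 + c * V z" for z
    have w: "1 \<le> w z" for z using c V_nonneg[of z] by (simp add: w_def)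
    \<comment> \<open>The constant \<open>k\<close> recentres \<open>F\<close> so that
      \<open>F - k\<close> lies between \<open>- w\<close> and \<open>w\<close>. Then
      \<open>p\<close> and \<open>m\<close> below are nonnegative and add up to
      \<open>2 * w\<close>, and the minorization applies to both.\<close>
    define k where "k = (SUP z. F z - w z)"
    have bdd: "bdd_above (range (\<lambda>z. F z - w z))"
      using osc[of _ undefined] by (intro bdd_aboveI2[where M = "F undefined + w undefined"])
        (simp add: w_def algebra_simps)
    have k1: "F z - w z \<le> k" for z unfolding k_def by (rule cSUP_upper[OF _ bdd]) simp
    have k2: "k \<le> F z + w z" for z
      unfolding k_def
    proof (rule cSUP_least)
      show "F z' - w z' \<le> F z + w z" for z' using osc[of z' z] by (simp add: w_def)
    qed simp
    define p where "p z = w z + (F z - k)" for z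
    define m where "m z = w z - (F z - k)" for z
    have pm: "0 \<le> p z" "0 \<le> m z" "p z + m z = 2 * w z" for z
      using k1[of z] k2[of z] by (simp_all add: p_def m_def)
    have meas [measurable]: "p \<in> borel_measurable borel" "m \<in> borel_measurable borel" "w \<in> borel_measurable borel"
      unfolding p_def m_def w_def by measurable
    have ple: "\<bar>p z\<bar> \<le> 2 + (2 * c) * V z" and mle: "\<bar>m z\<bar> \<le> 2 + (2 * c) * V z"
      and wle: "\<bar>w z\<bar> \<le> 1 + c * V z" for z
      using pm[of z] w[of z] by (simp_all add: w_def algebra_simps)
    have F_eq: "F = (\<lambda>z. p z - w z + k)" "F = (\<lambda>z. w z - m z + k)" by (simp_all add: p_def m_def fun_eq_iff)
    note ints = integrable_kernel[OF meas(1) ple] integrable_kernel[OF meas(2) mle]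
      integrable_kernel[OF meas(3) wle]
    have wint: "E z w = 1 + c * E z V" for z
    proof -
      interpret Pz: prob_space "P z" by (rule prob_kernel)
      show ?thesis unfolding w_def using integrable_kernel_V[of z] by (simp add: Pz.prob_space)
    qed
    have wint_le: "E z w \<le> 1 + c * (r * V z + b)" for z
      unfolding wint using integral_kernel_V[of z] c by simp
    have ex: "E x F = E x w - E x m + k"
      unfolding F_eq(2) using ints by (simp add: Px.prob_space)
    have ey: "E y F = E y p - E y w + k"
      unfolding F_eq(1) using ints by (simp add: Py.prob_space)
    define T where "T = V x + V y"
    have T0: "0 \<le> T" using V_nonneg[of x] V_nonneg[of y] by (simp add: T_def)
    have goal_eq: "2 + c * V x + c * V y = 2 + c * T" by (simp add: T_def algebra_simps)
    have up: "E x w + E y w \<le> 2 + c * (r * T) + 2 * c * b"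
      using wint_le[of x] wint_le[of y] by (simp add: T_def algebra_simps)
    show ?thesis
    proof (cases "T \<le> R")
      case False
      have "E x F - E y F \<le> E x w + E y w"
      proof -
        have "0 \<le> E x m" "0 \<le> E y p"
          by (simp_all add: integral_nonneg_AE pm)
        then show ?thesis unfolding ex ey by simp
      qed
      also have "\<dots> \<le> 2 + c * (r' * T)"
      proof -
        have "(1 - r) * R \<le> (1 - r) * T" using False rate by (intro mult_left_mono) auto
        then have "2 * b \<le> (1 - r) * T / 2" using R by simp
        then have "c * (2 * b) \<le> c * ((1 - r) * T / 2)" using c by (intro mult_left_mono) auto
        then show ?thesis using up by (simp add: r'_def algebra_simps add_divide_distrib diff_divide_distrib)
      qed
      \<comment> \<open>The quotient of \<open>2 + c * (r' * T)\<close> by \<open>2 + c * T\<close>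
        decreases in \<open>T\<close>, so its value \<open>\<alpha>1\<close> at \<open>R\<close> is
        a bound.\<close>
      also have "\<dots> \<le> \<alpha>1 * (2 + c * T)"
      proof -
        have "R * (1 - r') \<le> T * (1 - r')" using False r' by (intro mult_right_mono) auto
        then have "2 * c * (R * (1 - r')) \<le> 2 * c * (T * (1 - r'))" using c by (intro mult_left_mono) auto
        then have "(2 + c * (r' * T)) * (2 + c * R) \<le> (2 + c * (r' * R)) * (2 + c * T)"
          by (simp add: algebra_simps)
        then show ?thesis using den by (simp add: \<alpha>1_def pos_le_divide_eq)
      qed
      also have "\<dots> \<le> \<alpha> * (2 + c * T)"
        using T0 c by (intro mult_right_mono) (auto simp: \<alpha>_def)
      finally show ?thesis by (simp only: goal_eq)
    next
      case True
      have VR: "V x \<le> R" "V y \<le> R" using True V_nonneg[of x] V_nonneg[of y] by (simp_all add: T_def)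
      \<comment> \<open>The minorization for real integrals. Integrability under
        \<open>\<eta>\<close> is part of the conclusion, since \<open>\<epsilon>\<close> times the
        \<open>\<eta>\<close>-integral is at most a finite integral under
        \<open>P z\<close>.\<close>
      have lower: "integrable \<eta> \<psi> \<and> \<epsilon> * integral\<^sup>L \<eta> \<psi> \<le> E z \<psi>"
        if "V z \<le> R" "\<psi> \<in> borel_measurable borel" "integrable (P z) \<psi>" "\<And>u. 0 \<le> \<psi> u" for z \<psi>
      proof -
        have le: "ennreal \<epsilon> * (\<integral>\<^sup>+u. ennreal (\<psi> u) \<partial>\<eta>) \<le> ennreal (E z \<psi>)"
          using min[of z "\<lambda>u. ennreal (\<psi> u)"] that nn_integral_eq_integral[of "P z" \<psi>] by simp
        have "(\<integral>\<^sup>+u. ennreal (\<psi> u) \<partial>\<eta>) < \<infinity>"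
        proof (rule ccontr)
          assume "\<not> ?thesis"
          then have "(\<integral>\<^sup>+u. ennreal (\<psi> u) \<partial>\<eta>) = \<infinity>" by (simp add: not_less top_unique)
          then have "ennreal \<epsilon> * \<infinity> \<le> ennreal (E z \<psi>)" using le by simp
          then show False using \<epsilon> by (simp add: ennreal_mult_top top_unique)
        qed
        then have int: "integrable \<eta> \<psi>"
          using that \<eta>(2) by (intro integrableI_nonneg) (auto cong: measurable_cong_sets)
        have "ennreal (\<epsilon> * integral\<^sup>L \<eta> \<psi>) \<le> ennreal (E z \<psi>)"
          using le nn_integral_eq_integral[OF int] that \<epsilon> by (simp add: ennreal_mult integral_nonneg_AE)
        then show ?thesis using int that by (simp add: integral_nonneg_AE)
      qed
      note Lx = lower[OF VR(1) meas(2) ints(2) pm(2)] and Ly = lower[OF VR(2) meas(1) ints(1) pm(1)]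
      have "2 \<le> integral\<^sup>L \<eta> (\<lambda>z. p z + m z)"
      proof -
        have "integral\<^sup>L \<eta> (\<lambda>_. 2) \<le> integral\<^sup>L \<eta> (\<lambda>z. p z + m z)"
          using w Lx Ly pm(3)
          by (intro integral_mono Bochner_Integration.integrable_add) (simp_all add: \<eta>.prob_space)
        then show ?thesis by (simp add: \<eta>.prob_space)
      qed
      then have "2 \<le> integral\<^sup>L \<eta> p + integral\<^sup>L \<eta> m"
        using Lx Ly by simp
      then have "\<epsilon> * 2 \<le> \<epsilon> * (integral\<^sup>L \<eta> p + integral\<^sup>L \<eta> m)"
        using \<epsilon> by (intro mult_left_mono) auto
      then have "E x F - E y F \<le> 2 + c * (r * T) + 2 * c * b - 2 * \<epsilon>"
        using Lx Ly up unfolding ex ey by (simp add: algebra_simps)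
      also have "\<dots> = (1 - \<epsilon> / 2) * 2 + r * (c * T)"
        using c by (simp add: algebra_simps)
      also have "\<dots> \<le> \<alpha>2 * 2 + \<alpha>2 * (c * T)"
        using T0 c by (intro add_mono mult_right_mono) (auto simp: \<alpha>2_def)
      also have "\<dots> = \<alpha>2 * (2 + c * T)" by (simp add: algebra_simps)
      also have "\<dots> \<le> \<alpha> * (2 + c * T)"
        using T0 c by (intro mult_right_mono) (auto simp: \<alpha>_def)
      finally show ?thesis by (simp only: goal_eq)
    qed
  qed
  from c(1) \<alpha> main show ?thesis by (rule that)
qed

text \<open>Composition of kernels for Bochner integrals of functions dominated by \<open>V\<close>.
  Adding \<open>\<bar>B\<bar> * V\<close> makes \<open>F\<close> nonnegative, where the identity
  holds for nonnegative integrals, and \<open>QV\<close> keeps every integral finite.\<close>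

lemma bind_integral:
  assumes M: "prob_space M" "sets M = sets borel" "integrable M V"
    and F [measurable]: "F \<in> borel_measurable borel" and bound: "\<And>x. \<bar>F x\<bar> \<le> B * V x"
    and Q: "Q \<in> borel \<rightarrow>\<^sub>M prob_algebra borel"
    and QV: "\<And>x. (\<integral>\<^sup>+y. ennreal (V y) \<partial>Q x) \<le> ennreal (K * V x)"
  shows "integral\<^sup>L (M \<bind> Q) F = (\<integral>x. integral\<^sup>L (Q x) F \<partial>M)"
    and "integrable M (\<lambda>x. integral\<^sup>L (Q x) F)"
    and "integrable (M \<bind> Q) V"
proof -
  have Qs: "Q \<in> M \<rightarrow>\<^sub>M subprob_algebra borel"
    using measurable_prob_algebraD[OF Q] M(2) by (simp cong: measurable_cong_sets)
  have [measurable_cong]: "sets M = sets borel" by fact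
  \<comment> \<open>The sign follows from \<open>QV\<close>: the integral of
    \<open>V \<ge> 1\<close> against a probability measure is positive.\<close>
  have K: "0 \<le> K * V x" for x
  proof (rule ccontr)
    assume "\<not> 0 \<le> K * V x"
    then have "(\<integral>\<^sup>+y. ennreal (V y) \<partial>Q x) = 0" using QV[of x] by (simp add: ennreal_neg)
    moreover have "prob_space (Q x)" "sets (Q x) = sets borel"
      using measurable_space[OF Q, of x] by (simp_all add: space_prob_algebra)
    moreover have "(\<integral>\<^sup>+y. 1 \<partial>Q x) \<le> (\<integral>\<^sup>+y. ennreal (V y) \<partial>Q x)"
      using V_ge_1 by (intro nn_integral_mono) auto
    ultimately show False by (simp add: prob_space.emeasure_space_1)
  qed
  have intQ: "integrable (Q x) V" "integral\<^sup>L (Q x) V \<le> K * V x"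
    and prQ: "prob_space (Q x)" "sets (Q x) = sets borel" for x
    using measurable_space[OF Q, of x] integrable_if_nn_integral_le[OF _ V_meas V_nonneg QV K]
    by (auto simp: space_prob_algebra)
  have pos: "integral\<^sup>L (M \<bind> Q) \<psi> = (\<integral>x. integral\<^sup>L (Q x) \<psi> \<partial>M) \<and>
      integrable M (\<lambda>x. integral\<^sup>L (Q x) \<psi>) \<and> integrable (M \<bind> Q) \<psi>"
    if [measurable]: "\<psi> \<in> borel_measurable borel" and b: "\<And>x. 0 \<le> \<psi> x" "\<And>x. \<psi> x \<le> A * V x" for \<psi> A
  proof -
    have int: "integrable (Q x) \<psi>" for x
      by (rule integrable_dominated_affine[OF prQ intQ(1) that(1), of 0 A]) (use b in auto)
    have mm: "(\<lambda>x. integral\<^sup>L (Q x) \<psi>) \<in> borel_measurable borel"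
      by (rule measurable_compose[OF measurable_prob_algebraD[OF Q] integral_measurable_subprob_algebra[OF that(1)]])
    have A: "0 \<le> A"
    proof -
      have "0 \<le> A * V undefined" using b[of undefined] by linarith
      then show ?thesis using V_ge_1[of undefined] by (auto simp: zero_le_mult_iff)
    qed
    have le: "integral\<^sup>L (Q x) \<psi> \<le> A * (K * V x)" for x
    proof -
      have "integral\<^sup>L (Q x) \<psi> \<le> integral\<^sup>L (Q x) (\<lambda>y. A * V y)"
        using int intQ b by (intro integral_mono) auto
      also have "\<dots> \<le> A * (K * V x)" using intQ[of x] A by (simp add: mult_left_mono)
      finally show ?thesis .
    qed
    have i2: "integrable M (\<lambda>x. integral\<^sup>L (Q x) \<psi>)"
      by (rule integrable_dominated_affine[OF M mm, of 0 "A * K"])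
        (use le b in \<open>auto simp: mult.assoc integral_nonneg_AE\<close>)
    have eq: "(\<integral>\<^sup>+x. ennreal (\<psi> x) \<partial>(M \<bind> Q)) = ennreal (\<integral>x. integral\<^sup>L (Q x) \<psi> \<partial>M)"
      using b nn_integral_eq_integral[OF int] nn_integral_eq_integral[OF i2]
      by (subst nn_integral_bind[OF _ Qs]) (auto simp: integral_nonneg_AE)
    have sb: "sets (M \<bind> Q) = sets borel"
      by (rule sets_bind'[OF _ Q]) (use M in \<open>simp add: space_prob_algebra\<close>)
    have i3: "integrable (M \<bind> Q) \<psi>"
      by (rule integrable_if_nn_integral_le[OF sb that(1) b(1)], subst eq, rule order_refl)
        (use b in \<open>auto simp: integral_nonneg_AE\<close>)
    moreover have "integral\<^sup>L (M \<bind> Q) \<psi> = (\<integral>x. integral\<^sup>L (Q x) \<psi> \<partial>M)"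
      using nn_integral_eq_integral[OF i3] b eq by (simp add: integral_nonneg_AE)
    ultimately show ?thesis using i2 by blast
  qed
  have B: "\<bar>F x\<bar> \<le> \<bar>B\<bar> * V x" for x
    using bound[of x] V_nonneg[of x] by (meson abs_ge_self mult_right_mono order_trans)
  define \<psi> where "\<psi> x = F x + \<bar>B\<bar> * V x" for x
  have \<psi>: "\<psi> \<in> borel_measurable borel" "0 \<le> \<psi> x" "\<psi> x \<le> (2 * \<bar>B\<bar>) * V x" for x
    unfolding \<psi>_def using B[of x] by (auto simp: abs_le_iff)
  note p1 = pos[OF \<psi>] and p2 = pos[OF V_meas V_nonneg, of 1]
  have eq: "F = (\<lambda>x. \<psi> x - \<bar>B\<bar> * V x)" by (simp add: \<psi>_def)
  have int\<psi>: "integrable (Q x) \<psi>" for x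
    by (rule integrable_dominated_affine[OF prQ intQ(1) \<psi>(1), of 0 "2 * \<bar>B\<bar>"]) (use \<psi> in \<open>auto simp: abs_le_iff\<close>)
  have eq2: "integral\<^sup>L (Q x) F = integral\<^sup>L (Q x) \<psi> - \<bar>B\<bar> * integral\<^sup>L (Q x) V" for x
    unfolding eq using int\<psi> intQ by simp
  show "integral\<^sup>L (M \<bind> Q) F = (\<integral>x. integral\<^sup>L (Q x) F \<partial>M)" "integrable M (\<lambda>x. integral\<^sup>L (Q x) F)"
    "integrable (M \<bind> Q) V"
    unfolding eq2 using p1 p2 by (auto simp: eq)
qed

lemma kernel_pow_kernel: "kernel_pow P n \<in> borel \<rightarrow>\<^sub>M prob_algebra borel"
proof (induction n)
  case 0
  have "kernel_pow P 0 = return borel" by (rule ext) simp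
  then show ?case by simp
next
  case (Suc n)
  have "kernel_pow P (Suc n) = (\<lambda>x. kernel_pow P n x \<bind> P)" by (rule ext) simp
  then show ?case using measurable_bind_prob_space[OF Suc kernel] by simp
qed

lemma prob_kernel_pow: "prob_space (kernel_pow P n x)" "sets (kernel_pow P n x) = sets borel"
  using measurable_space[OF kernel_pow_kernel, of x n] by (simp_all add: space_prob_algebra)

lemma invariant_pow: "\<nu> \<bind> kernel_pow P n = \<nu>"
proof (induction n)
  case 0
  have "kernel_pow P 0 = return borel" by (rule ext) simp
  then show ?case using prob_invariant by (simp add: bind_return'')
next
  case (Suc n)
  have "kernel_pow P (Suc n) = (\<lambda>x. kernel_pow P n x \<bind> P)" by (rule ext) simp
  moreover have "kernel_pow P n \<in> \<nu> \<rightarrow>\<^sub>M subprob_algebra borel"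
    using measurable_prob_algebraD[OF kernel_pow_kernel] prob_invariant(2)
    by (simp cong: measurable_cong_sets)
  ultimately have "\<nu> \<bind> kernel_pow P (Suc n) = (\<nu> \<bind> kernel_pow P n) \<bind> P"
    by (simp only: bind_assoc[OF _ kernel_subprob])
  then show ?case by (simp only: Suc invariant)
qed

lemma kernel_pow_V:
  "(\<integral>\<^sup>+y. ennreal (V y) \<partial>kernel_pow P n x) \<le> ennreal ((1 + b / (1 - r)) * V x)"
proof -
  \<comment> \<open>The fixed point of the map from \<open>t\<close> to \<open>r * t + b\<close>, so
    that the bound \<open>V x + b'\<close> survives each step of the induction.\<close>
  define b' where "b' = b / (1 - r)"
  have b': "0 \<le> b'" "r * b' + b = b'" using rate by (simp_all add: b'_def field_simps)
  have "(\<integral>\<^sup>+y. ennreal (V y) \<partial>kernel_pow P n x) \<le> ennreal (V x + b')"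
  proof (induction n)
    case 0
    then show ?case using b' V_nonneg[of x] by (simp add: nn_integral_return)
  next
    case (Suc n)
    interpret Pn: prob_space "kernel_pow P n x" by (rule prob_kernel_pow)
    have [measurable_cong]: "sets (kernel_pow P n x) = sets borel" by (rule prob_kernel_pow)
    have "(\<integral>\<^sup>+y. ennreal (V y) \<partial>kernel_pow P (Suc n) x) =
        (\<integral>\<^sup>+z. \<integral>\<^sup>+y. ennreal (V y) \<partial>P z \<partial>kernel_pow P n x)"
      using kernel_subprob prob_kernel_pow(2)[of n x]
      by (simp, subst nn_integral_bind[where B = borel]) (auto cong: measurable_cong_sets)
    also have "\<dots> \<le> (\<integral>\<^sup>+z. ennreal r * ennreal (V z) + ennreal b \<partial>kernel_pow P n x)"
      using drift rate V_nonneg by (intro nn_integral_mono) (simp add: ennreal_mult ennreal_plus)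
    also have "\<dots> = ennreal r * (\<integral>\<^sup>+z. ennreal (V z) \<partial>kernel_pow P n x) + ennreal b"
      by (simp add: nn_integral_add nn_integral_cmult Pn.emeasure_space_1)
    also have "\<dots> \<le> ennreal r * ennreal (V x + b') + ennreal b"
      using Suc by (intro add_mono mult_left_mono) auto
    also have "\<dots> = ennreal (r * V x + b')"
      using rate V_nonneg[of x] b' by (simp add: distrib_left flip: ennreal_mult ennreal_plus)
    also have "\<dots> \<le> ennreal (V x + b')"
      using rate V_nonneg[of x] by (intro ennreal_leI) (simp add: mult_left_le_one_le)
    finally show ?case .
  qed
  also have "\<dots> \<le> ennreal ((1 + b') * V x)"
    using V_ge_1[of x] b' by (intro ennreal_leI) (simp add: distrib_right mult_left_le mult_le_cancel_left1)
  finally show ?thesis by (simp add: b'_def)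
qed

lemma integrable_kernel_pow_V: "integrable (kernel_pow P n x) V"
proof (rule integrable_if_nn_integral_le[OF prob_kernel_pow(2) V_meas V_nonneg kernel_pow_V])
  show "0 \<le> (1 + b / (1 - r)) * V x" using rate V_nonneg[of x] by simp
qed

text \<open>Integrating \<open>(1 - r) V 1{V \<le> m} \<le> min V m + b - min m (r V + b)\<close> against the invariant
  measure avoids subtracting infinite integrals.\<close>

lemma integrable_invariant_V: "integrable \<nu> V"
proof -
  interpret \<nu>: prob_space \<nu> by (rule prob_invariant)
  have [measurable_cong]: "sets \<nu> = sets borel" by (rule prob_invariant)
  define g where "g m z = ennreal ((1 - r) * V z) * indicator {z. V z \<le> real m} z" for m :: nat and z
  have [measurable]: "g m \<in> borel_measurable borel" for m unfolding g_def by measurable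
  have le: "(\<integral>\<^sup>+z. g m z \<partial>\<nu>) \<le> ennreal b" for m
  proof -
    define W where "W z = ennreal (min (V z) (real m))" for z
    have [measurable]: "W \<in> borel_measurable borel" unfolding W_def by measurable
    have fin: "(\<integral>\<^sup>+z. W z \<partial>\<nu>) < \<infinity>"
    proof -
      have "(\<integral>\<^sup>+z. W z \<partial>\<nu>) \<le> (\<integral>\<^sup>+z. ennreal (real m) \<partial>\<nu>)"
        by (intro nn_integral_mono) (auto simp: W_def intro!: ennreal_leI)
      then show ?thesis by (simp add: \<nu>.emeasure_space_1 order_le_less_trans)
    qed
    have PW: "(\<integral>\<^sup>+y. W y \<partial>P z) \<le> ennreal (min (real m) (r * V z + b))" for z
    proof -
      interpret Pz: prob_space "P z" by (rule prob_kernel)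
      have "(\<integral>\<^sup>+y. W y \<partial>P z) \<le> (\<integral>\<^sup>+y. ennreal (real m) \<partial>P z)"
        by (intro nn_integral_mono) (auto simp: W_def intro!: ennreal_leI)
      moreover have "(\<integral>\<^sup>+y. W y \<partial>P z) \<le> (\<integral>\<^sup>+y. ennreal (V y) \<partial>P z)"
        by (intro nn_integral_mono) (auto simp: W_def intro!: ennreal_leI)
      moreover have "(\<integral>\<^sup>+y. ennreal (real m) \<partial>P z) = ennreal (real m)"
        by (simp add: Pz.emeasure_space_1)
      ultimately show ?thesis using order_trans[OF _ drift[of z]] by (auto simp: min_def)
    qed
    have "(\<integral>\<^sup>+z. W z \<partial>(\<nu> \<bind> P)) = (\<integral>\<^sup>+z. \<integral>\<^sup>+y. W y \<partial>P z \<partial>\<nu>)"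
      using kernel_subprob prob_invariant(2)
      by (intro nn_integral_bind[where B = borel]) (auto cong: measurable_cong_sets)
    then have "(\<integral>\<^sup>+z. g m z \<partial>\<nu>) + (\<integral>\<^sup>+z. W z \<partial>\<nu>) =
        (\<integral>\<^sup>+z. g m z \<partial>\<nu>) + (\<integral>\<^sup>+z. \<integral>\<^sup>+y. W y \<partial>P z \<partial>\<nu>)"
      by (simp only: invariant)
    also have "\<dots> \<le> (\<integral>\<^sup>+z. g m z \<partial>\<nu>) + (\<integral>\<^sup>+z. ennreal (min (real m) (r * V z + b)) \<partial>\<nu>)"
      by (intro add_left_mono nn_integral_mono PW)
    also have "\<dots> = (\<integral>\<^sup>+z. g m z + ennreal (min (real m) (r * V z + b)) \<partial>\<nu>)"
      by (subst nn_integral_add) auto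
    also have "\<dots> \<le> (\<integral>\<^sup>+z. ennreal b + W z \<partial>\<nu>)"
    proof (intro nn_integral_mono)
      fix z
      have nn: "0 \<le> min (real m) (r * V z + b)" using rate V_nonneg[of z] by simp
      show "g m z + ennreal (min (real m) (r * V z + b)) \<le> ennreal b + W z"
      proof (cases "V z \<le> real m")
        case True
        have "(1 - r) * V z + min (real m) (r * V z + b) \<le> b + V z" by (simp add: algebra_simps min_def)
        then show ?thesis
          using True rate V_nonneg[of z] nn by (simp add: g_def W_def flip: ennreal_plus)
      next
        case False
        then show ?thesis
          using rate nn by (simp add: g_def W_def flip: ennreal_plus)
      qed
    qed
    also have "\<dots> = ennreal b + (\<integral>\<^sup>+z. W z \<partial>\<nu>)"
      by (simp add: nn_integral_add \<nu>.emeasure_space_1)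
    finally show ?thesis using fin
      by (metis ennreal_add_left_cancel_le add.commute infinity_ennreal_def less_irrefl)
  qed
  have "(\<integral>\<^sup>+z. ennreal ((1 - r) * V z) \<partial>\<nu>) = (\<integral>\<^sup>+z. (SUP m. g m z) \<partial>\<nu>)"
  proof (intro nn_integral_cong)
    fix z
    obtain m where "V z \<le> real m" using real_arch_simple by blast
    then have "ennreal ((1 - r) * V z) \<le> (SUP m. g m z)"
      by (intro SUP_upper2[of m]) (simp_all add: g_def)
    moreover have "(SUP m. g m z) \<le> ennreal ((1 - r) * V z)"
      by (intro SUP_least) (simp add: g_def indicator_def)
    ultimately show "ennreal ((1 - r) * V z) = (SUP m. g m z)" by (rule order_antisym)
  qed
  also have "\<dots> = (SUP m. \<integral>\<^sup>+z. g m z \<partial>\<nu>)"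
    by (intro nn_integral_monotone_convergence_SUP)
      (auto simp: incseq_def le_fun_def g_def indicator_def intro!: mult_left_mono)
  also have "\<dots> \<le> ennreal b" by (intro SUP_least le)
  finally have "integrable \<nu> (\<lambda>z. (1 - r) * V z)"
    using rate V_nonneg by (intro integrable_if_nn_integral_le(1)[OF prob_invariant(2), where r = b]) auto
  then show ?thesis using rate by simp
qed

text \<open>Iterating the contraction bounds the difference of \<open>En n x F\<close> and
  \<open>En n y F\<close> by \<open>\<alpha> ^ n\<close> times the weight; integrating over
  \<open>y\<close> against the invariant measure turns \<open>En n y F\<close> into the invariant
  mean.\<close>

theorem geometrically_ergodic: "geometrically_ergodic P \<nu>"
proof -
  obtain c \<alpha> where c: "0 < c" and \<alpha>: "0 < \<alpha>" "\<alpha> < 1"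
    and contr: "\<And>F x y. F \<in> borel_measurable borel \<Longrightarrow> (\<And>x y. F x - F y \<le> 2 + c * V x + c * V y) \<Longrightarrow>
      E x F - E y F \<le> \<alpha> * (2 + c * V x + c * V y)"
    by (rule kernel_integral_contraction) blast
  interpret \<nu>: prob_space \<nu> by (rule prob_invariant)
  have [measurable_cong]: "sets \<nu> = sets borel" by (rule prob_invariant)
  have PV: "(\<integral>\<^sup>+y. ennreal (V y) \<partial>P x) \<le> ennreal ((r + b) * V x)" for x
  proof (rule order_trans[OF drift ennreal_leI])
    show "r * V x + b \<le> (r + b) * V x" using rate V_ge_1[of x] by (simp add: distrib_right)
  qed
  have osc_pow: "En n x F - En n y F
      \<le> \<alpha> ^ n * (2 + c * V x + c * V y)"
    if "F \<in> borel_measurable borel" "\<And>x y. F x - F y \<le> 2 + c * V x + c * V y" for n F x y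
    using that
  proof (induction n arbitrary: F)
    case 0
    then show ?case by (simp add: integral_return)
  next
    case (Suc n)
    \<comment> \<open>Division by \<open>\<alpha>\<close> restores weighted oscillation at most 1,
      so that the induction hypothesis applies.\<close>
    define F' where "F' z = E z F / \<alpha>" for z
    have m: "F' \<in> borel_measurable borel"
      unfolding F'_def using measurable_kernel_integral[OF Suc.prems(1)] by simp
    have "F' u - F' v \<le> 2 + c * V u + c * V v" for u v
      using contr[OF Suc.prems, of u v] \<alpha> by (simp add: F'_def field_simps)
    from Suc.IH[OF m this]
    have "\<alpha> * (En n x F' - En n y F')
        \<le> \<alpha> * (\<alpha> ^ n * (2 + c * V x + c * V y))"
      using \<alpha> by (intro mult_left_mono) auto
    moreover have "integral\<^sup>L (kernel_pow P (Suc n) z) F = \<alpha> * En n z F'" for z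
    proof -
      \<comment> \<open>A reference point turns the oscillation bound into domination of
        \<open>F\<close> by a multiple of \<open>V\<close>, as needed for integration against the
        composed kernel.\<close>
      define z0 :: 'a where "z0 = undefined"
      have "\<bar>F u\<bar> \<le> (\<bar>F z0\<bar> + 2 + c + c * V z0) * V u" for u
      proof -
        have "\<bar>F u\<bar> \<le> (\<bar>F z0\<bar> + 2 + c * V z0) * 1 + c * V u"
          using Suc.prems(2)[of u z0] Suc.prems(2)[of z0 u] by simp
        also have "\<dots> \<le> (\<bar>F z0\<bar> + 2 + c * V z0) * V u + c * V u"
          using V_ge_1[of u] c V_nonneg[of z0] by (intro add_right_mono mult_left_mono) auto
        finally show ?thesis by (simp add: algebra_simps)
      qed
      from bind_integral(1)[OF prob_kernel_pow integrable_kernel_pow_V Suc.prems(1) this kernel PV]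
      show ?thesis using \<alpha> by (simp add: F'_def[abs_def])
    qed
    ultimately show ?case by (simp add: algebra_simps)
  qed
  define I where "I = integral\<^sup>L \<nu> V"
  have I: "0 \<le> I" unfolding I_def using V_nonneg by (simp add: integral_nonneg_AE)
  define C where "C = (2 + c + c * I) / c"
  have C: "0 \<le> C" using c I by (simp add: C_def)
  have "V_dist V (kernel_pow P n x) \<nu> \<le> ereal (C * \<alpha> ^ n * V x)" for n x
  proof -
    have "En n x F - integral\<^sup>L \<nu> F \<le> C * \<alpha> ^ n * V x"
      if F: "F \<in> borel_measurable borel" "\<And>x. \<bar>F x\<bar> \<le> V x" for F
    proof -
      have "\<bar>F u\<bar> \<le> 1 * V u" for u using F(2) by simp
      note bi = bind_integral[OF prob_invariant integrable_invariant_V F(1) this kernel_pow_kernel kernel_pow_V, of n]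
      have le: "c * (En n x F - En n y F)
          \<le> \<alpha> ^ n * (2 + c * V x + c * V y)" for y
      proof -
        \<comment> \<open>For \<open>\<bar>F\<bar> \<le> V\<close> it is \<open>c * F\<close> that
          has weighted oscillation at most 1; the factor \<open>1 / c\<close> ends up in
          \<open>C\<close>.\<close>
        have "c * F u - c * F v \<le> 2 + c * V u + c * V v" for u v
        proof -
          have "F u - F v \<le> V u + V v" using F(2)[of u] F(2)[of v] by (simp add: abs_le_iff)
          then have "c * (F u - F v) \<le> c * (V u + V v)" using c by (intro mult_left_mono) auto
          then show ?thesis by (simp add: algebra_simps)
        qed
        from osc_pow[OF _ this, of n x y] F(1) show ?thesis by (simp add: algebra_simps)
      qed
      have "c * (En n x F - integral\<^sup>L \<nu> F) =
          (\<integral>y. c * (En n x F - En n y F) \<partial>\<nu>)"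
        using bi by (simp add: invariant_pow \<nu>.prob_space)
      also have "\<dots> \<le> (\<integral>y. \<alpha> ^ n * (2 + c * V x + c * V y) \<partial>\<nu>)"
        using bi integrable_invariant_V by (intro integral_mono le) auto
      also have "\<dots> = \<alpha> ^ n * (2 + c * V x + c * I)"
        using integrable_invariant_V by (simp add: I_def \<nu>.prob_space)
      also have "\<dots> \<le> \<alpha> ^ n * ((2 + c + c * I) * V x)"
      proof -
        have "(2 + c * I) * 1 \<le> (2 + c * I) * V x"
          using V_ge_1[of x] c I by (intro mult_left_mono) auto
        then show ?thesis using \<alpha> by (intro mult_left_mono) (auto simp: algebra_simps)
      qed
      finally show ?thesis using c by (simp add: C_def field_simps)
    qed
    then show ?thesis
      unfolding V_dist_def using integrable_kernel_pow_V integrable_invariant_V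
      by (auto intro!: SUP_least)
  qed
  then have "V_geometrically_ergodic V P \<nu>"
    unfolding V_geometrically_ergodic_def using C \<alpha> by (intro exI[of _ C] conjI bexI[of _ \<alpha>]) auto
  then show ?thesis
    unfolding geometrically_ergodic_def using kernel invariant_space invariant V_meas V_ge_1 by blast
qed

end

section \<open>Gaussian integrals\<close>

lemma nn_integral_lborel_translate:
  fixes F :: "'a::euclidean_space \<Rightarrow> ennreal"
  assumes [measurable]: "F \<in> borel_measurable borel"
  shows "(\<integral>\<^sup>+x. F (t + x) \<partial>lborel) = (\<integral>\<^sup>+x. F x \<partial>lborel)"
  by (subst (2) lborel_distr_plus[of t, symmetric]) (simp add: nn_integral_distr)

lemma measurable_matrix_vector [measurable]: "(\<lambda>x. (Q :: real ^ 'n ^ 'n) *v x) \<in> borel_measurable borel"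
  by (intro borel_measurable_continuous_onI matrix_vector_mult_linear_continuous_on)

text \<open>The image of \<open>lborel\<close> under \<open>Q\<close> is translation invariant, hence proportional to \<open>lborel\<close>
  (integrate \<open>g x * F (Q u + x)\<close> in both orders), and the unit ball \<open>g\<close> fixes the constant.\<close>

lemma nn_integral_lborel_orthogonal:
  fixes F :: "real ^ 'n \<Rightarrow> ennreal" and Q :: "real ^ 'n ^ 'n"
  assumes Q: "orthogonal_matrix Q" and [measurable]: "F \<in> borel_measurable borel"
  shows "(\<integral>\<^sup>+x. F (Q *v x) \<partial>lborel) = (\<integral>\<^sup>+x. F x \<partial>lborel)"
proof -
  have QT: "Q *v (transpose Q *v x) = x" "transpose Q *v (Q *v x) = x" for x
    using Q by (simp_all add: orthogonal_matrix_def matrix_vector_mul_assoc del: transpose_matrix_vector)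
  have Qn: "norm (Q *v x) = norm x" for x
  proof -
    have "(Q *v x) \<bullet> (Q *v x) = (transpose Q *v (Q *v x)) \<bullet> x"
      by (metis dot_lmul_matrix inner_commute transpose_matrix_vector)
    then show ?thesis by (simp only: QT norm_eq_sqrt_inner)
  qed
  define g :: "real ^ 'n \<Rightarrow> ennreal" where "g = indicator (cball 0 1)"
  have g [measurable]: "g \<in> borel_measurable borel" unfolding g_def by (intro borel_measurable_indicator) (simp add: borel_closed)
  have gQ: "g (Q *v x) = g x" and g_minus: "g (- x) = g x" for x
    by (simp_all add: g_def indicator_def Qn)
  define c where "c = (\<integral>\<^sup>+x. g x \<partial>lborel)"
  have c: "c = emeasure lborel (cball 0 1 :: (real ^ 'n) set)" by (simp add: c_def g_def)
  have c0: "0 < c" "c < \<infinity>"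
    unfolding c by (simp add: emeasure_cball) (rule emeasure_lborel_cball_finite)
  have step1: "(\<integral>\<^sup>+u. F (Q *v u) \<partial>lborel) = (\<integral>\<^sup>+u. F (Q *v u + x) \<partial>lborel)" for x
    using nn_integral_lborel_translate[of "\<lambda>u. F (Q *v u)" "transpose Q *v x"]
    by (simp add: matrix_vector_right_distrib QT add.commute del: transpose_matrix_vector)
  have step2: "(\<integral>\<^sup>+x. g x * F (Q *v u + x) \<partial>lborel) = (\<integral>\<^sup>+x. g (x - Q *v u) * F x \<partial>lborel)" for u
    using nn_integral_lborel_translate[of "\<lambda>x. g (x - Q *v u) * F x" "Q *v u"] by simp
  have step3: "(\<integral>\<^sup>+u. g (x - Q *v u) \<partial>lborel) = c" for x
  proof -
    have "g (x - Q *v u) = g (- (transpose Q *v x) + u)" for u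
    proof -
      have "x - Q *v u = Q *v (- (- (transpose Q *v x) + u))"
        by (simp add: matrix_vector_mult_diff_distrib QT del: transpose_matrix_vector)
      then show ?thesis by (simp only: gQ g_minus)
    qed
    then show ?thesis
      using nn_integral_lborel_translate[of g "- (transpose Q *v x)"] by (simp add: c_def)
  qed
  have "c * (\<integral>\<^sup>+u. F (Q *v u) \<partial>lborel) = (\<integral>\<^sup>+x. g x * (\<integral>\<^sup>+u. F (Q *v u + x) \<partial>lborel) \<partial>lborel)"
    unfolding c_def by (simp add: nn_integral_multc flip: step1)
  also have "\<dots> = (\<integral>\<^sup>+x. \<integral>\<^sup>+u. g x * F (Q *v u + x) \<partial>lborel \<partial>lborel)"
    by (simp add: nn_integral_cmult)
  also have "\<dots> = (\<integral>\<^sup>+u. \<integral>\<^sup>+x. g x * F (Q *v u + x) \<partial>lborel \<partial>lborel)"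
    by (rule lborel_pair.Fubini') measurable
  also have "\<dots> = (\<integral>\<^sup>+u. \<integral>\<^sup>+x. g (x - Q *v u) * F x \<partial>lborel \<partial>lborel)"
    by (simp only: step2)
  also have "\<dots> = (\<integral>\<^sup>+x. \<integral>\<^sup>+u. g (x - Q *v u) * F x \<partial>lborel \<partial>lborel)"
    by (rule lborel_pair.Fubini') measurable
  also have "\<dots> = c * (\<integral>\<^sup>+x. F x \<partial>lborel)"
    by (simp add: nn_integral_multc step3 nn_integral_cmult)
  finally show ?thesis
    using c0 by (auto simp: ennreal_mult_cancel_left)
qed

lemma nn_integral_lborel_diagonal:
  fixes F :: "real ^ 'n \<Rightarrow> ennreal" and r :: "'n \<Rightarrow> real"
  assumes r: "\<And>i. 0 < r i" and F [measurable]: "F \<in> borel_measurable borel"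
  shows "(\<integral>\<^sup>+x. F x \<partial>lborel) =
    ennreal (prod r UNIV) * (\<integral>\<^sup>+x. F ((\<chi> i j. if i = j then r i else 0) *v x) \<partial>lborel)"
proof -
  let ?D = "(\<chi> i j. if i = j then r i else 0) :: real ^ 'n ^ 'n"
  define c :: "real ^ 'n \<Rightarrow> real" where "c j = (\<chi> i. r i) \<bullet> j" for j
  have B: "Basis = range (\<lambda>i :: 'n. axis i (1 :: real))" by (auto simp: Basis_vec_def)
  have inj: "inj (\<lambda>i :: 'n. axis i (1 :: real))" by (simp add: inj_def axis_eq_axis)
  have cj: "c (axis i 1) = r i" for i by (simp add: c_def inner_axis)
  have "?D *v x = 0 + (\<Sum>j\<in>Basis. (c j * (x \<bullet> j)) *\<^sub>R j)" for x
  proof -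
    have "(\<Sum>j\<in>Basis. (c j * (x \<bullet> j)) *\<^sub>R j) = (\<Sum>i\<in>UNIV. (r i * x $ i) *\<^sub>R axis i 1)"
      by (simp only: B sum.reindex[OF inj] o_def cj inner_axis inner_real_def mult_1_right)
    then show ?thesis
      by (simp add: vec_eq_iff matrix_vector_mult_def axis_def
          if_distrib[of "\<lambda>y. y * _"] if_distrib[of "(*) _"] cong: if_cong)
  qed
  then have eq: "(\<lambda>x. 0 + (\<Sum>j\<in>Basis. (c j * (x \<bullet> j)) *\<^sub>R j)) = (\<lambda>x. ?D *v x)" by simp
  have "c j \<noteq> 0" if j: "j \<in> Basis" for j
  proof -
    from j obtain i where "j = axis i 1" unfolding B by (rule imageE)
    then show ?thesis using r[of i] cj[of i] by simp
  qed
  from lborel_affine_euclidean[where t = 0 and c = c, OF this]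
  have "lborel = density (distr lborel borel (\<lambda>x. ?D *v x)) (\<lambda>_. ennreal (\<Prod>j\<in>Basis. \<bar>c j\<bar>))"
    by (simp only: eq)
  also have "(\<Prod>j\<in>Basis. \<bar>c j\<bar>) = prod r UNIV"
    using r by (simp add: B prod.reindex[OF inj] cj less_imp_le abs_of_pos)
  finally have L: "lborel = density (distr lborel borel (\<lambda>x. ?D *v x)) (\<lambda>_. ennreal (prod r UNIV))" .
  show ?thesis
    by (subst L) (simp add: nn_integral_density nn_integral_distr nn_integral_cmult)
qed

text \<open>Through \<open>B = Q ** D ** transpose Q\<close> the change of variables splits into a
  translation, two orthogonal maps that preserve the measure and one coordinatewise scaling.\<close>

lemma nn_integral_lborel_eigenbasis:
  fixes F :: "real ^ 'n \<Rightarrow> ennreal"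
  assumes eb: "eigenbasis B b r" and r: "\<And>i. 0 < r i" and F [measurable]: "F \<in> borel_measurable borel"
  shows "(\<integral>\<^sup>+y. F y \<partial>lborel) = ennreal (det B) * (\<integral>\<^sup>+x. F (m + B *v x) \<partial>lborel)"
proof -
  define Q :: "real ^ 'n ^ 'n" where "Q = (\<chi> i j. b j $ i)"
  define D :: "real ^ 'n ^ 'n" where "D = (\<chi> i j. if i = j then r i else 0)"
  have Q: "orthogonal_matrix Q" "orthogonal_matrix (transpose Q)"
    using eigenbasis_orthogonal_matrix[OF eb] by (simp_all add: Q_def)
  have "B = B ** (Q ** transpose Q)" using Q by (simp add: orthogonal_matrix_def)
  also have "\<dots> = Q ** D ** transpose Q"
    using eigenbasis_factorization[OF eb] by (simp add: Q_def D_def matrix_mul_assoc)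
  finally have B: "Q *v (D *v (transpose Q *v x)) = B *v x" for x
    by (simp add: matrix_vector_mul_assoc matrix_mul_assoc del: transpose_matrix_vector)
  have "(\<integral>\<^sup>+y. F y \<partial>lborel) = (\<integral>\<^sup>+y. F (m + y) \<partial>lborel)"
    by (simp add: nn_integral_lborel_translate)
  also have "\<dots> = (\<integral>\<^sup>+y. F (m + Q *v y) \<partial>lborel)"
    by (rule nn_integral_lborel_orthogonal[OF Q(1), symmetric]) measurable
  also have "\<dots> = ennreal (prod r UNIV) * (\<integral>\<^sup>+y. F (m + Q *v (D *v y)) \<partial>lborel)"
    unfolding D_def by (rule nn_integral_lborel_diagonal[OF r]) measurable
  also have "\<dots> = ennreal (prod r UNIV) * (\<integral>\<^sup>+x. F (m + Q *v (D *v (transpose Q *v x))) \<partial>lborel)"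
  proof -
    have "(\<lambda>y. F (m + Q *v (D *v y))) \<in> borel_measurable borel" by measurable
    from nn_integral_lborel_orthogonal[OF Q(2) this] show ?thesis by (simp only:)
  qed
  finally show ?thesis by (simp only: B eigenbasis_det[OF eb])
qed

lemma nn_integral_exp_square:
  fixes c :: real
  assumes "0 < c"
  shows "(\<integral>\<^sup>+x. ennreal (exp (- (c * (x::real)\<^sup>2))) \<partial>lborel) = ennreal (sqrt (pi / c))"
proof -
  define \<sigma> where "\<sigma> = sqrt (1 / (2 * c))"
  have \<sigma>: "0 < \<sigma>" "\<sigma>\<^sup>2 = 1 / (2 * c)" using assms by (simp_all add: \<sigma>_def)
  have "exp (- (c * x\<^sup>2)) = sqrt (pi / c) * normal_density 0 \<sigma> x" for x
  proof -
    have "2 * pi * \<sigma>\<^sup>2 = pi / c" "- (x - 0)\<^sup>2 / (2 * \<sigma>\<^sup>2) = - (c * x\<^sup>2)"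
      unfolding \<sigma>(2) using assms by simp_all
    moreover have "0 < sqrt (pi / c)" using assms by simp
    ultimately show ?thesis unfolding normal_density_def by (simp only:) (use assms in simp)
  qed
  moreover have "(\<integral>\<^sup>+x. ennreal (normal_density 0 \<sigma> x) \<partial>lborel) = 1"
    using \<sigma> by (subst nn_integral_eq_integral) auto
  ultimately show ?thesis
    using assms by (simp add: ennreal_mult nn_integral_cmult)
qed

lemma nn_integral_exp_norm_square:
  fixes c :: real
  assumes "0 < c"
  shows "(\<integral>\<^sup>+x. ennreal (exp (- (c * (norm (x :: real ^ 'n))\<^sup>2))) \<partial>lborel) = ennreal (sqrt (pi / c) ^ CARD('n))"
proof -
  have "ennreal (exp (- (c * (norm x)\<^sup>2))) = (\<Prod>b\<in>Basis. ennreal (exp (- (c * (x \<bullet> b)\<^sup>2))))" for x :: "real ^ 'n"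
  proof -
    have "- (c * (norm x)\<^sup>2) = (\<Sum>b\<in>Basis. - (c * (x \<bullet> b)\<^sup>2))"
      unfolding power2_norm_eq_inner euclidean_inner[of x x]
      by (simp add: sum_distrib_left sum_negf power2_eq_square)
    then show ?thesis by (simp add: exp_sum prod_ennreal)
  qed
  then have "(\<integral>\<^sup>+x. ennreal (exp (- (c * (norm (x :: real ^ 'n))\<^sup>2))) \<partial>lborel) =
      (\<Prod>b\<in>(Basis :: (real ^ 'n) set). \<integral>\<^sup>+t. ennreal (exp (- (c * t\<^sup>2))) \<partial>lborel)"
    by (simp only:) (rule nn_integral_lborel_prod, auto)
  then show ?thesis
    using assms by (simp add: nn_integral_exp_square ennreal_power del: real_sqrt_divide)
qed

lemma matrix_inv_right:
  fixes A :: "real ^ 'n ^ 'n"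
  assumes "invertible A"
  shows "A ** matrix_inv A = mat 1"
  using assms unfolding invertible_def matrix_inv_def by (rule someI2_ex) (rule conjunct1)

context
  fixes B :: "real ^ 'n ^ 'n" and b r
  assumes eb: "eigenbasis B b r" and r: "\<And>i. 0 < r i"
begin

lemma eigenbasis_pos_det: "0 < det B"
  unfolding eigenbasis_det[OF eb] using r by (simp add: prod_pos)

lemma eigenbasis_invertible: "invertible B"
  using eigenbasis_pos_det invertible_det_nz[of B] by (metis less_irrefl)

text \<open>In the coordinate \<open>x\<close> the quadratic form becomes
  \<open>x \<bullet> x\<close>: the vector \<open>w\<close> with \<open>B (B w) = B x\<close>
  satisfies \<open>B w = x\<close>, and \<open>B\<close> is symmetric.\<close>

lemma gaussian_density_affine:
  "gaussian_density m (B ** transpose B) (m + B *v x) =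
     exp (- ((norm x)\<^sup>2 / 2)) / (sqrt (2 * pi) ^ CARD('n) * det B)"
proof -
  have BT: "transpose B = B" by (rule symmetric_if_eigenbasis[OF eb])
  define w where "w = matrix_inv (B ** B) *v (B *v x)"
  have inv: "invertible (B ** B)" by (rule invertible_mult[OF eigenbasis_invertible eigenbasis_invertible])
  have "B *v (B *v (matrix_inv (B ** B) *v u)) = u" for u
    by (simp only: matrix_vector_mul_assoc matrix_mul_assoc matrix_inv_right[OF inv] matrix_vector_mul_lid)
  then have "B *v (B *v w) = B *v x" unfolding w_def .
  then have "B *v w = x"
    using eigenbasis_invertible by (metis invertible_def matrix_vector_mul_assoc matrix_vector_mul_lid)
  then have "(B *v x) \<bullet> w = x \<bullet> x"
    using symmetric_inner_commute[OF BT, of x w] by simp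
  then have "- ((m + B *v x - m) \<bullet> (matrix_inv (B ** B) *v (m + B *v x - m))) / 2 = - ((norm x)\<^sup>2 / 2)"
    by (simp add: w_def power2_norm_eq_inner)
  moreover have "sqrt ((2 * pi) ^ CARD('n) * det (B ** B)) = sqrt (2 * pi) ^ CARD('n) * det B"
    using eigenbasis_pos_det
    by (simp add: det_mul real_sqrt_mult real_sqrt_power power_mult_distrib)
  ultimately show ?thesis unfolding gaussian_density_def BT by (simp only:)
qed

lemma gaussian_density_le:
  "gaussian_density m (B ** transpose B) y \<le> 1 / (sqrt (2 * pi) ^ CARD('n) * det B)"
proof -
  have "B *v (matrix_inv B *v (y - m)) = y - m"
    using matrix_inv_right[OF eigenbasis_invertible] by (simp add: matrix_vector_mul_assoc)
  then have "gaussian_density m (B ** transpose B) y =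
      exp (- ((norm (matrix_inv B *v (y - m)))\<^sup>2 / 2)) / (sqrt (2 * pi) ^ CARD('n) * det B)"
    using gaussian_density_affine[of m "matrix_inv B *v (y - m)"] by simp
  also have "\<dots> \<le> 1 / (sqrt (2 * pi) ^ CARD('n) * det B)"
    using eigenbasis_pos_det by (intro divide_right_mono) auto
  finally show ?thesis .
qed

lemma gaussian_density_pos: "0 < gaussian_density m (B ** transpose B) y"
proof -
  have "det B * det (transpose B) > 0" using eigenbasis_pos_det by simp
  then show ?thesis unfolding gaussian_density_def by (simp add: det_mul)
qed

lemma nn_integral_gaussian:
  assumes F [measurable]: "F \<in> borel_measurable borel"
    and [measurable]: "gaussian_density m (B ** transpose B) \<in> borel_measurable borel"
  shows "(\<integral>\<^sup>+y. ennreal (gaussian_density m (B ** transpose B) y) * F y \<partial>lborel) =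
    (\<integral>\<^sup>+x. ennreal (exp (- ((norm x)\<^sup>2 / 2)) / sqrt (2 * pi) ^ CARD('n)) * F (m + B *v x) \<partial>lborel)"
proof -
  have *: "det B * (exp (- ((norm x)\<^sup>2 / 2)) / (sqrt (2 * pi) ^ CARD('n) * det B)) =
      exp (- ((norm x)\<^sup>2 / 2)) / sqrt (2 * pi) ^ CARD('n)" for x :: "real ^ 'n"
    using eigenbasis_pos_det by (simp add: field_simps)
  have "(\<integral>\<^sup>+y. ennreal (gaussian_density m (B ** transpose B) y) * F y \<partial>lborel) =
      (\<integral>\<^sup>+x. ennreal (det B) * (ennreal (gaussian_density m (B ** transpose B) (m + B *v x)) * F (m + B *v x)) \<partial>lborel)"
    by (subst nn_integral_lborel_eigenbasis[OF eb r, of _ m]) (auto simp: nn_integral_cmult)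
  also have "\<dots> = (\<integral>\<^sup>+x. ennreal (exp (- ((norm x)\<^sup>2 / 2)) / sqrt (2 * pi) ^ CARD('n)) * F (m + B *v x) \<partial>lborel)"
    unfolding gaussian_density_affine mult.assoc[symmetric]
      ennreal_mult'[symmetric, OF less_imp_le[OF eigenbasis_pos_det]] * ..
  finally show ?thesis .
qed

lemma nn_integral_gaussian_density:
  assumes "gaussian_density m (B ** transpose B) \<in> borel_measurable borel"
  shows "(\<integral>\<^sup>+y. ennreal (gaussian_density m (B ** transpose B) y) \<partial>lborel) = 1"
proof -
  define K where "K = sqrt (2 * pi) ^ CARD('n)"
  have K: "0 < K" by (simp add: K_def)
  have "(\<integral>\<^sup>+y. ennreal (gaussian_density m (B ** transpose B) y) \<partial>lborel) =
    (\<integral>\<^sup>+x. ennreal (exp (- ((norm (x :: real ^ 'n))\<^sup>2 / 2)) / K) \<partial>lborel)"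
    using nn_integral_gaussian[OF _ assms, of "\<lambda>_. 1"] by (simp add: K_def)
  also have "\<dots> = (\<integral>\<^sup>+x. ennreal (inverse K) * ennreal (exp (- (1 / 2 * (norm (x :: real ^ 'n))\<^sup>2))) \<partial>lborel)"
    using K by (intro nn_integral_cong, subst ennreal_mult[symmetric]) (auto simp: field_simps)
  also have "\<dots> = ennreal (inverse K) * ennreal (sqrt (pi / (1 / 2)) ^ CARD('n))"
    using nn_integral_exp_norm_square[of "1 / 2", where 'n = 'n] by (subst nn_integral_cmult) simp_all
  also have "\<dots> = ennreal (inverse K * K)"
    using K by (simp add: K_def mult.commute flip: ennreal_mult)
  also have "\<dots> = 1" using K by simp
  finally show ?thesis .
qed

end

section \<open>The Metropolis--Hastings kernel\<close>

locale mh_target =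
  fixes p :: "'a::euclidean_space \<Rightarrow> real" and q :: "'a \<Rightarrow> 'a \<Rightarrow> real"
  assumes p_pos: "\<And>x. 0 < p x" and p_cont: "continuous_on UNIV p"
    and p_prob: "prob_space (density lborel (\<lambda>x. ennreal (p x)))"
    and q_pos: "\<And>x y. 0 < q x y" and q_cont: "continuous_on UNIV (\<lambda>z. q (fst z) (snd z))"
    and q_prob: "\<And>x. (\<integral>\<^sup>+y. ennreal (q x y) \<partial>lborel) = 1"
begin

abbreviation "\<pi> \<equiv> density lborel (\<lambda>x. ennreal (p x))"
abbreviation "acc \<equiv> mh_accept p q"
abbreviation "P \<equiv> mh_kernel p q"

text \<open>The density of an accepted move. Multiplied by \<open>p x\<close> it is the minimum of
  \<open>p x * q x y\<close> and \<open>p y * q y x\<close>, which is symmetric in the two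
  points.\<close>

definition flux :: "'a \<Rightarrow> 'a \<Rightarrow> real" where
  "flux x y = acc x y * q x y"

definition rej :: "'a \<Rightarrow> ennreal" where
  "rej x = (\<integral>\<^sup>+z. ennreal ((1 - acc x z) * q x z) \<partial>lborel)"

lemma acc_bounds: "0 < acc x y" "acc x y \<le> 1"
  using p_pos[of x] p_pos[of y] q_pos[of x y] q_pos[of y x] by (simp_all add: mh_accept_def)

lemma flux_eq: "flux x y = min (q x y) (p y * q y x / p x)"
proof -
  have "flux x y = min (1 * q x y) (p y * q y x / (p x * q x y) * q x y)"
    unfolding flux_def mh_accept_def using q_pos[of x y] by (simp add: min_mult_distrib_right)
  also have "p y * q y x / (p x * q x y) * q x y = p y * q y x / p x"
    using q_pos[of x y] p_pos[of x] by (simp add: field_simps)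
  finally show ?thesis by simp
qed

lemma detailed_balance: "p x * flux x y = p y * flux y x"
  using p_pos[of x] p_pos[of y] by (simp add: flux_eq min_mult_distrib_left min.commute)

lemma flux_pos: "0 < flux x y"
  unfolding flux_def using acc_bounds q_pos by simp

lemma continuous_flux: "continuous_on UNIV (\<lambda>z. flux (fst z) (snd z))"
proof -
  have q': "continuous_on UNIV (\<lambda>z :: 'a \<times> 'a. q (snd z) (fst z))"
  proof -
    have "continuous_on UNIV (\<lambda>z :: 'a \<times> 'a. (snd z, fst z))" by (intro continuous_intros)
    from continuous_on_compose2[OF q_cont this] show ?thesis by simp
  qed
  have p': "continuous_on UNIV (\<lambda>z :: 'a \<times> 'a. p (fst z))" "continuous_on UNIV (\<lambda>z :: 'a \<times> 'a. p (snd z))"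
    by (auto intro!: continuous_on_compose2[OF p_cont] continuous_intros)
  have "p (fst z) \<noteq> 0" for z :: "'a \<times> 'a" using p_pos[of "fst z"] by simp
  then show ?thesis
    unfolding flux_eq by (intro continuous_intros q_cont q' p') auto
qed

lemma measurable_p [measurable]: "p \<in> borel_measurable borel"
  using p_cont by (rule borel_measurable_continuous_onI)

lemma measurable_q_pair [measurable]: "(\<lambda>z. q (fst z) (snd z)) \<in> borel_measurable (borel \<Otimes>\<^sub>M borel)"
  using borel_measurable_continuous_onI[OF q_cont] by (simp add: borel_prod)

lemma measurable_flux_pair [measurable]: "(\<lambda>z. flux (fst z) (snd z)) \<in> borel_measurable (borel \<Otimes>\<^sub>M borel)"
  using borel_measurable_continuous_onI[OF continuous_flux] by (simp add: borel_prod)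

lemma measurable_q [measurable (raw)]:
  assumes "f \<in> borel_measurable M" "g \<in> borel_measurable M"
  shows "(\<lambda>x. q (f x) (g x)) \<in> borel_measurable M"
  using measurable_compose[OF measurable_Pair[OF assms] measurable_q_pair] by simp

lemma measurable_flux [measurable (raw)]:
  assumes "f \<in> borel_measurable M" "g \<in> borel_measurable M"
  shows "(\<lambda>x. flux (f x) (g x)) \<in> borel_measurable M"
  using measurable_compose[OF measurable_Pair[OF assms] measurable_flux_pair] by simp

lemma measurable_acc [measurable (raw)]:
  assumes "f \<in> borel_measurable M" "g \<in> borel_measurable M"
  shows "(\<lambda>x. acc (f x) (g x)) \<in> borel_measurable M"
  unfolding mh_accept_def using assms by measurable

lemma measurable_rej [measurable]: "rej \<in> borel_measurable borel"
  unfolding rej_def by measurable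

lemma flux_rej: "(\<integral>\<^sup>+y. ennreal (flux x y) \<partial>lborel) + rej x = 1"
proof -
  have "(\<integral>\<^sup>+y. ennreal (flux x y) \<partial>lborel) + rej x =
      (\<integral>\<^sup>+y. ennreal (flux x y) + ennreal ((1 - acc x y) * q x y) \<partial>lborel)"
    unfolding rej_def by (subst nn_integral_add) auto
  also have "\<dots> = (\<integral>\<^sup>+y. ennreal (q x y) \<partial>lborel)"
    using acc_bounds q_pos flux_pos
    by (intro nn_integral_cong, subst ennreal_plus[symmetric]) (auto simp: flux_def less_imp_le algebra_simps)
  finally show ?thesis by (simp add: q_prob)
qed

lemma rej_le_1: "rej x \<le> 1"
  using flux_rej[of x] by (metis add.commute le_iff_add)

lemma nn_integral_flux: "(\<integral>\<^sup>+y. ennreal (flux x y) \<partial>lborel) = ennreal (\<integral>y. flux x y \<partial>lborel)"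
proof -
  have "(\<integral>\<^sup>+y. ennreal (flux x y) \<partial>lborel) \<le> 1"
    using flux_rej[of x] by (metis le_iff_add)
  then have "(\<integral>\<^sup>+y. ennreal (flux x y) \<partial>lborel) < \<infinity>"
    by (auto simp: order_le_less_trans)
  then have "integrable lborel (flux x)"
    using flux_pos by (intro integrableI_nonneg) (auto simp: less_imp_le)
  then show ?thesis
    using flux_pos by (intro nn_integral_eq_integral) (auto simp: less_imp_le)
qed

lemma flux_integral_bounds: "0 \<le> (\<integral>y. flux x y \<partial>lborel)" "(\<integral>y. flux x y \<partial>lborel) \<le> 1"
proof -
  show "0 \<le> (\<integral>y. flux x y \<partial>lborel)" using flux_pos by (simp add: integral_nonneg_AE less_imp_le)
  have "ennreal (\<integral>y. flux x y \<partial>lborel) \<le> 1"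
    using flux_rej[of x] unfolding nn_integral_flux by (metis le_iff_add)
  then show "(\<integral>y. flux x y \<partial>lborel) \<le> 1" by simp
qed

lemma rej_eq: "rej x = ennreal (1 - (\<integral>y. flux x y \<partial>lborel))"
proof -
  have "rej x = 1 - ennreal (\<integral>y. flux x y \<partial>lborel)"
    using flux_rej[of x] unfolding nn_integral_flux by (metis ennreal_add_diff_cancel_left ennreal_neq_top infinity_ennreal_def)
  then show ?thesis
    using flux_integral_bounds[of x] by (simp add: ennreal_minus flip: ennreal_1)
qed

section \<open>The kernel as a measure: integrals, invariance, minorization\<close>

lemma sets_P [simp, measurable_cong]: "sets (P x) = sets borel"
  unfolding mh_kernel_def using sets.sigma_sets_eq[of "borel :: 'a measure"] by (simp add: sets_measure_of_conv)

lemma space_P [simp]: "space (P x) = UNIV"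
  using sets_eq_imp_space_eq[OF sets_P] by simp

lemma emeasure_P:
  assumes "A \<in> sets borel"
  shows "emeasure (P x) A = (\<integral>\<^sup>+y. ennreal (flux x y) * indicator A y \<partial>lborel) + rej x * indicator A x"
proof -
  have "acc x \<in> borel_measurable borel" "q x \<in> borel_measurable borel" by measurable
  from emeasure_mh_kernel[OF this assms] show ?thesis
    by (simp add: flux_def rej_def mult.commute)
qed

lemma nn_integral_P:
  assumes "\<psi> \<in> borel_measurable borel"
  shows "(\<integral>\<^sup>+y. \<psi> y \<partial>P x) = (\<integral>\<^sup>+y. ennreal (flux x y) * \<psi> y \<partial>lborel) + rej x * \<psi> x"
  using assms
proof (induction rule: borel_measurable_induct)
  case (cong f g)
  then show ?case by simp
next
  case (set A)
  then show ?case by (simp add: emeasure_P)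
next
  case (mult u c)
  then show ?case
    by (simp add: nn_integral_cmult distrib_left mult.left_commute[of _ c])
next
  case (add u v)
  then show ?case by (simp add: nn_integral_add distrib_left add_ac)
next
  case (seq U)
  note [measurable] = seq.hyps(1)
  have inc: "incseq (\<lambda>i. \<integral>\<^sup>+y. ennreal (flux x y) * U i y \<partial>lborel)" "incseq (\<lambda>i. rej x * U i x)"
    using seq.hyps by (auto simp: incseq_def le_fun_def intro!: nn_integral_mono mult_left_mono)
  have S: "Sup (range U) y = (SUP i. U i y)" for y by (simp add: image_image)
  have "(\<integral>\<^sup>+y. Sup (range U) y \<partial>P x) = (SUP i. \<integral>\<^sup>+y. U i y \<partial>P x)"
    unfolding S using seq.hyps
    by (intro nn_integral_monotone_convergence_SUP) auto
  also have "\<dots> = (SUP i. (\<integral>\<^sup>+y. ennreal (flux x y) * U i y \<partial>lborel) + rej x * U i x)"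
    using seq by simp
  also have "\<dots> = (SUP i. \<integral>\<^sup>+y. ennreal (flux x y) * U i y \<partial>lborel) + (SUP i. rej x * U i x)"
    by (rule ennreal_SUP_add[OF inc])
  also have "(SUP i. \<integral>\<^sup>+y. ennreal (flux x y) * U i y \<partial>lborel) = (\<integral>\<^sup>+y. (SUP i. ennreal (flux x y) * U i y) \<partial>lborel)"
    using seq.hyps
    by (intro nn_integral_monotone_convergence_SUP[symmetric])
      (auto simp: incseq_def le_fun_def intro!: mult_left_mono)
  finally show ?case
    unfolding S SUP_mult_left_ennreal .
qed

lemma prob_P: "prob_space (P x)"
  by (rule prob_spaceI) (simp add: emeasure_P flux_rej)

lemma measurable_P: "P \<in> borel \<rightarrow>\<^sub>M prob_algebra borel"
proof (rule measurable_prob_algebraI)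
  show "P \<in> borel \<rightarrow>\<^sub>M subprob_algebra borel"
  proof (rule measurable_subprob_algebra)
    show "(\<lambda>x. emeasure (P x) A) \<in> borel_measurable borel" if [measurable]: "A \<in> sets borel" for A
      by (simp add: emeasure_P[OF that])
  qed (simp_all add: prob_P prob_space_imp_subprob_space)
qed (rule prob_P)

lemma invariant_space: "\<pi> \<in> space (prob_algebra borel)"
  using p_prob by (simp add: space_prob_algebra)

text \<open>Detailed balance and Fubini show that the mass carried into \<open>A\<close> by accepted
  moves equals the mass that accepted moves take from points of \<open>A\<close>; together with the
  rejected mass the latter is the full mass of \<open>A\<close>.\<close>

lemma invariant: "\<pi> \<bind> P = \<pi>"
proof (rule measure_eqI)
  show s: "sets (\<pi> \<bind> P) = sets \<pi>"
    using sets_bind'[OF invariant_space measurable_P] by simp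
  fix A assume "A \<in> sets (\<pi> \<bind> P)"
  then have A [measurable]: "A \<in> sets borel" using s by simp
  have Pm: "P \<in> \<pi> \<rightarrow>\<^sub>M subprob_algebra borel"
    using measurable_prob_algebraD[OF measurable_P] by (simp cong: measurable_cong_sets)
  have pf: "ennreal (p x) * (ennreal (flux x y) * i) = ennreal (p y) * (ennreal (flux y x) * i)" for x y i
    using detailed_balance[of x y] p_pos flux_pos
    by (simp add: less_imp_le flip: mult.assoc ennreal_mult)
  have "emeasure (\<pi> \<bind> P) A = (\<integral>\<^sup>+x. ennreal (p x) * emeasure (P x) A \<partial>lborel)"
    using emeasure_bind[OF _ Pm A] measurable_emeasure_subprob_algebra[OF A]
    by (simp add: nn_integral_density emeasure_P)
  also have "\<dots> = (\<integral>\<^sup>+x. \<integral>\<^sup>+y. ennreal (p x) * (ennreal (flux x y) * indicator A y) \<partial>lborel \<partial>lborel) +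
      (\<integral>\<^sup>+x. ennreal (p x) * (rej x * indicator A x) \<partial>lborel)"
    by (simp add: emeasure_P distrib_left nn_integral_add nn_integral_cmult)
  also have "(\<integral>\<^sup>+x. \<integral>\<^sup>+y. ennreal (p x) * (ennreal (flux x y) * indicator A y) \<partial>lborel \<partial>lborel) =
      (\<integral>\<^sup>+y. \<integral>\<^sup>+x. ennreal (p x) * (ennreal (flux x y) * indicator A y) \<partial>lborel \<partial>lborel)"
    by (rule lborel_pair.Fubini') measurable
  also have "\<dots> = (\<integral>\<^sup>+y. \<integral>\<^sup>+x. ennreal (p y) * indicator A y * ennreal (flux y x) \<partial>lborel \<partial>lborel)"
    by (subst pf) (simp add: mult_ac)
  also have "\<dots> = (\<integral>\<^sup>+y. ennreal (p y) * indicator A y * (\<integral>\<^sup>+x. ennreal (flux y x) \<partial>lborel) \<partial>lborel)"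
    by (simp add: nn_integral_cmult)
  also have "\<dots> + (\<integral>\<^sup>+x. ennreal (p x) * (rej x * indicator A x) \<partial>lborel) =
      (\<integral>\<^sup>+x. ennreal (p x) * indicator A x * ((\<integral>\<^sup>+y. ennreal (flux x y) \<partial>lborel) + rej x) \<partial>lborel)"
    by (subst nn_integral_add[symmetric]) (auto simp: distrib_left mult_ac)
  also have "\<dots> = emeasure \<pi> A"
    by (simp add: flux_rej emeasure_density)
  finally show "emeasure (\<pi> \<bind> P) A = emeasure \<pi> A" .
qed

text \<open>The flux is continuous and positive, so it has a positive minimum \<open>e\<close> on
  the compact product of the closure of \<open>S\<close> with the unit ball; \<open>\<eta>\<close>
  is the uniform law on that ball.\<close>

lemma minorization:
  assumes "bounded S"
  shows "\<exists>\<epsilon> \<eta>. 0 < \<epsilon> \<and> \<epsilon> \<le> 1 \<and> prob_space \<eta> \<and> sets \<eta> = sets borel \<and>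
       (\<forall>x \<psi>. x \<in> S \<longrightarrow> \<psi> \<in> borel_measurable borel \<longrightarrow>
          ennreal \<epsilon> * (\<integral>\<^sup>+y. \<psi> y \<partial>\<eta>) \<le> (\<integral>\<^sup>+y. \<psi> y \<partial>P x))"
proof -
  define B where "B = cball (0 :: 'a) 1"
  \<comment> \<open>The point 0 keeps the compact set nonempty when \<open>S\<close> is
    empty.\<close>
  define K where "K = insert 0 (closure S)"
  have "compact (K \<times> B)" using assms by (auto simp: K_def B_def intro!: compact_Times compact_insert)
  moreover have "K \<times> B \<noteq> {}" by (auto simp: K_def B_def)
  ultimately obtain z where z: "\<And>w. w \<in> K \<times> B \<Longrightarrow> flux (fst z) (snd z) \<le> flux (fst w) (snd w)"
    using continuous_attains_inf[OF _ _ continuous_on_subset[OF continuous_flux]] by (metis subset_UNIV)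
  define e where "e = flux (fst z) (snd z)"
  have e: "0 < e" by (simp add: e_def flux_pos)
  have e_le: "e \<le> flux x y" if "x \<in> S" "y \<in> B" for x y
    using z[of "(x, y)"] that closure_subset[of S] by (auto simp: e_def K_def)
  define m where "m = measure lborel B"
  have em: "emeasure lborel B = ennreal m"
    unfolding m_def using emeasure_lborel_cball_finite[of "0 :: 'a" 1]
    by (intro emeasure_eq_ennreal_measure) (auto simp: B_def)
  have m: "0 < m" by (simp add: m_def B_def content_cball_pos)
  define \<eta> where "\<eta> = uniform_measure lborel B"
  define \<epsilon> where "\<epsilon> = min 1 (e * m)"
  have "prob_space \<eta>"
    unfolding \<eta>_def using m em by (intro prob_space_uniform_measure) (auto simp: ennreal_eq_0_iff)
  moreover have "ennreal \<epsilon> * (\<integral>\<^sup>+y. \<psi> y \<partial>\<eta>) \<le> (\<integral>\<^sup>+y. \<psi> y \<partial>P x)"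
    if x: "x \<in> S" and [measurable]: "\<psi> \<in> borel_measurable borel" for x \<psi>
  proof -
    have [measurable]: "B \<in> sets borel" by (simp add: B_def borel_closed)
    have "ennreal \<epsilon> * (\<integral>\<^sup>+y. \<psi> y \<partial>\<eta>) = ennreal \<epsilon> * ((\<integral>\<^sup>+y. \<psi> y * indicator B y \<partial>lborel) / ennreal m)"
      unfolding \<eta>_def em[symmetric] by (subst nn_integral_uniform_measure) auto
    also have "\<dots> = (ennreal \<epsilon> / ennreal m) * (\<integral>\<^sup>+y. \<psi> y * indicator B y \<partial>lborel)"
      by (simp add: divide_ennreal_def mult_ac)
    also have "\<dots> \<le> ennreal e * (\<integral>\<^sup>+y. \<psi> y * indicator B y \<partial>lborel)"
    proof (rule mult_right_mono)
      have "\<epsilon> / m \<le> e" using m by (simp add: \<epsilon>_def divide_le_eq)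
      then show "ennreal \<epsilon> / ennreal m \<le> ennreal e"
        using e m by (subst divide_ennreal) (auto simp: \<epsilon>_def intro!: ennreal_leI)
    qed simp
    also have "\<dots> = (\<integral>\<^sup>+y. ennreal e * (\<psi> y * indicator B y) \<partial>lborel)"
      by (simp add: nn_integral_cmult)
    also have "\<dots> \<le> (\<integral>\<^sup>+y. ennreal (flux x y) * \<psi> y \<partial>lborel)"
      using e_le[OF x] by (intro nn_integral_mono) (auto simp: indicator_def intro!: mult_right_mono ennreal_leI)
    also have "\<dots> \<le> (\<integral>\<^sup>+y. \<psi> y \<partial>P x)"
      by (simp add: nn_integral_P)
    finally show ?thesis .
  qed
  moreover have "0 < \<epsilon>" "\<epsilon> \<le> 1" using e m by (simp_all add: \<epsilon>_def)
  moreover have "sets \<eta> = sets borel" by (simp add: \<eta>_def)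
  ultimately show ?thesis by blast
qed

text \<open>Far out, rejection keeps at most the fraction \<open>1 - a\<close> of \<open>V x\<close>
  and accepted moves add at most \<open>a / 2\<close>, which makes \<open>1 - a / 2\<close> in
  total. In the ball the boundedness of \<open>V\<close> and the crude constant \<open>K\<close> are
  enough.\<close>

lemma geometrically_ergodic_if_drift:
  assumes V: "continuous_on UNIV V" "\<And>x. 1 \<le> V x" "\<And>R. bounded {x. V x \<le> R}"
    and a: "0 < a" "\<And>x. \<rho> \<le> norm x \<Longrightarrow> a \<le> (\<integral>y. flux x y \<partial>lborel)"
    and finite: "\<And>x. (\<integral>\<^sup>+y. ennreal (flux x y) * ennreal (V y) \<partial>lborel) \<le> ennreal (K * V x)"
    and far: "\<And>x. \<rho> \<le> norm x \<Longrightarrow>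
      (\<integral>\<^sup>+y. ennreal (flux x y) * ennreal (V y) \<partial>lborel) \<le> ennreal (a / 2 * V x)"
  shows "geometrically_ergodic P \<pi>"
proof -
  have V_meas: "V \<in> borel_measurable borel" using V(1) by (rule borel_measurable_continuous_onI)
  have V0: "0 \<le> V x" for x using V(2)[of x] by linarith
  obtain M where M: "\<And>x. x \<in> cball 0 \<rho> \<Longrightarrow> V x \<le> M"
  proof -
    have "compact (V ` cball 0 \<rho>)"
      by (intro compact_continuous_image continuous_on_subset[OF V(1)]) auto
    then have "bdd_above (V ` cball 0 \<rho>)" by (intro bounded_imp_bdd_above compact_imp_bounded)
    then obtain M where "\<forall>v \<in> V ` cball 0 \<rho>. v \<le> M" by (auto simp: bdd_above_def)
    then show ?thesis using that by blast
  qed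
  \<comment> \<open>Truncation at 1 keeps the drift rate \<open>1 - a' / 2\<close>
    nonnegative.\<close>
  define a' where "a' = min a 1"
  have a': "0 < a'" "a' \<le> 1" "a' \<le> a" using a by (simp_all add: a'_def)
  define b where "b = (\<bar>K\<bar> + 1) * \<bar>M\<bar> + 1"
  have b: "0 < b" by (simp add: b_def add_nonneg_pos)
  have drift: "(\<integral>\<^sup>+y. ennreal (V y) \<partial>P x) \<le> ennreal ((1 - a' / 2) * V x + b)" for x
  proof (cases "\<rho> \<le> norm x")
    case True
    define f where "f = (\<integral>y. flux x y \<partial>lborel)"
    have r: "rej x = ennreal (1 - f)" unfolding f_def by (rule rej_eq)
    have f: "a \<le> f" unfolding f_def by (rule a(2)[OF True])
    have f1: "f \<le> 1" unfolding f_def by (rule flux_integral_bounds)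
    have "(\<integral>\<^sup>+y. ennreal (V y) \<partial>P x) \<le> ennreal (a / 2 * V x) + ennreal (1 - f) * ennreal (V x)"
      using far[OF True] V_meas by (simp add: nn_integral_P r add_mono)
    also have "\<dots> = ennreal (a / 2 * V x + (1 - f) * V x)"
      using a f1 V0[of x] by (simp flip: ennreal_mult ennreal_plus)
    also have "\<dots> \<le> ennreal ((1 - a' / 2) * V x + b)"
    proof (rule ennreal_leI)
      have "(a / 2 + (1 - f)) * V x \<le> (1 - a' / 2) * V x"
        using f a' V0[of x] by (intro mult_right_mono) auto
      then show "a / 2 * V x + (1 - f) * V x \<le> (1 - a' / 2) * V x + b"
        using b by (simp add: distrib_right)
    qed
    finally show ?thesis .
  next
    case False
    then have VM: "V x \<le> \<bar>M\<bar>" using M[of x] by auto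
    have "(\<integral>\<^sup>+y. ennreal (V y) \<partial>P x) \<le> ennreal (\<bar>K\<bar> * V x) + 1 * ennreal (V x)"
    proof -
      have "ennreal (K * V x) \<le> ennreal (\<bar>K\<bar> * V x)"
        using V0[of x] by (intro ennreal_leI mult_right_mono) auto
      from order_trans[OF finite this] show ?thesis
        using V_meas by (simp only: nn_integral_P measurable_compose[OF V_meas measurable_ennreal])
          (intro add_mono mult_right_mono rej_le_1, auto)
    qed
    also have "\<dots> = ennreal ((\<bar>K\<bar> + 1) * V x)"
      using V0[of x] by (simp add: distrib_right flip: ennreal_plus)
    also have "\<dots> \<le> ennreal ((1 - a' / 2) * V x + b)"
    proof (rule ennreal_leI)
      have "(\<bar>K\<bar> + 1) * V x \<le> (\<bar>K\<bar> + 1) * \<bar>M\<bar>" using VM by (intro mult_left_mono) auto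
      moreover have "0 \<le> (1 - a' / 2) * V x" using V0[of x] a' by simp
      ultimately show "(\<bar>K\<bar> + 1) * V x \<le> (1 - a' / 2) * V x + b" by (simp add: b_def)
    qed
    finally show ?thesis .
  qed
  interpret harris_kernel P V \<pi> "1 - a' / 2" b
    using minorization[OF V(3), simplified] measurable_P V_meas V(2) a' b drift invariant_space invariant
    by unfold_locales auto
  show ?thesis by (rule geometrically_ergodic)
qed

end

section \<open>Log-densities of class C3\<close>

lemma differentiable_continuous_on_UNIV:
  fixes h :: "'a::real_normed_vector \<Rightarrow> 'b::real_normed_vector"
  assumes "\<And>x. h differentiable (at x)"
  shows "continuous_on UNIV h"
  using assms by (simp add: continuous_at_imp_continuous_on differentiable_imp_continuous_within)

lemma continuous_norm_bound_cball:
  fixes h :: "'a::euclidean_space \<Rightarrow> 'b::real_normed_vector"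
  assumes "continuous_on UNIV h"
  shows "\<exists>B\<ge>0. \<forall>x. norm x \<le> R \<longrightarrow> norm (h x) \<le> B"
proof -
  have "compact (h ` cball 0 R)"
    by (intro compact_continuous_image continuous_on_subset[OF assms]) auto
  then have "bounded (h ` cball 0 R)" by (rule compact_imp_bounded)
  then obtain B where "\<forall>y \<in> h ` cball 0 R. norm y \<le> B" unfolding bounded_iff by (rule exE)
  then have "norm (h x) \<le> \<bar>B\<bar>" if "norm x \<le> R" for x
    using that by (metis abs_ge_self dist_0_norm imageI mem_cball order_trans)
  then show ?thesis by (intro exI[of _ "\<bar>B\<bar>"]) simp
qed

locale C3_function =
  fixes g :: "real ^ 'd \<Rightarrow> real" and f :: "real ^ 'd \<Rightarrow> real ^ 'd"
  assumes C3: "C_k 3 g" and grad: "\<And>x. GDERIV g x :> f x"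
begin

abbreviation J :: "real ^ 'd \<Rightarrow> real ^ 'd ^ 'd" where
  "J x \<equiv> jacobian f (at x)"

lemma partial_deriv_eq: "partial_deriv i g = (\<lambda>x. f x $ i)"
proof
  fix x
  have "frechet_derivative g (at x) = (\<lambda>h. h \<bullet> f x)"
    using grad[of x] unfolding gderiv_def by (rule frechet_derivative_at[symmetric])
  then show "partial_deriv i g x = f x $ i"
    by (simp add: partial_deriv_def inner_axis inner_commute)
qed

lemma C2_component: "C_k 2 (\<lambda>x. f x $ i)"
proof -
  have "C_k (Suc 2) g" using C3 by (simp only: eval_nat_numeral BitM.simps One_nat_def)
  then have "C_k 2 (partial_deriv i g)" by (simp only: C_k.simps)
  then show ?thesis by (simp only: partial_deriv_eq)
qed

lemma f_has_derivative: "(f has_derivative (\<lambda>h. J x *v h)) (at x)"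
proof -
  have "(\<lambda>x. f x $ i) differentiable (at x)" for i
    using C2_component[of i] by (simp add: numeral_2_eq_2)
  then have "f differentiable (at x)"
    using differentiable_componentwise_within[of f x UNIV] by (auto simp: Basis_vec_def inner_axis)
  then show ?thesis by (simp add: jacobian_works)
qed

lemma J_component: "J x $ i $ j = partial_deriv j (\<lambda>x. f x $ i) x"
proof -
  have "((\<lambda>x. f x $ i) has_derivative (\<lambda>h. (J x *v h) $ i)) (at x)"
    by (rule bounded_linear.has_derivative[OF bounded_linear_vec_nth f_has_derivative])
  then have "frechet_derivative (\<lambda>x. f x $ i) (at x) = (\<lambda>h. (J x *v h) $ i)"
    by (rule frechet_derivative_at[symmetric])
  then show ?thesis
    by (simp add: partial_deriv_def matrix_vector_mul_component inner_axis)
qed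

lemma continuous_f: "continuous_on UNIV f"
  using f_has_derivative by (intro differentiable_continuous_on_UNIV) (auto simp: differentiable_def)

lemma continuous_g: "continuous_on UNIV g"
  using grad unfolding gderiv_def
  by (intro differentiable_continuous_on_UNIV) (auto simp: differentiable_def)

lemma continuous_J: "continuous_on UNIV J"
proof -
  have "continuous_on UNIV (partial_deriv j (\<lambda>x. f x $ i))" for i j
    using C2_component[of i] unfolding numeral_2_eq_2
    by (intro differentiable_continuous_on_UNIV) simp
  then have "continuous_on UNIV (\<lambda>x. J x $ i $ j)" for i j
    by (simp add: J_component)
  then have "continuous_on UNIV (\<lambda>x. \<chi> i j. J x $ i $ j)"
    by (intro continuous_on_vec_lambda)
  then show ?thesis by simp
qed

lemma continuous_vec_laplacian: "continuous_on UNIV (vec_laplacian f)"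
proof -
  have "continuous_on UNIV (partial_deriv j (partial_deriv j (\<lambda>x. f x $ i)))" for i j
    using C2_component[of i] by (simp add: numeral_2_eq_2)
  then show ?thesis
    unfolding vec_laplacian_def[abs_def] laplacian_def
    by (intro continuous_on_vec_lambda continuous_on_sum)
qed

section \<open>Calculus along lines\<close>

lemma line_derivative_g: "((\<lambda>t. g (a + t *\<^sub>R u)) has_real_derivative (f (a + t *\<^sub>R u) \<bullet> u)) (at t)"
proof -
  have "((\<lambda>t. a + t *\<^sub>R u) has_derivative (\<lambda>s. s *\<^sub>R u)) (at t)"
    by (auto intro!: derivative_eq_intros)
  from has_derivative_compose[OF this grad[unfolded gderiv_def]]
  show ?thesis by (simp add: has_field_derivative_def inner_commute mult_commute_abs mult.commute)
qed

lemma line_derivative_f: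
  "((\<lambda>t. f (a + t *\<^sub>R u) \<bullet> v) has_real_derivative ((J (a + t *\<^sub>R u) *v u) \<bullet> v)) (at t)"
proof -
  have "((\<lambda>t. a + t *\<^sub>R u) has_derivative (\<lambda>s. s *\<^sub>R u)) (at t)"
    by (auto intro!: derivative_eq_intros)
  from bounded_linear.has_derivative[OF bounded_linear_inner_left has_derivative_compose[OF this f_has_derivative]]
  show ?thesis
    by (simp add: has_field_derivative_def matrix_vector_mult_scaleR mult_commute_abs mult.commute)
qed

text \<open>Schwarz's theorem: both mixed derivatives are limits of the same second difference quotient.\<close>

lemma second_difference:
  assumes t: "0 < t"
  obtains y where "norm (y - x) \<le> t * (norm u + norm v)"
    and "g (x + t *\<^sub>R u + t *\<^sub>R v) - g (x + t *\<^sub>R u) - g (x + t *\<^sub>R v) + g x = t * t * ((J y *v v) \<bullet> u)"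
proof -
  define \<phi> where "\<phi> s = g ((x + t *\<^sub>R v) + s *\<^sub>R u) - g (x + s *\<^sub>R u)" for s
  define \<phi>' where "\<phi>' s = f ((x + t *\<^sub>R v) + s *\<^sub>R u) \<bullet> u - f (x + s *\<^sub>R u) \<bullet> u" for s
  have "DERIV \<phi> s :> \<phi>' s" for s
    unfolding \<phi>_def[abs_def] \<phi>'_def by (intro DERIV_diff line_derivative_g)
  then obtain s where s: "0 < s" "s < t" "\<phi> t - \<phi> 0 = (t - 0) * \<phi>' s"
    using MVT2[OF t, of \<phi> \<phi>'] by blast
  define \<psi> where "\<psi> r = f ((x + s *\<^sub>R u) + r *\<^sub>R v) \<bullet> u" for r
  have "DERIV \<psi> r :> ((J ((x + s *\<^sub>R u) + r *\<^sub>R v) *v v) \<bullet> u)" for r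
    unfolding \<psi>_def[abs_def] by (rule line_derivative_f)
  then obtain r where r: "0 < r" "r < t" "\<psi> t - \<psi> 0 = (t - 0) * ((J ((x + s *\<^sub>R u) + r *\<^sub>R v) *v v) \<bullet> u)"
    using MVT2[OF t, of \<psi> "\<lambda>r. (J ((x + s *\<^sub>R u) + r *\<^sub>R v) *v v) \<bullet> u"] by blast
  define y where "y = (x + s *\<^sub>R u) + r *\<^sub>R v"
  show ?thesis
  proof (rule that)
    have "norm (y - x) \<le> s * norm u + r * norm v"
      using norm_triangle_ineq[of "s *\<^sub>R u" "r *\<^sub>R v"] s r by (simp add: y_def)
    also have "\<dots> \<le> t * norm u + t * norm v"
      using s r by (intro add_mono mult_right_mono) auto
    finally show "norm (y - x) \<le> t * (norm u + norm v)" by (simp add: distrib_left)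
    have "\<psi> t - \<psi> 0 = \<phi>' s" by (simp add: \<psi>_def \<phi>'_def add_ac)
    then have "\<phi> t - \<phi> 0 = t * (t * ((J y *v v) \<bullet> u))"
      using s(3) r(3) by (simp add: y_def)
    then show "g (x + t *\<^sub>R u + t *\<^sub>R v) - g (x + t *\<^sub>R u) - g (x + t *\<^sub>R v) + g x = t * t * ((J y *v v) \<bullet> u)"
      by (simp add: \<phi>_def add_ac)
  qed
qed

lemma J_symmetric: "transpose (J x) = J x"
proof -
  have eq: "(J x *v v) \<bullet> u = (J x *v u) \<bullet> v" for u v
  proof (rule ccontr)
    assume ne: "(J x *v v) \<bullet> u \<noteq> (J x *v u) \<bullet> v"
    define e where "e = \<bar>(J x *v v) \<bullet> u - (J x *v u) \<bullet> v\<bar> / 2"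
    have e: "0 < e" using ne by (simp add: e_def)
    have cont: "continuous_on UNIV (\<lambda>y. (J y *v a) \<bullet> b)" for a b
      by (intro continuous_on_inner continuous_on_const continuous_on_matrix_vector_mult continuous_J)
    have ev: "\<forall>\<^sub>F y in nhds x. \<bar>(J y *v a) \<bullet> b - (J x *v a) \<bullet> b\<bar> < e" for a b
    proof -
      have "isCont (\<lambda>y. (J y *v a) \<bullet> b) x" using cont by (simp add: continuous_on_eq_continuous_at)
      then have "((\<lambda>y. (J y *v a) \<bullet> b) \<longlongrightarrow> (J x *v a) \<bullet> b) (nhds x)"
        unfolding isCont_def by (rule tendsto_at_iff_tendsto_nhds[THEN iffD1])
      from tendstoD[OF this e] show ?thesis by (simp add: dist_real_def)
    qed
    from eventually_conj[OF ev[of v u] ev[of u v]] obtain d where d: "0 < d"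
      "\<And>y. dist y x < d \<Longrightarrow> \<bar>(J y *v v) \<bullet> u - (J x *v v) \<bullet> u\<bar> < e"
      "\<And>y. dist y x < d \<Longrightarrow> \<bar>(J y *v u) \<bullet> v - (J x *v u) \<bullet> v\<bar> < e"
      unfolding eventually_nhds_metric by blast
    \<comment> \<open>With this \<open>t\<close> the intermediate points of both second differences
      lie within \<open>d\<close> of \<open>x\<close>, where each form is less than \<open>e\<close>
      away from its value at \<open>x\<close>; equal values there contradict a gap of
      \<open>2 * e\<close> at \<open>x\<close>.\<close>
    define t where "t = d / (2 * (norm u + norm v + 1))"
    have N: "0 < norm u + norm v + 1" by (simp add: add_nonneg_pos)
    have t: "0 < t" using d N by (simp add: t_def)
    have small: "t * (norm u + norm v) < d"
    proof -
      have "t * (norm u + norm v) \<le> t * (norm u + norm v + 1)" using t by simp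
      also have "\<dots> = d / 2"
      proof -
        have "d / (2 * n) * n = d / 2" if "0 < n" for n :: real using that by simp
        from this[OF N] show ?thesis unfolding t_def .
      qed
      finally show ?thesis using d by simp
    qed
    obtain y where y: "norm (y - x) \<le> t * (norm u + norm v)"
      "g (x + t *\<^sub>R u + t *\<^sub>R v) - g (x + t *\<^sub>R u) - g (x + t *\<^sub>R v) + g x = t * t * ((J y *v v) \<bullet> u)"
      using second_difference[OF t] by metis
    obtain z where z: "norm (z - x) \<le> t * (norm v + norm u)"
      "g (x + t *\<^sub>R v + t *\<^sub>R u) - g (x + t *\<^sub>R v) - g (x + t *\<^sub>R u) + g x = t * t * ((J z *v u) \<bullet> v)"
      using second_difference[OF t] by metis
    have "t * t * ((J y *v v) \<bullet> u) = t * t * ((J z *v u) \<bullet> v)"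
    proof -
      have "x + t *\<^sub>R v + t *\<^sub>R u = x + t *\<^sub>R u + t *\<^sub>R v" by (simp add: add_ac)
      with z(2) have "g (x + t *\<^sub>R u + t *\<^sub>R v) - g (x + t *\<^sub>R v) - g (x + t *\<^sub>R u) + g x =
          t * t * ((J z *v u) \<bullet> v)" by (simp only:)
      with y(2) show ?thesis by linarith
    qed
    then have "(J y *v v) \<bullet> u = (J z *v u) \<bullet> v" using t by simp
    moreover have "dist y x < d" "dist z x < d"
      using y(1) z(1) small by (simp_all add: dist_norm add.commute)
    ultimately show False
      using d(2)[of y] d(3)[of z] by (simp add: e_def abs_if split: if_splits)
  qed
  have "transpose (J x) *v u = J x *v u" for u
  proof -
    have "(transpose (J x) *v u) \<bullet> v = (J x *v u) \<bullet> v" for v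
      using eq[of v u] by (metis dot_lmul_matrix inner_commute transpose_matrix_vector)
    then show ?thesis by (metis vector_eq_rdot)
  qed
  then show ?thesis by (simp add: matrix_eq)
qed

text \<open>Outside the ball the form is nonpositive and on the ball \<open>J\<close> is bounded by
  compactness. The constant later controls \<open>line_density\<close> at points where
  \<open>g\<close> may fail to be concave.\<close>

lemma quadratic_form_upper_bound:
  assumes "\<And>x v. R \<le> norm x \<Longrightarrow> v \<bullet> (J x *v v) \<le> 0"
  obtains K where "0 \<le> K" "\<And>x v. v \<bullet> (J x *v v) \<le> K * (v \<bullet> v)"
proof -
  from bounded_bilinear.pos_bounded[OF bounded_bilinear_matrix_vector_mult[where 'n = 'd]]
  obtain C where *: "0 < C \<and> (\<forall>(A :: real ^ 'd ^ 'd) (v :: real ^ 'd). norm (A *v v) \<le> norm A * norm v * C)" ..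
  note C = *[THEN conjunct1] *[THEN conjunct2, THEN spec, THEN spec]
  obtain B where B: "0 \<le> B" "\<forall>x. norm x \<le> R \<longrightarrow> norm (J x) \<le> B"
    using continuous_norm_bound_cball[OF continuous_J] by blast
  show ?thesis
  proof (rule that)
    show "0 \<le> \<bar>B\<bar> * C" using C by simp
    show "v \<bullet> (J x *v v) \<le> \<bar>B\<bar> * C * (v \<bullet> v)" for x v
    proof (cases "R \<le> norm x")
      case True
      have "0 \<le> \<bar>B\<bar> * C * (v \<bullet> v)" using C by simp
      then show ?thesis using assms[OF True, of v] by linarith
    next
      case False
      have "v \<bullet> (J x *v v) \<le> norm v * norm (J x *v v)" by (rule norm_cauchy_schwarz)
      also have "\<dots> \<le> norm v * (norm (J x) * norm v * C)" by (intro mult_left_mono C(2)) simp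
      also have "\<dots> \<le> norm v * (\<bar>B\<bar> * norm v * C)"
        using B False C by (intro mult_left_mono mult_right_mono) auto
      also have "\<dots> = \<bar>B\<bar> * C * (v \<bullet> v)"
        by (simp add: dot_square_norm power2_eq_square mult_ac)
      finally show ?thesis .
    qed
  qed
qed

text \<open>Integrating the strong concavity twice along each ray, starting at radius
  \<open>R0\<close>, gives a quadratic upper bound whose constants are uniform in the direction by
  compactness of the ball.\<close>

lemma tends_to_minus_infinity:
  assumes \<delta>: "0 < \<delta>" and conc: "\<And>x v. R \<le> norm x \<Longrightarrow> v \<bullet> (J x *v v) \<le> - \<delta> * (v \<bullet> v)"
  shows "filterlim g at_bot at_infinity"
proof -
  define R0 where "R0 = max R 0"
  have R0: "R \<le> R0" "0 \<le> R0" by (simp_all add: R0_def)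
  obtain A where A: "\<forall>x. norm x \<le> R0 \<longrightarrow> norm (f x) \<le> A"
    using continuous_norm_bound_cball[OF continuous_f] by blast
  obtain B where B: "\<forall>x. norm x \<le> R0 \<longrightarrow> norm (g x) \<le> B"
    using continuous_norm_bound_cball[OF continuous_g] by blast
  have bound: "g x \<le> B + A * (norm x - R0) - \<delta> * (norm x - R0)\<^sup>2 / 2" if x: "R0 < norm x" for x
  proof -
    define n where "n = x /\<^sub>R norm x"
    have "norm x \<noteq> 0" using x R0 by linarith
    then have n: "norm n = 1" "x = norm x *\<^sub>R n" by (simp_all add: n_def)
    have slope: "f (0 + t *\<^sub>R n) \<bullet> n \<le> A - \<delta> * (t - R0)" if t: "R0 \<le> t" for t
    proof -
      have "(\<lambda>t. f (0 + t *\<^sub>R n) \<bullet> n + \<delta> * (t - R0)) t \<le> (\<lambda>t. f (0 + t *\<^sub>R n) \<bullet> n + \<delta> * (t - R0)) R0"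
      proof (rule DERIV_nonpos_imp_nonincreasing[OF t])
        fix s assume s: "R0 \<le> s" "s \<le> t"
        have "((\<lambda>t. f (0 + t *\<^sub>R n) \<bullet> n + \<delta> * (t - R0)) has_real_derivative
            (J (0 + s *\<^sub>R n) *v n) \<bullet> n + \<delta> * (1 - 0)) (at s)"
          by (intro DERIV_add line_derivative_f DERIV_cmult DERIV_diff DERIV_ident DERIV_const)
        moreover have "(J (0 + s *\<^sub>R n) *v n) \<bullet> n + \<delta> * (1 - 0) \<le> 0"
          using conc[of "s *\<^sub>R n" n] s R0 n by (simp add: inner_commute dot_square_norm)
        ultimately show "\<exists>y. ((\<lambda>t. f (0 + t *\<^sub>R n) \<bullet> n + \<delta> * (t - R0)) has_real_derivative y) (at s) \<and> y \<le> 0"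
          by blast
      qed
      moreover have "f (0 + R0 *\<^sub>R n) \<bullet> n \<le> A"
        using norm_cauchy_schwarz[of "f (0 + R0 *\<^sub>R n)" n] A[rule_format, of "0 + R0 *\<^sub>R n"] n R0 by simp
      ultimately show ?thesis by simp
    qed
    let ?G = "\<lambda>t. g (0 + t *\<^sub>R n) - (A * (t - R0) - \<delta> / 2 * (t - R0)\<^sup>2)"
    have "?G (norm x) \<le> ?G R0"
    proof (rule DERIV_nonpos_imp_nonincreasing[OF less_imp_le[OF x]])
      fix s assume s: "R0 \<le> s" "s \<le> norm x"
      have "(?G has_real_derivative (f (0 + s *\<^sub>R n) \<bullet> n - (A - \<delta> * (s - R0)))) (at s)"
        by (intro DERIV_diff line_derivative_g) (auto intro!: derivative_eq_intros)
      moreover have "f (0 + s *\<^sub>R n) \<bullet> n - (A - \<delta> * (s - R0)) \<le> 0"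
        using slope[OF s(1)] by simp
      ultimately show "\<exists>y. (?G has_real_derivative y) (at s) \<and> y \<le> 0" by blast
    qed
    moreover have "g (0 + R0 *\<^sub>R n) \<le> B" using B[rule_format, of "0 + R0 *\<^sub>R n"] n R0 by simp
    moreover have "g (0 + norm x *\<^sub>R n) = g x" using n(2) by simp
    ultimately show ?thesis by simp
  qed
  show ?thesis
    unfolding filterlim_at_bot eventually_at_infinity
  proof (intro allI exI impI)
    fix Z and x :: "real ^ 'd"
    define T where "T = norm x - R0"
    assume x: "R0 + 1 + \<bar>Z\<bar> + 2 * (\<bar>A\<bar> + \<bar>B\<bar> + 1) / \<delta> \<le> norm x"
    have pos: "0 \<le> 2 * (\<bar>A\<bar> + \<bar>B\<bar> + 1) / \<delta>" using \<delta> by simp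
    have T: "1 \<le> T" "\<bar>Z\<bar> \<le> T" "2 * (\<bar>A\<bar> + \<bar>B\<bar> + 1) / \<delta> \<le> T" using x pos unfolding T_def by linarith+
    have "\<bar>A\<bar> + \<bar>B\<bar> + 1 \<le> \<delta> / 2 * T" using T(3) \<delta> by (simp add: field_simps)
    then have "(\<bar>A\<bar> + \<bar>B\<bar> + 1) * T \<le> \<delta> / 2 * T * T" using T(1) by (intro mult_right_mono) auto
    moreover have "A * T \<le> \<bar>A\<bar> * T" using T(1) by (intro mult_right_mono) auto
    moreover have "B \<le> \<bar>B\<bar> * T" using T(1) mult_left_mono[of 1 T "\<bar>B\<bar>"] by simp
    moreover have "g x \<le> B + A * T - \<delta> * T\<^sup>2 / 2" using T(1) unfolding T_def by (intro bound) simp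
    ultimately have "g x \<le> - T" by (simp add: power2_eq_square algebra_simps)
    then show "g x \<le> Z" using T(2) by simp
  qed
qed

end

section \<open>Concave functions along Gaussian directions\<close>

lemma min_one_le_powr:
  fixes E k :: real
  assumes "0 < E" "0 \<le> k" "k \<le> 1"
  shows "min 1 E \<le> E powr k"
proof (cases "E \<le> 1")
  case True
  have "E powr 1 \<le> E powr k" using assms True by (intro powr_mono') auto
  then show ?thesis using assms by simp
next
  case False
  then have "1 \<le> E powr k" using assms by (intro ge_one_powr_ge_zero) auto
  then show ?thesis by simp
qed

text \<open>The bound \<open>min 1 E \<le> E powr k\<close> produces the factor
  \<open>exp ((s - k) * \<Delta>)\<close>. Taking \<open>k = 3 * s / 2\<close> for
  \<open>\<Delta> \<ge> 0\<close> and \<open>k = s / 2\<close> otherwise leaves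
  \<open>exp (- (s / 2 * \<bar>\<Delta>\<bar>))\<close> in both cases; \<open>3 * s \<le> 2\<close>
  ensures \<open>k \<le> 1\<close>.\<close>

lemma min_one_exp_le:
  fixes \<Delta> D r s :: real
  assumes D: "0 < D" and r: "0 \<le> r" and s: "0 < s" "3 * s \<le> 2"
  shows "min 1 (exp (- \<Delta>) * D * exp r) * exp (s * \<Delta>) \<le>
    exp (- (s / 2 * \<bar>\<Delta>\<bar>)) * (D powr (s / 2) + D powr (3 * s / 2)) * exp (3 * s / 2 * r)"
proof -
  have bound: "min 1 (exp (- \<Delta>) * D * exp r) * exp (s * \<Delta>) \<le>
      exp ((s - k) * \<Delta>) * D powr k * exp (3 * s / 2 * r)" if k: "0 \<le> k" "k \<le> 1" "k \<le> 3 * s / 2" for k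
  proof -
    have "min 1 (exp (- \<Delta>) * D * exp r) * exp (s * \<Delta>) \<le> (exp (- \<Delta>) * D * exp r) powr k * exp (s * \<Delta>)"
      using D k by (intro mult_right_mono min_one_le_powr) auto
    also have "\<dots> = exp ((s - k) * \<Delta>) * D powr k * exp (k * r)"
    proof -
      have "exp (- \<Delta>) powr k = exp (- (k * \<Delta>))" "exp r powr k = exp (k * r)"
        by (simp_all add: powr_def)
      moreover have "exp (- (k * \<Delta>)) * exp (s * \<Delta>) = exp ((s - k) * \<Delta>)"
        by (simp add: left_diff_distrib flip: exp_add)
      ultimately show ?thesis using D by (simp add: powr_mult mult_ac)
    qed
    also have "\<dots> \<le> exp ((s - k) * \<Delta>) * D powr k * exp (3 * s / 2 * r)"
    proof -
      have "k * r \<le> 3 * s / 2 * r" using k r by (intro mult_right_mono) auto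
      then show ?thesis by (intro mult_left_mono) auto
    qed
    finally show ?thesis .
  qed
  show ?thesis
  proof (cases "0 \<le> \<Delta>")
    case True
    have "min 1 (exp (- \<Delta>) * D * exp r) * exp (s * \<Delta>) \<le>
        exp ((s - 3 * s / 2) * \<Delta>) * D powr (3 * s / 2) * exp (3 * s / 2 * r)"
      using s by (intro bound) auto
    also have "(s - 3 * s / 2) * \<Delta> = - (s / 2 * \<bar>\<Delta>\<bar>)" using True by (simp add: field_simps)
    also have "exp (- (s / 2 * \<bar>\<Delta>\<bar>)) * D powr (3 * s / 2) * exp (3 * s / 2 * r) \<le>
      exp (- (s / 2 * \<bar>\<Delta>\<bar>)) * (D powr (s / 2) + D powr (3 * s / 2)) * exp (3 * s / 2 * r)"
      by (intro mult_right_mono mult_left_mono) auto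
    finally show ?thesis .
  next
    case False
    have "min 1 (exp (- \<Delta>) * D * exp r) * exp (s * \<Delta>) \<le>
        exp ((s - s / 2) * \<Delta>) * D powr (s / 2) * exp (3 * s / 2 * r)"
      using s by (intro bound) auto
    also have "(s - s / 2) * \<Delta> = - (s / 2 * \<bar>\<Delta>\<bar>)" using False by (simp add: field_simps)
    also have "exp (- (s / 2 * \<bar>\<Delta>\<bar>)) * D powr (s / 2) * exp (3 * s / 2 * r) \<le>
      exp (- (s / 2 * \<bar>\<Delta>\<bar>)) * (D powr (s / 2) + D powr (3 * s / 2)) * exp (3 * s / 2 * r)"
      by (intro mult_right_mono mult_left_mono) auto
    finally show ?thesis .
  qed
qed

text \<open>Trades the exponential for \<open>1 / (1 + v\<^sup>2)\<close>, the derivative of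
  \<open>arctan\<close>, so that products with a slope become parts of exact derivatives. The
  constant comes from the quadratic Taylor bound for \<open>exp\<close>.\<close>

lemma exp_neg_abs_le:
  fixes k v :: real
  assumes "0 < k"
  shows "exp (- (k * \<bar>v\<bar>)) \<le> (1 + 2 / k\<^sup>2) / (1 + v\<^sup>2)"
proof -
  have "1 + k * \<bar>v\<bar> + (k * \<bar>v\<bar>)\<^sup>2 / 2 \<le> exp (k * \<bar>v\<bar>)"
    using assms by (intro exp_lower_Taylor_quadratic) auto
  moreover have "0 \<le> k * \<bar>v\<bar>" using assms by simp
  moreover have "(k * \<bar>v\<bar>)\<^sup>2 / 2 = k\<^sup>2 * v\<^sup>2 / 2" by (simp add: power_mult_distrib)
  moreover have "0 \<le> k\<^sup>2 * v\<^sup>2 / 2" by simp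
  ultimately have q: "k\<^sup>2 * v\<^sup>2 / 2 \<le> exp (k * \<bar>v\<bar>)" and o: "1 \<le> exp (k * \<bar>v\<bar>)"
    by linarith+
  have "v\<^sup>2 = 2 / k\<^sup>2 * (k\<^sup>2 * v\<^sup>2 / 2)" using assms by simp
  also have "\<dots> \<le> 2 / k\<^sup>2 * exp (k * \<bar>v\<bar>)" using q by (intro mult_left_mono) auto
  finally have "1 + v\<^sup>2 \<le> exp (k * \<bar>v\<bar>) + 2 / k\<^sup>2 * exp (k * \<bar>v\<bar>)" using o by linarith
  then have "1 + v\<^sup>2 \<le> (1 + 2 / k\<^sup>2) * exp (k * \<bar>v\<bar>)" by (simp only: distrib_right mult_1_left)
  then have "exp (- (k * \<bar>v\<bar>)) * (1 + v\<^sup>2) \<le> exp (- (k * \<bar>v\<bar>)) * ((1 + 2 / k\<^sup>2) * exp (k * \<bar>v\<bar>))"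
    by (intro mult_left_mono) auto
  also have "\<dots> = 1 + 2 / k\<^sup>2" by (simp add: exp_minus)
  finally show ?thesis by (simp add: pos_le_divide_eq add_pos_nonneg)
qed

lemma mult_arctan_nonneg: "0 \<le> z * arctan (z :: real)"
  by (cases "0 \<le> z") (auto simp: mult_nonpos_nonpos)

text \<open>\<open>z * arctan z\<close> replaces \<open>\<bar>z\<bar>\<close>, since
  \<open>arctan\<close>, unlike the sign, is differentiable. The constant 1 pays for small
  \<open>z\<close>, and the factor 2 comes from \<open>arctan z \<ge> 1 / 2\<close> for
  \<open>z \<ge> 1\<close>.\<close>

lemma abs_le_mult_arctan: "\<bar>z\<bar> \<le> 1 + 2 * (z * arctan (z :: real))"
proof -
  have pos: "z \<le> 1 + 2 * (z * arctan z)" if "0 \<le> z" for z :: real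
  proof (cases "z \<le> 1")
    case True
    then show ?thesis using mult_arctan_nonneg[of z] by linarith
  next
    case False
    have "1 / 2 \<le> pi / 4" using pi_gt3 by simp
    also have "\<dots> \<le> arctan z" using False arctan_monotone'[of 1 z] by (simp add: arctan_one)
    finally have "z * (1 / 2) \<le> z * arctan z" using that by (intro mult_left_mono) auto
    then show ?thesis by simp
  qed
  show ?thesis using pos[of z] pos[of "- z"] by (cases "0 \<le> z") (auto simp: arctan_minus)
qed

text \<open>The integral is unchanged by the shift \<open>t *\<^sub>R e\<close>, so it may be
  averaged over \<open>t\<close> in the unit interval; after Fubini each segment contributes at most
  \<open>C\<close>. The weight has to be controlled only along such segments, by
  \<open>W'\<close>.\<close>

lemma nn_integral_line_average:
  fixes W W' F :: "'a::euclidean_space \<Rightarrow> ennreal"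
  assumes [measurable]: "W \<in> borel_measurable borel" "F \<in> borel_measurable borel" "W' \<in> borel_measurable borel"
    and W: "\<And>x t. 0 \<le> t \<Longrightarrow> t \<le> 1 \<Longrightarrow> W (x + t *\<^sub>R e) \<le> W' x"
    and F: "\<And>x. (\<integral>\<^sup>+t. F (x + t *\<^sub>R e) * indicator {0..1::real} t \<partial>lborel) \<le> C"
  shows "(\<integral>\<^sup>+x. W x * F x \<partial>lborel) \<le> C * (\<integral>\<^sup>+x. W' x \<partial>lborel)"
proof -
  have "(\<integral>\<^sup>+x. W x * F x \<partial>lborel) = (\<integral>\<^sup>+t. (\<integral>\<^sup>+x. W x * F x \<partial>lborel) * indicator {0..1::real} t \<partial>lborel)"
    by (simp add: nn_integral_cmult)
  also have "\<dots> = (\<integral>\<^sup>+t. (\<integral>\<^sup>+x. W (x + t *\<^sub>R e) * F (x + t *\<^sub>R e) \<partial>lborel) * indicator {0..1::real} t \<partial>lborel)"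
  proof (intro nn_integral_cong)
    fix t :: real
    show "(\<integral>\<^sup>+x. W x * F x \<partial>lborel) * indicator {0..1} t =
        (\<integral>\<^sup>+x. W (x + t *\<^sub>R e) * F (x + t *\<^sub>R e) \<partial>lborel) * indicator {0..1} t"
      using nn_integral_lborel_translate[of "\<lambda>x. W x * F x" "t *\<^sub>R e"] by (simp add: add.commute)
  qed
  also have "\<dots> = (\<integral>\<^sup>+t. \<integral>\<^sup>+x. W (x + t *\<^sub>R e) * F (x + t *\<^sub>R e) * indicator {0..1::real} t \<partial>lborel \<partial>lborel)"
    by (simp add: nn_integral_multc)
  also have "\<dots> = (\<integral>\<^sup>+x. \<integral>\<^sup>+t. W (x + t *\<^sub>R e) * F (x + t *\<^sub>R e) * indicator {0..1::real} t \<partial>lborel \<partial>lborel)"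
    by (rule lborel_pair.Fubini') measurable
  also have "\<dots> \<le> (\<integral>\<^sup>+x. \<integral>\<^sup>+t. W' x * (F (x + t *\<^sub>R e) * indicator {0..1::real} t) \<partial>lborel \<partial>lborel)"
    using W by (intro nn_integral_mono) (auto simp: indicator_def intro!: mult_right_mono)
  also have "\<dots> = (\<integral>\<^sup>+x. W' x * (\<integral>\<^sup>+t. F (x + t *\<^sub>R e) * indicator {0..1::real} t \<partial>lborel) \<partial>lborel)"
    by (simp add: nn_integral_cmult)
  also have "\<dots> \<le> (\<integral>\<^sup>+x. W' x * C \<partial>lborel)"
    by (intro nn_integral_mono mult_left_mono F) auto
  also have "\<dots> = C * (\<integral>\<^sup>+x. W' x \<partial>lborel)"
    by (subst nn_integral_multc) (simp_all add: mult.commute)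
  finally show ?thesis .
qed

context C3_function
begin

text \<open>The derivative of \<open>(arctan \<Delta> + 3) * arctan \<Delta>'\<close> along \<open>v\<close>, where \<open>\<Delta> = c - g\<close>. Where \<open>g\<close> is
  concave both summands are nonnegative, so the integral over a line segment bounds each of them.\<close>

definition line_density :: "real \<Rightarrow> real ^ 'd \<Rightarrow> real ^ 'd \<Rightarrow> real" where
  "line_density c v y = (f y \<bullet> v) * arctan (f y \<bullet> v) / (1 + (c - g y)\<^sup>2)
     + (arctan (c - g y) + 3) * (- ((J y *v v) \<bullet> v) / (1 + (f y \<bullet> v)\<^sup>2))"

text \<open>The shift 3 is chosen for this: with \<open>pi < 4\<close> the factor of the curvature
  stays between 1 and 5.\<close>

lemma arctan_plus_3_bounds: "1 \<le> arctan z + 3" "arctan z + 3 \<le> 5"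
  using arctan_bounded[of z] pi_less_4 by linarith+

lemma continuous_line_density: "continuous_on UNIV (line_density c v)"
proof -
  have nz: "1 + a\<^sup>2 \<noteq> 0" for a :: real by (metis add_nonneg_pos not_less_iff_gr_or_eq zero_le_power2 zero_less_one add.commute)
  show ?thesis
    unfolding line_density_def[abs_def]
    by (intro continuous_intros continuous_f continuous_g continuous_on_matrix_vector_mult continuous_J)
      (auto simp: nz)
qed

text \<open>Only the curvature summand can be negative, and by at most 5 times the curvature bound;
  adding \<open>5 * k\<close> therefore makes the density nonnegative everywhere, also where
  \<open>g\<close> is not concave.\<close>

lemma line_density_lower:
  assumes "v \<bullet> (J y *v v) \<le> k" "0 \<le> k"
  shows "- 5 * k \<le> line_density c v y"
proof -
  let ?q = "- ((J y *v v) \<bullet> v) / (1 + (f y \<bullet> v)\<^sup>2)"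
  have "0 \<le> (f y \<bullet> v) * arctan (f y \<bullet> v) / (1 + (c - g y)\<^sup>2)"
    using mult_arctan_nonneg by (intro divide_nonneg_nonneg) auto
  moreover have "- 5 * k \<le> (arctan (c - g y) + 3) * ?q"
  proof -
    have "1 * k \<le> (1 + (f y \<bullet> v)\<^sup>2) * k" using assms(2) by (intro mult_right_mono) auto
    then have "(J y *v v) \<bullet> v \<le> (1 + (f y \<bullet> v)\<^sup>2) * k" using assms(1) by (simp add: inner_commute)
    moreover have "0 < 1 + (f y \<bullet> v)\<^sup>2" by (simp add: add_pos_nonneg)
    ultimately have "(J y *v v) \<bullet> v / (1 + (f y \<bullet> v)\<^sup>2) \<le> k"
      by (simp only: pos_divide_le_eq mult.commute[of k])
    then have q: "- k \<le> ?q" by (simp add: minus_divide_left[symmetric])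
    show ?thesis
    proof (cases "0 \<le> ?q")
      case True
      have "0 \<le> (arctan (c - g y) + 3) * ?q" using True arctan_plus_3_bounds[of "c - g y"] by (intro mult_nonneg_nonneg) auto
      then show ?thesis using assms(2) by linarith
    next
      case False
      have "5 * ?q \<le> (arctan (c - g y) + 3) * ?q"
        using False arctan_plus_3_bounds[of "c - g y"] by (intro mult_right_mono_neg) auto
      then show ?thesis using q by linarith
    qed
  qed
  ultimately show ?thesis unfolding line_density_def by linarith
qed

text \<open>The integrand is an exact derivative. The product of arctangents lies between -10 and
  10, so it increases by at most 20 whatever \<open>a\<close> and \<open>c\<close> are; the linear
  compensator adds \<open>5 * k\<close>.\<close>

lemma line_density_integral:
  assumes k: "\<And>y. v \<bullet> (J y *v v) \<le> k" "0 \<le> k"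
  shows "(\<integral>\<^sup>+t. ennreal (line_density c v (a + t *\<^sub>R v) + 5 * k) * indicator {0..1} t \<partial>lborel)
    \<le> ennreal (20 + 5 * k)"
proof -
  \<comment> \<open>The second arctangent is taken at the derivative of \<open>c - g\<close> along
    the line; in \<open>line_density\<close> the sign of that slope has disappeared because
    \<open>z * arctan z\<close> is even.\<close>
  define F where "F t = (arctan (c - g (a + t *\<^sub>R v)) + 3) * arctan (- (f (a + t *\<^sub>R v) \<bullet> v)) + 5 * k * t" for t
  have F: "(F has_real_derivative (line_density c v (a + t *\<^sub>R v) + 5 * k)) (at t)" for t
  proof -
    have 1: "((\<lambda>t. c - g (a + t *\<^sub>R v)) has_real_derivative (0 - f (a + t *\<^sub>R v) \<bullet> v)) (at t)"
      by (intro DERIV_diff DERIV_const line_derivative_g)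
    have 2: "((\<lambda>t. - (f (a + t *\<^sub>R v) \<bullet> v)) has_real_derivative - ((J (a + t *\<^sub>R v) *v v) \<bullet> v)) (at t)"
      by (intro DERIV_minus line_derivative_f)
    note 3 = DERIV_chain2[OF DERIV_arctan 1] DERIV_chain2[OF DERIV_arctan 2]
    show ?thesis
      unfolding F_def[abs_def] line_density_def
      by (rule derivative_eq_intros 3 refl)+
        (simp add: arctan_minus divide_inverse algebra_simps)
  qed
  have Fb: "\<bar>(arctan z + 3) * arctan w\<bar> \<le> 10" for z w :: real
  proof -
    have "\<bar>arctan w\<bar> \<le> 2" using arctan_bounded[of w] pi_less_4 by auto
    then have "\<bar>arctan z + 3\<bar> * \<bar>arctan w\<bar> \<le> 5 * 2"
      using arctan_plus_3_bounds[of z] by (intro mult_mono) auto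
    then show ?thesis by (simp add: abs_mult)
  qed
  have "(\<lambda>t. line_density c v (a + t *\<^sub>R v)) \<in> borel_measurable borel"
    by (intro borel_measurable_continuous_onI continuous_on_compose2[OF continuous_line_density] continuous_intros) auto
  then have "(\<integral>\<^sup>+t. ennreal (line_density c v (a + t *\<^sub>R v) + 5 * k) * indicator {0..1} t \<partial>lborel) = ennreal (F 1 - F 0)"
  proof (intro nn_integral_FTC_Icc F)
    show "0 \<le> line_density c v (a + t *\<^sub>R v) + 5 * k" for t
      using line_density_lower[OF k, of c "a + t *\<^sub>R v"] by linarith
  qed auto
  also have "\<dots> \<le> ennreal (20 + 5 * k)"
    unfolding F_def using Fb[of "c - g (a + 1 *\<^sub>R v)" "- (f (a + 1 *\<^sub>R v) \<bullet> v)"]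
      Fb[of "c - g (a + 0 *\<^sub>R v)" "- (f (a + 0 *\<^sub>R v) \<bullet> v)"]
    by (intro ennreal_leI) (auto simp: abs_le_iff)
  finally show ?thesis .
qed

lemma line_density_dominates:
  assumes k: "0 < k" and conc: "v \<bullet> (J y *v v) \<le> 0"
  shows "exp (- (k * \<bar>c - g y\<bar>)) * \<bar>f y \<bullet> v\<bar> \<le> (1 + 2 / k\<^sup>2) * (1 + 2 * line_density c v y)"
    and "- ((J y *v v) \<bullet> v) / (1 + (f y \<bullet> v)\<^sup>2) \<le> line_density c v y"
    and "0 \<le> - ((J y *v v) \<bullet> v) / (1 + (f y \<bullet> v)\<^sup>2)" and "0 \<le> line_density c v y"
proof -
  let ?z = "f y \<bullet> v" and ?d = "1 + (c - g y)\<^sup>2" and ?q = "- ((J y *v v) \<bullet> v) / (1 + (f y \<bullet> v)\<^sup>2)"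
  have d: "1 \<le> ?d" by simp
  show q: "0 \<le> ?q" using conc by (intro divide_nonneg_nonneg) (auto simp: inner_commute)
  have z: "0 \<le> ?z * arctan ?z / ?d" using mult_arctan_nonneg d by (intro divide_nonneg_nonneg) auto
  have "1 * ?q \<le> (arctan (c - g y) + 3) * ?q" using q arctan_plus_3_bounds by (intro mult_right_mono) auto
  then have sum: "?z * arctan ?z / ?d + ?q \<le> line_density c v y" unfolding line_density_def by linarith
  then show "?q \<le> line_density c v y" "0 \<le> line_density c v y" using z q by linarith+
  have "exp (- (k * \<bar>c - g y\<bar>)) * \<bar>?z\<bar> \<le> (1 + 2 / k\<^sup>2) / ?d * (1 + 2 * (?z * arctan ?z))"
    using k by (intro mult_mono exp_neg_abs_le abs_le_mult_arctan) auto
  also have "\<dots> = (1 + 2 / k\<^sup>2) * (1 / ?d + 2 * (?z * arctan ?z / ?d))"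
    by (simp only: divide_inverse) (simp only: distrib_left mult_ac mult_1_left mult_1_right)
  also have "\<dots> \<le> (1 + 2 / k\<^sup>2) * (1 + 2 * line_density c v y)"
  proof (rule mult_left_mono)
    have "0 < ?d" using d by linarith
    then have "1 / ?d \<le> 1" using d by (simp only: pos_divide_le_eq mult_1_left)
    then show "1 / ?d + 2 * (?z * arctan ?z / ?d) \<le> 1 + 2 * line_density c v y" using sum q by linarith
  qed simp
  finally show "exp (- (k * \<bar>c - g y\<bar>)) * \<bar>?z\<bar> \<le> (1 + 2 / k\<^sup>2) * (1 + 2 * line_density c v y)" .
qed

end

section \<open>Drift of the accepted moves\<close>

lemma matrix_vector_mult_minus_left: "(- A) *v u = - (A *v (u :: real ^ 'n))"
  by (simp add: matrix_vector_mult_def vec_eq_iff sum_negf)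

lemma eigenbasis_minus:
  assumes "eigenbasis M b l"
  shows "eigenbasis (- M) b (\<lambda>i. - l i)"
  using assms by (simp add: eigenbasis_def matrix_vector_mult_minus_left)

text \<open>\<open>newton\<close> expresses the decrement through a Newton step: for
  \<open>J y *v w = f y\<close>, the number \<open>- (w \<bullet> f y)\<close> is the value at
  \<open>f y\<close> of the form inverse to \<open>- J y\<close>. \<open>c1\<close> says, in the
  determinant form in which it is used, that the inverse covariance is dominated by
  \<open>- J\<close> far out.\<close>

locale gaussian_mh = C3_function g f + mh_target "\<lambda>x. exp (g x)" q
  for g :: "real ^ 'd \<Rightarrow> real" and f and q +
  fixes \<mu> :: "real ^ 'd \<Rightarrow> real ^ 'd" and B :: "real ^ 'd \<Rightarrow> real ^ 'd ^ 'd" and b r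
    and K \<beta> \<delta> R0 c1 a \<rho> :: real
  assumes eb: "\<And>x. eigenbasis (B x) (b x) (r x)" and r_pos: "\<And>x i. 0 < r x i"
    and q_eq: "\<And>x y. q x y = gaussian_density (\<mu> x) (B x ** transpose (B x)) y"
    and K: "0 \<le> K" "\<And>x v. v \<bullet> (J x *v v) \<le> K * (v \<bullet> v)"
    and \<beta>: "0 \<le> \<beta>" "\<And>x v. (B x *v v) \<bullet> (B x *v v) \<le> \<beta> * (v \<bullet> v)"
    and \<delta>: "0 < \<delta>" "\<And>x v. R0 \<le> norm x \<Longrightarrow> v \<bullet> (J x *v v) \<le> - \<delta> * (v \<bullet> v)"
    and c1: "0 < c1" "\<And>y. R0 \<le> norm y \<Longrightarrow> 1 / (det (B y))\<^sup>2 \<le> c1 * det (- J y)"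
    and newton: "\<And>L. \<exists>R. \<forall>y. R \<le> norm y \<longrightarrow> (\<exists>w. J y *v w = f y \<and> L \<le> - (w \<bullet> f y))"
    and accept: "0 < a" "\<And>x. \<rho> \<le> norm x \<Longrightarrow> a \<le> (\<integral>y. flux x y \<partial>lborel)"
begin

definition s :: real where "s = 1 / (3 * CARD('d))"

lemma s_bounds: "0 < s" "3 * s \<le> 1" "s * CARD('d) = 1 / 3"
proof -
  have "1 \<le> real CARD('d)" by (simp add: Suc_leI)
  then show "0 < s" "3 * s \<le> 1" "s * CARD('d) = 1 / 3" by (simp_all add: s_def)
qed

definition dir :: "real ^ 'd \<Rightarrow> 'd \<Rightarrow> real ^ 'd" where
  "dir x i = B x *v axis i 1"

text \<open>The derivative, along the direction \<open>dir x i\<close>, of the arctangent of the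
  slope of \<open>- g\<close>; this normalisation is what makes its line integrals bounded.\<close>

definition curv :: "real ^ 'd \<Rightarrow> 'd \<Rightarrow> real ^ 'd \<Rightarrow> real" where
  "curv x i y = - ((J y *v dir x i) \<bullet> dir x i) / (1 + (f y \<bullet> dir x i)\<^sup>2)"

text \<open>The summand 1 makes this at least 1 in the concave region, so that its powers increase
  with the exponent.\<close>

definition grad_curv :: "real ^ 'd \<Rightarrow> real ^ 'd \<Rightarrow> real" where
  "grad_curv x y = 1 + (\<Sum>i\<in>UNIV. \<bar>f y \<bullet> dir x i\<bar> + curv x i y)"

lemma det_B_pos: "0 < det (B x)"
  by (rule eigenbasis_pos_det[OF eb r_pos])

lemma B_symmetric: "transpose (B x) = B x"
  by (rule symmetric_if_eigenbasis[OF eb])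

lemma concave:
  assumes "R0 \<le> norm y"
  shows "v \<bullet> (J y *v v) \<le> 0"
proof -
  have "0 \<le> \<delta> * (v \<bullet> v)" using \<delta>(1) by simp
  then show ?thesis using \<delta>(2)[OF assms, of v] by linarith
qed

lemma curv_nonneg:
  assumes "R0 \<le> norm y"
  shows "0 \<le> curv x i y"
  using concave[OF assms, of "dir x i"]
  unfolding curv_def by (intro divide_nonneg_nonneg) (auto simp: inner_commute)

lemma grad_curv_ge_1:
  assumes "R0 \<le> norm y"
  shows "1 \<le> grad_curv x y"
proof -
  have "0 \<le> (\<Sum>i\<in>UNIV. \<bar>f y \<bullet> dir x i\<bar> + curv x i y)"
    by (intro sum_nonneg add_nonneg_nonneg curv_nonneg assms) auto
  then show ?thesis by (simp add: grad_curv_def)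
qed

text \<open>The determinant is bounded by its smallest eigenvalue, which the Newton decrement controls, times
  a power of the trace.\<close>

lemma det_ratio_le:
  assumes y: "R0 \<le> norm y" and w: "J y *v w = f y" "0 < L" "L \<le> - (w \<bullet> f y)"
  shows "(det (B x) / det (B y))\<^sup>2 \<le> c1 / L * grad_curv x y ^ (3 * CARD('d))"
proof -
  let ?Z = "grad_curv x y"
  \<comment> \<open>The Hessian at \<open>y\<close> of \<open>- g\<close> in the coordinate of the
    proposal from \<open>x\<close>; its diagonal consists of the second derivatives in the
    directions \<open>dir x i\<close>.\<close>
  define N where "N = B x ** (- J y) ** B x"
  have N: "N *v u = B x *v (- (J y *v (B x *v u)))" for u
    by (simp only: N_def matrix_vector_mul_assoc[symmetric] matrix_vector_mult_minus_left)
  have symN: "transpose N = N"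
  proof -
    have "transpose (- J y) = - transpose (J y)" by (simp add: transpose_def vec_eq_iff)
    then show ?thesis
      by (simp add: N_def matrix_transpose_mul B_symmetric J_symmetric matrix_mul_assoc)
  qed
  have qN: "u \<bullet> (N *v u) = - ((B x *v u) \<bullet> (J y *v (B x *v u)))" for u
    unfolding N using symmetric_inner_commute[OF B_symmetric[of x], of u] by simp
  have inv: "invertible (B x)" by (rule eigenbasis_invertible[OF eb r_pos])
  have posN: "0 < u \<bullet> (N *v u)" if "u \<noteq> 0" for u
  proof -
    have "B x *v u \<noteq> 0"
      using inv that by (metis invertible_def matrix_vector_mul_assoc matrix_vector_mul_lid matrix_vector_mult_0_right)
    then have "0 < \<delta> * ((B x *v u) \<bullet> (B x *v u))" using \<delta>(1) by simp
    also have "\<dots> \<le> u \<bullet> (N *v u)" unfolding qN using \<delta>(2)[OF y, of "B x *v u"] by simp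
    finally show ?thesis .
  qed
  \<comment> \<open>The Newton step, pulled back by \<open>B x\<close>. Its pairing with
    \<open>B x *v f y\<close> is \<open>- (w \<bullet> f y)\<close>, whatever \<open>B x\<close> is:
    this is the affine invariance of the decrement.\<close>
  define z where "z = matrix_inv (B x) *v (- w)"
  have Bz: "B x *v z = - w"
    unfolding z_def matrix_vector_mul_assoc matrix_inv_right[OF inv] by simp
  have Nz: "N *v z = B x *v f y"
  proof -
    have "J y *v (- w) = - (J y *v w)" using matrix_vector_mult_diff_distrib[of "J y" 0 w] by simp
    then show ?thesis unfolding N Bz using w(1) by simp
  qed
  have zL: "L \<le> (B x *v f y) \<bullet> z"
    using symmetric_inner_commute[OF B_symmetric[of x], of "f y" z] w(3) by (simp add: Bz inner_commute)
  have Bf: "(B x *v f y) $ i = f y \<bullet> dir x i" for i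
  proof -
    have "(B x *v f y) $ i = axis i 1 \<bullet> (B x *v f y)" by (simp add: inner_axis')
    also have "\<dots> = dir x i \<bullet> f y"
      unfolding dir_def by (rule symmetric_inner_commute[OF B_symmetric])
    finally show ?thesis by (simp add: inner_commute)
  qed
  have Nii: "N $ i $ i = curv x i y * (1 + (f y \<bullet> dir x i)\<^sup>2)" for i
  proof -
    have "1 + (f y \<bullet> dir x i)\<^sup>2 \<noteq> 0" by (metis add_nonneg_pos add.commute less_irrefl zero_le_power2 zero_less_one)
    moreover have "N $ i $ i = axis i 1 \<bullet> (N *v axis i 1)"
      by (simp add: inner_commute[of "axis i 1"] inner_axis matrix_vector_mul_component)
    ultimately show ?thesis unfolding qN curv_def by (simp add: dir_def inner_commute)
  qed
  note c0 = curv_nonneg[OF y, of x]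
  note Z1 = grad_curv_ge_1[OF y, of x]
  have part: "1 + \<bar>f y \<bullet> dir x i\<bar> \<le> ?Z" for i
  proof -
    have "\<bar>f y \<bullet> dir x i\<bar> + curv x i y \<le> (\<Sum>i\<in>UNIV. \<bar>f y \<bullet> dir x i\<bar> + curv x i y)"
      using c0 by (intro member_le_sum) auto
    then show ?thesis unfolding grad_curv_def using c0[of i] by linarith
  qed
  have sq: "1 + (f y \<bullet> dir x i)\<^sup>2 \<le> ?Z\<^sup>2" for i
  proof -
    have "1 + (f y \<bullet> dir x i)\<^sup>2 \<le> (1 + \<bar>f y \<bullet> dir x i\<bar>)\<^sup>2" by (simp add: power2_sum)
    also have "\<dots> \<le> ?Z\<^sup>2" using part by (intro power_mono) auto
    finally show ?thesis .
  qed
  have sums: "(\<Sum>i\<in>UNIV. curv x i y) \<le> ?Z" "(\<Sum>i\<in>UNIV. \<bar>f y \<bullet> dir x i\<bar>) \<le> ?Z"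
    using c0 unfolding grad_curv_def sum.distrib by (simp_all add: sum_nonneg add_nonneg_nonneg)
  have "trace N = (\<Sum>i\<in>UNIV. curv x i y * (1 + (f y \<bullet> dir x i)\<^sup>2))" by (simp add: trace_def Nii)
  also have "\<dots> \<le> (\<Sum>i\<in>UNIV. curv x i y * ?Z\<^sup>2)" by (intro sum_mono mult_left_mono sq c0)
  also have "\<dots> \<le> ?Z * ?Z\<^sup>2" unfolding sum_distrib_right[symmetric] using sums by (intro mult_right_mono) auto
  finally have tr: "trace N \<le> ?Z ^ 3" by (simp add: power2_eq_square power3_eq_cube)
  have tr0: "0 \<le> trace N" unfolding trace_def Nii using c0 by (intro sum_nonneg mult_nonneg_nonneg) auto
  have grad: "(B x *v f y) \<bullet> (B x *v f y) \<le> ?Z\<^sup>2"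
  proof -
    have "(B x *v f y) \<bullet> (B x *v f y) = (\<Sum>i\<in>UNIV. \<bar>f y \<bullet> dir x i\<bar> * \<bar>f y \<bullet> dir x i\<bar>)"
      by (simp add: inner_vec_def Bf)
    also have "\<dots> \<le> (\<Sum>i\<in>UNIV. \<bar>f y \<bullet> dir x i\<bar> * ?Z)"
    proof (intro sum_mono mult_left_mono)
      show "\<bar>f y \<bullet> dir x i\<bar> \<le> ?Z" for i using part[of i] by linarith
    qed simp
    also have "\<dots> \<le> ?Z * ?Z" unfolding sum_distrib_right[symmetric] using sums Z1 by (intro mult_right_mono) auto
    finally show ?thesis by (simp add: power2_eq_square)
  qed
  have "(det (B x) / det (B y))\<^sup>2 = (det (B x))\<^sup>2 * (1 / (det (B y))\<^sup>2)" by (simp add: power_divide)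
  also have "\<dots> \<le> (det (B x))\<^sup>2 * (c1 * det (- J y))" by (intro mult_left_mono c1(2) y) auto
  also have "\<dots> = c1 * det N" by (simp add: N_def det_mul power2_eq_square)
  also have "\<dots> \<le> c1 * ((B x *v f y) \<bullet> (B x *v f y) / L * trace N ^ (CARD('d) - 1))"
    using c1(1) by (intro mult_left_mono det_le_trace_power[OF symN posN Nz w(2) zL]) auto
  also have "\<dots> \<le> c1 * (?Z\<^sup>2 / L * (?Z ^ 3) ^ (CARD('d) - 1))"
    using c1(1) w(2) grad tr tr0
    by (intro mult_left_mono mult_mono divide_right_mono power_mono) auto
  \<comment> \<open>The squared gradient has degree 2 and each of the other
    \<open>CARD('d) - 1\<close> eigenvalues degree 3; the total is then rounded up to three times
    the dimension.\<close>
  also have "\<dots> = c1 / L * (?Z ^ (2 + 3 * (CARD('d) - 1)))" by (simp add: power_add power2_eq_square flip: power_mult)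
  also have "\<dots> \<le> c1 / L * ?Z ^ (3 * CARD('d))"
  proof (intro mult_left_mono power_increasing Z1)
    have "1 \<le> CARD('d)" by (simp add: Suc_leI)
    then show "2 + 3 * (CARD('d) - 1) \<le> 3 * CARD('d)" by arith
  qed (use c1(1) w(2) in auto)
  finally show ?thesis .
qed

text \<open>The exponents are \<open>2 * \<theta>\<close> with \<open>\<theta>\<close> equal to
  \<open>s / 4\<close> and \<open>3 * s / 4\<close>. Since \<open>3 * CARD('d) * s = 1\<close>, the
  power of \<open>grad_curv\<close> drops to at most 1; since \<open>c1 \<le> L\<close>, the factor
  \<open>(c1 / L) powr \<theta>\<close> is largest at \<open>\<theta> = s / 4\<close>.\<close>

lemma det_ratio_powr_le:
  assumes y: "R0 \<le> norm y" and w: "J y *v w = f y" "c1 \<le> L" "L \<le> - (w \<bullet> f y)"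
  shows "(det (B x) / det (B y)) powr (s / 2) + (det (B x) / det (B y)) powr (3 * s / 2)
    \<le> 2 * (c1 / L) powr (s / 4) * grad_curv x y"
proof -
  let ?Z = "grad_curv x y" and ?D = "det (B x) / det (B y)"
  have L: "0 < L" using c1(1) w(2) by linarith
  have D: "0 < ?D" using det_B_pos by simp
  note Z1 = grad_curv_ge_1[OF y, of x]
  have bound: "?D powr (2 * \<theta>) \<le> (c1 / L) powr (s / 4) * ?Z" if \<theta>: "s / 4 \<le> \<theta>" "\<theta> \<le> s" for \<theta>
  proof -
    have \<theta>0: "0 < \<theta>" using \<theta> s_bounds by linarith
    have "?D powr (2 * \<theta>) = (?D\<^sup>2) powr \<theta>"
      using D by (simp add: powr_powr[symmetric] flip: powr_numeral)
    also have "\<dots> \<le> (c1 / L * ?Z ^ (3 * CARD('d))) powr \<theta>"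
      using \<theta>0 by (intro powr_mono2 det_ratio_le[OF y w(1) L w(3)]) auto
    also have "\<dots> = (c1 / L) powr \<theta> * ?Z powr (3 * CARD('d) * \<theta>)"
    proof -
      have "?Z ^ (3 * CARD('d)) = ?Z powr (3 * CARD('d))" using Z1 powr_realpow[of ?Z "3 * CARD('d)"] by simp
      then show ?thesis using c1(1) L by (simp only: powr_mult powr_powr)
    qed
    also have "\<dots> \<le> (c1 / L) powr (s / 4) * ?Z powr 1"
    proof (intro mult_mono)
      show "(c1 / L) powr \<theta> \<le> (c1 / L) powr (s / 4)"
        using \<theta> c1(1) L w(2) by (intro powr_mono') auto
      have "3 * real CARD('d) * \<theta> \<le> 3 * real CARD('d) * s" using \<theta> by (intro mult_left_mono) auto
      also have "\<dots> = 1" using s_bounds(3) by (simp add: mult.commute)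
      finally show "?Z powr (3 * CARD('d) * \<theta>) \<le> ?Z powr 1" using Z1 by (intro powr_mono) auto
    qed auto
    finally show ?thesis using Z1 by simp
  qed
  have "?D powr (s / 2) \<le> (c1 / L) powr (s / 4) * ?Z" "?D powr (3 * s / 2) \<le> (c1 / L) powr (s / 4) * ?Z"
    using bound[of "s / 4"] bound[of "3 * s / 4"] s_bounds by simp_all
  then show ?thesis by simp
qed

text \<open>The constant of \<open>exp_neg_abs_le\<close> for the decay rate
  \<open>s / 2\<close>.\<close>

definition cs :: real where "cs = 1 + 2 / (s / 2)\<^sup>2"

definition cz :: real where "cz = 2 + CARD('d) * cs + 2 * cs"

lemma cs_cz_nonneg: "0 \<le> cs" "0 \<le> cz"
  by (simp_all add: cs_def cz_def)

text \<open>The exponential is spent on the slopes, which need its decay in \<open>c - g y\<close>;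
  for the curvature terms it is simply bounded by 1.\<close>

lemma grad_curv_le_line_density:
  assumes y: "R0 \<le> norm y"
  shows "exp (- (s / 2 * \<bar>c - g y\<bar>)) * grad_curv x y \<le> cz * (1 + (\<Sum>i\<in>UNIV. line_density c (dir x i) y))"
proof -
  let ?e = "exp (- (s / 2 * \<bar>c - g y\<bar>))" and ?L = "\<lambda>i. line_density c (dir x i) y"
  have s2: "0 < s / 2" using s_bounds by simp
  note dom = line_density_dominates(1)[where c = c, OF s2 concave[OF y]]
    line_density_dominates(2)[where c = c, OF s2 concave[OF y]] line_density_dominates(4)[where c = c, OF s2 concave[OF y]]
  have e: "0 \<le> ?e" "?e \<le> 1" using s2 by simp_all
  have L0: "0 \<le> (\<Sum>i\<in>UNIV. ?L i)" using dom(3) by (simp add: sum_nonneg)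
  have "?e * grad_curv x y = ?e + (\<Sum>i\<in>UNIV. ?e * \<bar>f y \<bullet> dir x i\<bar> + ?e * curv x i y)"
    by (simp add: grad_curv_def distrib_left sum_distrib_left)
  also have "\<dots> \<le> 1 + (\<Sum>i\<in>UNIV. cs * (1 + 2 * ?L i) + ?L i)"
  proof (intro add_mono e sum_mono)
    show "?e * \<bar>f y \<bullet> dir x i\<bar> \<le> cs * (1 + 2 * ?L i)" for i
      unfolding cs_def by (rule dom(1))
    show "?e * curv x i y \<le> ?L i" for i
    proof -
      have "?e * curv x i y \<le> 1 * curv x i y" using curv_nonneg[OF y] e by (intro mult_right_mono) auto
      also have "\<dots> \<le> ?L i" unfolding curv_def using dom(2) by simp
      finally show ?thesis .
    qed
  qed
  also have "\<dots> = 1 + CARD('d) * cs + (2 * cs + 1) * (\<Sum>i\<in>UNIV. ?L i)"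
    by (simp add: sum.distrib sum_distrib_left algebra_simps)
  also have "\<dots> \<le> cz + cz * (\<Sum>i\<in>UNIV. ?L i)"
  proof (intro add_mono mult_right_mono L0)
    have "0 \<le> real CARD('d) * cs" using cs_cz_nonneg by simp
    then show "1 + real CARD('d) * cs \<le> cz" "2 * cs + 1 \<le> cz" using cs_cz_nonneg by (simp_all add: cz_def)
  qed
  finally show ?thesis by (simp add: distrib_left)
qed

text \<open>The integral of the weight \<open>exp (- (1 / 4 * (norm z)\<^sup>2))\<close>, plus for
  each coordinate the line bound \<open>20 + 5 * (K * \<beta>)\<close> times the integral of the
  wider weight with rate \<open>1 / 8\<close>.\<close>

definition ci :: real where
  "ci = sqrt (pi / (1 / 4)) ^ CARD('d) + CARD('d) * ((20 + 5 * (K * \<beta>)) * (exp (1 / 4) * sqrt (pi / (1 / 8)) ^ CARD('d)))"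

lemma dir_curvature: "dir x i \<bullet> (J y *v dir x i) \<le> K * \<beta>"
proof -
  have "dir x i \<bullet> dir x i \<le> \<beta>" using \<beta>(2)[of x "axis i 1"] by (simp add: dir_def inner_axis)
  then have "K * (dir x i \<bullet> dir x i) \<le> K * \<beta>" using K(1) by (intro mult_left_mono)
  then show ?thesis using K(2)[of "dir x i" y] by linarith
qed

text \<open>In the coordinate \<open>z\<close> the direction \<open>dir x i\<close> becomes the
  \<open>i\<close>-th axis, along which each density is averaged. The resulting bound depends
  neither on the centre \<open>m\<close> nor on \<open>x\<close> or \<open>c\<close>.\<close>

lemma gaussian_line_density:
  "(\<integral>\<^sup>+z. ennreal (exp (- (1 / 4 * (norm z)\<^sup>2))) *
      ennreal (1 + (\<Sum>i\<in>UNIV. line_density c (dir x i) (m + B x *v z) + 5 * (K * \<beta>))) \<partial>lborel) \<le> ennreal ci"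
proof -
  let ?k = "K * \<beta>"
  let ?W = "\<lambda>z :: real ^ 'd. ennreal (exp (- (1 / 4 * (norm z)\<^sup>2)))"
  let ?W' = "\<lambda>z :: real ^ 'd. ennreal (exp (1 / 4)) * ennreal (exp (- (1 / 8 * (norm z)\<^sup>2)))"
  define F where "F i z = ennreal (line_density c (dir x i) (m + B x *v z) + 5 * ?k)" for i z
  have k: "0 \<le> ?k" using K(1) \<beta>(1) by simp
  have nonneg: "0 \<le> line_density c (dir x i) y + 5 * ?k" for i y
    using line_density_lower[OF dir_curvature k, of c x i y] by linarith
  have [measurable]: "line_density c v \<in> borel_measurable borel" for v
    by (rule borel_measurable_continuous_onI[OF continuous_line_density])
  have [measurable]: "F i \<in> borel_measurable borel" for i unfolding F_def by measurable
  \<comment> \<open>Along a step of length at most 1 the weight of rate \<open>1 / 4\<close> is at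
    most \<open>exp (1 / 4)\<close> times the weight of rate \<open>1 / 8\<close>, because the
    square of \<open>a + 1\<close> is at most \<open>2 * a\<^sup>2 + 2\<close>.\<close>
  have W: "?W (z + t *\<^sub>R axis i 1) \<le> ?W' z" if "0 \<le> t" "t \<le> 1" for z t and i :: 'd
  proof -
    have "norm z \<le> norm (z + t *\<^sub>R axis i 1) + 1"
      using norm_triangle_ineq4[of "z + t *\<^sub>R axis i 1" "t *\<^sub>R axis i 1"] that by simp
    then have "(norm z)\<^sup>2 \<le> (norm (z + t *\<^sub>R axis i 1) + 1)\<^sup>2" by (intro power_mono) auto
    also have "\<dots> \<le> 2 * (norm (z + t *\<^sub>R axis i 1))\<^sup>2 + 2"
      using zero_le_power2[of "norm (z + t *\<^sub>R axis i 1) - 1"] by (simp add: power2_eq_square algebra_simps)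
    finally show ?thesis by (simp flip: ennreal_mult exp_add)
  qed
  have FC: "(\<integral>\<^sup>+t. F i (z + t *\<^sub>R axis i 1) * indicator {0..1::real} t \<partial>lborel) \<le> ennreal (20 + 5 * ?k)" for i z
    using line_density_integral[OF dir_curvature k, of c x i "m + B x *v z"]
    by (simp add: F_def dir_def matrix_vector_right_distrib matrix_vector_mult_scaleR add.assoc)
  have one: "(\<integral>\<^sup>+z. ?W z * F i z \<partial>lborel) \<le> ennreal ((20 + 5 * ?k) * (exp (1 / 4) * sqrt (pi / (1 / 8)) ^ CARD('d)))" for i
  proof -
    have "(\<integral>\<^sup>+z. ?W z * F i z \<partial>lborel) \<le> ennreal (20 + 5 * ?k) * (\<integral>\<^sup>+z. ?W' z \<partial>lborel)"
      by (rule nn_integral_line_average[where e = "axis i 1" and W = ?W and F = "F i" and W' = ?W', OF _ _ _ W FC])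
        measurable
    also have "(\<integral>\<^sup>+z. ?W' z \<partial>lborel) = ennreal (exp (1 / 4)) * ennreal (sqrt (pi / (1 / 8)) ^ CARD('d))"
      using nn_integral_exp_norm_square[of "1 / 8", where 'n = 'd] by (subst nn_integral_cmult) simp_all
    finally show ?thesis using k by (simp add: ennreal_mult)
  qed
  have split: "ennreal (1 + (\<Sum>i\<in>UNIV. line_density c (dir x i) (m + B x *v z) + 5 * ?k)) = 1 + (\<Sum>i\<in>UNIV. F i z)" for z
  proof -
    have "(\<Sum>i\<in>UNIV. F i z) = ennreal (\<Sum>i\<in>UNIV. line_density c (dir x i) (m + B x *v z) + 5 * ?k)"
      unfolding F_def by (rule sum_ennreal) (rule nonneg)
    then show ?thesis using nonneg by (simp add: ennreal_plus sum_nonneg del: sum.distrib)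
  qed
  have "(\<integral>\<^sup>+z. ?W z * (1 + (\<Sum>i\<in>UNIV. F i z)) \<partial>lborel) =
      (\<integral>\<^sup>+z. ?W z \<partial>lborel) + (\<Sum>i\<in>UNIV. \<integral>\<^sup>+z. ?W z * F i z \<partial>lborel)"
    by (simp add: distrib_left sum_distrib_left nn_integral_add nn_integral_sum)
  also have "\<dots> \<le> ennreal (sqrt (pi / (1 / 4)) ^ CARD('d)) +
      (\<Sum>i\<in>(UNIV :: 'd set). ennreal ((20 + 5 * ?k) * (exp (1 / 4) * sqrt (pi / (1 / 8)) ^ CARD('d))))"
    using nn_integral_exp_norm_square[of "1 / 4", where 'n = 'd] by (intro add_mono sum_mono one) simp
  also have "\<dots> = ennreal ci"
    unfolding ci_def using k
    by (subst sum_ennreal, simp) (subst ennreal_plus[symmetric], auto intro!: mult_nonneg_nonneg)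
  finally show ?thesis by (simp only: split)
qed

text \<open>The reverse density is replaced by the peak value of its Gaussian, so the mean at the
  arrival point disappears; \<open>exp ((norm z)\<^sup>2 / 2)\<close> is the reciprocal of the
  Gaussian factor of the forward density.\<close>

lemma acceptance_le:
  "acc x (\<mu> x + B x *v z) \<le>
    min 1 (exp (- (g x - g (\<mu> x + B x *v z))) * (det (B x) / det (B (\<mu> x + B x *v z))) * exp ((norm z)\<^sup>2 / 2))"
proof -
  define y where "y = \<mu> x + B x *v z"
  define C where "C = sqrt (2 * pi) ^ CARD('d)"
  have C: "0 < C" by (simp add: C_def)
  have qxy: "q x y = exp (- ((norm z)\<^sup>2 / 2)) / (C * det (B x))"
    unfolding q_eq y_def C_def by (rule gaussian_density_affine[OF eb r_pos])
  have qyx: "q y x \<le> 1 / (C * det (B y))"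
    unfolding q_eq C_def by (rule gaussian_density_le[OF eb r_pos])
  have "exp (g y) * q y x / (exp (g x) * q x y) \<le> exp (g y) * (1 / (C * det (B y))) / (exp (g x) * q x y)"
    using qyx q_pos[of x y] by (intro divide_right_mono mult_left_mono) auto
  also have "\<dots> = exp (- (g x - g y)) * (det (B x) / det (B y)) * exp ((norm z)\<^sup>2 / 2)"
    unfolding qxy using C det_B_pos[of x] det_B_pos[of y]
    by (simp add: exp_diff exp_minus field_simps)
  finally show ?thesis unfolding mh_accept_def y_def[symmetric] by simp
qed

definition V :: "real \<Rightarrow> real ^ 'd \<Rightarrow> real" where
  "V G x = exp (s * (G - g x))"

definition cd :: real where "cd = 2 * cz / sqrt (2 * pi) ^ CARD('d) * ci"

lemma ci_nonneg: "0 \<le> ci"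
  unfolding ci_def using K(1) \<beta>(1) by (intro add_nonneg_nonneg mult_nonneg_nonneg) auto

lemma cd_nonneg: "0 \<le> cd"
  unfolding cd_def using ci_nonneg cs_cz_nonneg by (intro mult_nonneg_nonneg divide_nonneg_nonneg) auto

lemma continuous_V: "continuous_on UNIV (V G)"
  unfolding V_def[abs_def] by (intro continuous_intros continuous_g)

text \<open>The gain lies in \<open>(c1 / L) powr (s / 4)\<close>, which tends to 0 as
  \<open>L\<close> grows while \<open>cd\<close> is fixed. Concavity and the Newton decrement are
  used only at the arrival point \<open>y\<close>, so the bound holds for every
  \<open>x\<close>.\<close>

lemma outer_drift:
  assumes L: "c1 \<le> L" and R: "R0 \<le> R" "\<And>y. R \<le> norm y \<Longrightarrow> \<exists>w. J y *v w = f y \<and> L \<le> - (w \<bullet> f y)"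
  shows "(\<integral>\<^sup>+y. ennreal (flux x y) * (ennreal (V G y) * indicator {y. R \<le> norm y} y) \<partial>lborel)
    \<le> ennreal (cd * (c1 / L) powr (s / 4) * V G x)"
proof -
  define C where "C = sqrt (2 * pi) ^ CARD('d)"
  have C: "0 < C" by (simp add: C_def)
  define m where "m = \<mu> x"
  define h where "h = (c1 / L) powr (s / 4)"
  define F where "F y = ennreal (acc x y) * (ennreal (V G y) * indicator {y. R \<le> norm y} y)" for y
  have Vm [measurable]: "V G \<in> borel_measurable borel"
    by (rule borel_measurable_continuous_onI[OF continuous_V])
  have F [measurable]: "F \<in> borel_measurable borel" unfolding F_def by measurable
  have qm: "gaussian_density (\<mu> x) (B x ** transpose (B x)) \<in> borel_measurable borel"
  proof -
    have "q x = gaussian_density (\<mu> x) (B x ** transpose (B x))" by (rule ext) (rule q_eq)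
    moreover have "q x \<in> borel_measurable borel" by measurable
    ultimately show ?thesis by simp
  qed
  define A where "A = V G x * (2 * h * cz / C)"
  have A: "0 \<le> A" unfolding A_def V_def h_def using C cs_cz_nonneg by simp
  let ?E = "\<lambda>z. ennreal (exp (- (1 / 4 * (norm z)\<^sup>2))) *
        ennreal (1 + (\<Sum>i\<in>UNIV. line_density (g x) (dir x i) (m + B x *v z) + 5 * (K * \<beta>)))"
  have point: "ennreal (exp (- ((norm z)\<^sup>2 / 2)) / C) * F (m + B x *v z) \<le> ennreal A * ?E z" for z
  proof (cases "R \<le> norm (m + B x *v z)")
    case False
    then show ?thesis by (simp add: F_def)
  next
    case True
    define y where "y = m + B x *v z"
    define \<Delta> where "\<Delta> = g x - g y"
    define D where "D = det (B x) / det (B y)"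
    define u where "u = (norm z)\<^sup>2 / 2"
    have y: "R0 \<le> norm y" using True R(1) by (simp add: y_def)
    obtain w where w: "J y *v w = f y" "L \<le> - (w \<bullet> f y)" using R(2)[of y] True by (auto simp: y_def)
    have D: "0 < D" using det_B_pos by (simp add: D_def)
    have u: "0 \<le> u" by (simp add: u_def)
    let ?S = "\<Sum>i\<in>UNIV. line_density (g x) (dir x i) y"
    let ?S' = "\<Sum>i\<in>UNIV. line_density (g x) (dir x i) y + 5 * (K * \<beta>)"
    have SS: "?S \<le> ?S'" using K(1) \<beta>(1) by (intro sum_mono) simp
    have S0: "0 \<le> 1 + ?S"
    proof -
      have "0 \<le> ?S" by (intro sum_nonneg line_density_dominates(4)[of 1] concave[OF y]) simp
      then show ?thesis by simp
    qed
    have Vy: "V G y = V G x * exp (s * \<Delta>)"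
      unfolding V_def \<Delta>_def by (simp add: algebra_simps flip: exp_add)
    have sz: "exp (- (s / 2 * \<bar>\<Delta>\<bar>)) * (D powr (s / 2) + D powr (3 * s / 2)) \<le> 2 * h * (cz * (1 + ?S))"
    proof -
      have "exp (- (s / 2 * \<bar>\<Delta>\<bar>)) * (D powr (s / 2) + D powr (3 * s / 2)) \<le>
          exp (- (s / 2 * \<bar>\<Delta>\<bar>)) * (2 * h * grad_curv x y)"
        unfolding D_def h_def by (intro mult_left_mono det_ratio_powr_le[OF y w(1) L w(2)]) simp
      also have "\<dots> = 2 * h * (exp (- (s / 2 * \<bar>g x - g y\<bar>)) * grad_curv x y)" by (simp add: \<Delta>_def)
      also have "\<dots> \<le> 2 * h * (cz * (1 + ?S))"
        by (intro mult_left_mono grad_curv_le_line_density[OF y]) (simp add: h_def)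
      finally show ?thesis .
    qed
    have "acc x y * exp (s * \<Delta>) \<le> min 1 (exp (- \<Delta>) * D * exp u) * exp (s * \<Delta>)"
      using acceptance_le[of x z] by (intro mult_right_mono) (simp_all add: y_def m_def \<Delta>_def D_def u_def)
    also have "\<dots> \<le> exp (- (s / 2 * \<bar>\<Delta>\<bar>)) * (D powr (s / 2) + D powr (3 * s / 2)) * exp (3 * s / 2 * u)"
      using s_bounds by (intro min_one_exp_le D u) auto
    also have "\<dots> \<le> 2 * h * (cz * (1 + ?S)) * exp (u / 2)"
    proof (rule mult_mono[OF sz])
      \<comment> \<open>At least half of the Gaussian exponent survives: \<open>exp (- u)\<close>
        times \<open>exp (u / 2)\<close> is the weight of rate \<open>1 / 4\<close> in
        \<open>(norm z)\<^sup>2\<close>.\<close>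
      have "3 * s / 2 * u \<le> 1 / 2 * u" using s_bounds u by (intro mult_right_mono) auto
      then show "exp (3 * s / 2 * u) \<le> exp (u / 2)" by simp
      show "0 \<le> 2 * h * (cz * (1 + ?S))" using S0 cs_cz_nonneg by (simp add: h_def)
    qed simp
    finally have key: "acc x y * exp (s * \<Delta>) \<le> 2 * h * (cz * (1 + ?S)) * exp (u / 2)" .
    have "exp (- u) / C * (acc x y * V G y) = V G x / C * exp (- u) * (acc x y * exp (s * \<Delta>))"
      by (simp add: Vy)
    also have "\<dots> \<le> V G x / C * exp (- u) * (2 * h * (cz * (1 + ?S)) * exp (u / 2))"
      using C by (intro mult_left_mono key) (simp add: V_def)
    also have "\<dots> = A * (exp (- (u / 2)) * (1 + ?S))"
    proof -
      have "exp (- (u / 2)) = exp (- u) * exp (u / 2)" by (simp flip: exp_add)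
      then show ?thesis unfolding A_def by (simp only: divide_inverse mult_ac)
    qed
    \<comment> \<open>The compensator enters because the integral over all \<open>z\<close> also
      meets points where \<open>g\<close> may fail to be concave, and the integrand must stay
      nonnegative there.\<close>
    also have "\<dots> \<le> A * (exp (- (u / 2)) * (1 + ?S'))"
      using SS A by (intro mult_left_mono) auto
    finally have fin: "exp (- u) / C * (acc x y * V G y) \<le> A * (exp (- (u / 2)) * (1 + ?S'))" .
    have "ennreal (exp (- u) / C) * F y = ennreal (exp (- u) / C * (acc x y * V G y))"
      using True C acc_bounds(1)[of x y] by (simp add: F_def y_def V_def less_imp_le flip: ennreal_mult)
    also have "\<dots> \<le> ennreal (A * (exp (- (u / 2)) * (1 + ?S')))" by (rule ennreal_leI[OF fin])
    also have "\<dots> = ennreal A * (ennreal (exp (- (u / 2))) * ennreal (1 + ?S'))"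
      using A S0 SS by (simp add: ennreal_mult)
    finally show ?thesis by (simp add: y_def u_def)
  qed
  have "(\<integral>\<^sup>+y. ennreal (flux x y) * (ennreal (V G y) * indicator {y. R \<le> norm y} y) \<partial>lborel) =
      (\<integral>\<^sup>+y. ennreal (gaussian_density (\<mu> x) (B x ** transpose (B x)) y) * F y \<partial>lborel)"
  proof (intro nn_integral_cong)
    fix y
    have "ennreal (flux x y) = ennreal (q x y) * ennreal (acc x y)"
      unfolding flux_def using acc_bounds(1)[of x y] q_pos[of x y] by (simp add: ennreal_mult mult.commute less_imp_le)
    then show "ennreal (flux x y) * (ennreal (V G y) * indicator {y. R \<le> norm y} y) =
        ennreal (gaussian_density (\<mu> x) (B x ** transpose (B x)) y) * F y"
      by (simp only: F_def q_eq mult.assoc)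
  qed
  also have "\<dots> = (\<integral>\<^sup>+z. ennreal (exp (- ((norm z)\<^sup>2 / 2)) / C) * F (m + B x *v z) \<partial>lborel)"
    unfolding C_def m_def by (rule nn_integral_gaussian[OF eb r_pos F qm])
  also have "\<dots> \<le> (\<integral>\<^sup>+z. ennreal A * ?E z \<partial>lborel)"
    by (intro nn_integral_mono point)
  also have "\<dots> = ennreal A * (\<integral>\<^sup>+z. ?E z \<partial>lborel)"
  proof (rule nn_integral_cmult)
    have [measurable]: "line_density (g x) v \<in> borel_measurable borel" for v
      by (rule borel_measurable_continuous_onI[OF continuous_line_density])
    show "?E \<in> borel_measurable lborel" by measurable
  qed
  also have "\<dots> \<le> ennreal A * ennreal ci"
    by (intro mult_left_mono gaussian_line_density) simp
  also have "\<dots> = ennreal (cd * (c1 / L) powr (s / 4) * V G x)"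
    using A ci_nonneg by (simp add: A_def cd_def h_def C_def mult_ac flip: ennreal_mult)
  finally show ?thesis .
qed

text \<open>Arrivals in a ball contribute a constant, because \<open>V\<close> is bounded there and
  the flux has mass at most 1; arrivals outside contribute a multiple of \<open>V x\<close>, made as
  small as desired by enlarging the ball. Far out the constant is absorbed because \<open>V\<close>
  tends to infinity.\<close>

theorem geometrically_ergodic: "geometrically_ergodic P \<pi>"
proof -
  have lim: "filterlim g at_bot at_infinity" by (rule tends_to_minus_infinity[OF \<delta>])
  have ev: "\<exists>b. \<forall>x. b \<le> norm x \<longrightarrow> g x \<le> Z" for Z
    using lim unfolding filterlim_at_bot eventually_at_infinity by blast
  obtain G where G: "g x \<le> G" for x
  proof -
    obtain b0 where b0: "\<forall>x. b0 \<le> norm x \<longrightarrow> g x \<le> 0" using ev by blast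
    obtain M where M: "0 \<le> M" "\<forall>x. norm x \<le> b0 \<longrightarrow> norm (g x) \<le> M"
      using continuous_norm_bound_cball[OF continuous_g] by blast
    have "g x \<le> M" for x
    proof (cases "b0 \<le> norm x")
      case True
      then show ?thesis using b0 M(1) by (meson order_trans)
    next
      case False
      then have "norm (g x) \<le> M" using M(2) by simp
      then show ?thesis by simp
    qed
    then show ?thesis by (rule that)
  qed
  have V1: "1 \<le> V G x" for x using G[of x] s_bounds(1) by (simp add: V_def)
  have V_large: "\<exists>b. \<forall>x. b \<le> norm x \<longrightarrow> M \<le> V G x" for M
  proof -
    obtain b0 where b0: "\<forall>x. b0 \<le> norm x \<longrightarrow> g x \<le> G - \<bar>M\<bar> / s" using ev by blast
    have "M \<le> V G x" if "b0 \<le> norm x" for x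
    proof -
      have "s * (\<bar>M\<bar> / s) \<le> s * (G - g x)" using b0 that s_bounds(1) by (intro mult_left_mono) (auto simp: algebra_simps)
      then have "\<bar>M\<bar> \<le> s * (G - g x)" using s_bounds(1) by simp
      also have "\<dots> \<le> V G x" unfolding V_def using exp_ge_add_one_self[of "s * (G - g x)"] by linarith
      finally show ?thesis by linarith
    qed
    then show ?thesis by blast
  qed
  have bounded: "bounded {x. V G x \<le> M}" for M
  proof -
    obtain b0 where "\<forall>x. b0 \<le> norm x \<longrightarrow> M + 1 \<le> V G x" using V_large by blast
    then have "norm x \<le> b0" if "V G x \<le> M" for x using that by (metis add.commute add_le_same_cancel1 linear not_one_le_zero order_trans)
    then show ?thesis unfolding bounded_iff by blast
  qed
  let ?I = "\<lambda>x. (\<integral>\<^sup>+y. ennreal (flux x y) * ennreal (V G y) \<partial>lborel)"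
  have total: "\<exists>M\<ge>0. \<forall>x. ?I x
      \<le> ennreal (M + cd * (c1 / L) powr (s / 4) * V G x)" if L: "c1 \<le> L" for L
  proof -
    obtain R1 where R1: "\<forall>y. R1 \<le> norm y \<longrightarrow> (\<exists>w. J y *v w = f y \<and> L \<le> - (w \<bullet> f y))"
      using newton by blast
    define R where "R = max R0 R1"
    obtain M where M: "0 \<le> M" "\<forall>x. norm x \<le> R \<longrightarrow> norm (V G x) \<le> M"
      using continuous_norm_bound_cball[OF continuous_V] by blast
    have [measurable]: "V G \<in> borel_measurable borel"
      by (rule borel_measurable_continuous_onI[OF continuous_V])
    have "?I x
      \<le> ennreal (M + cd * (c1 / L) powr (s / 4) * V G x)" for x
    proof -
      have "?I x \<le>
          (\<integral>\<^sup>+y. ennreal M * ennreal (flux x y) +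
            ennreal (flux x y) * (ennreal (V G y) * indicator {y. R \<le> norm y} y) \<partial>lborel)"
      proof (intro nn_integral_mono)
        fix y
        show "ennreal (flux x y) * ennreal (V G y) \<le> ennreal M * ennreal (flux x y) +
            ennreal (flux x y) * (ennreal (V G y) * indicator {y. R \<le> norm y} y)"
        proof (cases "R \<le> norm y")
          case True
          then show ?thesis by (simp add: add_increasing)
        next
          case False
          then have "V G y \<le> M" using M(2)[rule_format, of y] by simp
          then have "ennreal (flux x y) * ennreal (V G y) \<le> ennreal (flux x y) * ennreal M"
            by (intro mult_left_mono ennreal_leI) auto
          then show ?thesis using False by (simp add: mult.commute)
        qed
      qed
      also have "\<dots> = ennreal M * (\<integral>\<^sup>+y. ennreal (flux x y) \<partial>lborel) +
          (\<integral>\<^sup>+y. ennreal (flux x y) * (ennreal (V G y) * indicator {y. R \<le> norm y} y) \<partial>lborel)"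
        by (simp add: nn_integral_add nn_integral_cmult)
      also have "\<dots> \<le> ennreal M * 1 + ennreal (cd * (c1 / L) powr (s / 4) * V G x)"
      proof (intro add_mono mult_left_mono outer_drift[OF L])
        show "(\<integral>\<^sup>+y. ennreal (flux x y) \<partial>lborel) \<le> 1" using flux_rej[of x] by (metis le_iff_add)
        show "R0 \<le> R" by (simp add: R_def)
        show "\<exists>w. J y *v w = f y \<and> L \<le> - (w \<bullet> f y)" if "R \<le> norm y" for y
          using R1 that by (simp add: R_def)
      qed simp
      also have "\<dots> = ennreal (M + cd * (c1 / L) powr (s / 4) * V G x)"
        using M(1) cd_nonneg by (simp add: ennreal_plus V_def)
      finally show ?thesis .
    qed
    then show ?thesis using M(1) by blast
  qed
  \<comment> \<open>With \<open>L = c1\<close> the coefficient of \<open>V x\<close> is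
    \<open>cd\<close>: this is the crude bound for all \<open>x\<close>.\<close>
  obtain M0 where M0: "0 \<le> M0" "\<And>x. ?I x
      \<le> ennreal (M0 + cd * (c1 / c1) powr (s / 4) * V G x)"
    using total[of c1] by blast
  \<comment> \<open>The target value of \<open>(c1 / L) powr (s / 4)\<close>:
    \<open>cd * e \<le> a / 4\<close> leaves another \<open>a / 4\<close> to absorb the constant,
    and \<open>e \<le> 1\<close> keeps \<open>c1 \<le> L\<close>.\<close>
  define e where "e = min 1 (a / (4 * (cd + 1)))"
  have e: "0 < e" "e \<le> 1" "cd * e \<le> a / 4"
  proof -
    show "0 < e" "e \<le> 1" using accept(1) cd_nonneg by (simp_all add: e_def)
    have "cd * e \<le> (cd + 1) * (a / (4 * (cd + 1)))"
      using cd_nonneg accept(1) \<open>0 < e\<close> by (intro mult_mono) (auto simp: e_def)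
    also have "\<dots> = a / 4"
    proof -
      have "n * (a / (4 * n)) = a / 4" if "0 < n" for n :: real using that by simp
      from this[of "cd + 1"] show ?thesis using cd_nonneg by argo
    qed
    finally show "cd * e \<le> a / 4" .
  qed
  define L where "L = c1 / e powr (4 / s)"
  have ep: "0 < e powr (4 / s)" "e powr (4 / s) \<le> 1"
    using e s_bounds(1) by (auto intro: powr_le1)
  have L: "c1 \<le> L" "(c1 / L) powr (s / 4) = e"
    using ep c1(1) e s_bounds(1) by (simp_all add: L_def le_divide_eq powr_powr)
  obtain M1 where M1: "0 \<le> M1" "\<And>x. ?I x
      \<le> ennreal (M1 + cd * (c1 / L) powr (s / 4) * V G x)"
    using total[OF L(1)] by blast
  obtain b1 where b1: "\<forall>x. b1 \<le> norm x \<longrightarrow> 4 * M1 / a \<le> V G x" using V_large by blast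
  show ?thesis
  proof (rule geometrically_ergodic_if_drift[where V = "V G" and \<rho> = "max \<rho> b1" and a = a and K = "M0 + cd"])
    show "?I x \<le> ennreal ((M0 + cd) * V G x)" for x
    proof (rule order_trans[OF M0(2)], rule ennreal_leI)
      have "M0 * 1 \<le> M0 * V G x" by (intro mult_left_mono V1 M0(1))
      then show "M0 + cd * (c1 / c1) powr (s / 4) * V G x \<le> (M0 + cd) * V G x"
        using c1(1) by (simp add: distrib_right)
    qed
    show "?I x \<le> ennreal (a / 2 * V G x)"
      if "max \<rho> b1 \<le> norm x" for x
    proof (rule order_trans[OF M1(2)], rule ennreal_leI)
      have "4 * M1 / a \<le> V G x" using b1 that by simp
      then have "M1 \<le> a / 4 * V G x" using accept(1) by (simp add: field_simps)
      moreover have "cd * e * V G x \<le> a / 4 * V G x" using e(3) V1[of x] by (intro mult_right_mono) auto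
      ultimately show "M1 + cd * (c1 / L) powr (s / 4) * V G x \<le> a / 2 * V G x"
        unfolding L(2) by simp
    qed
  qed (use continuous_V V1 bounded accept in auto)
qed

end

section \<open>The boosted Ozaki kernel\<close>

lemma continuous_on_det:
  fixes F :: "'a::topological_space \<Rightarrow> real ^ 'n ^ 'n"
  assumes "continuous_on S F"
  shows "continuous_on S (\<lambda>x. det (F x))"
  unfolding det_def by (intro continuous_intros continuous_on_component assms)

text \<open>Quotients of determinants make the continuity of the inverse in \<open>A\<close>
  visible.\<close>

lemma matrix_inv_mult_cramer:
  fixes A :: "real ^ 'n ^ 'n"
  assumes "det A \<noteq> 0"
  shows "matrix_inv A *v v = (\<chi> k. det (\<chi> i j. if j = k then v $ i else A $ i $ j) / det A)"
proof -
  have "invertible A" using assms by (simp only: invertible_det_nz not_False_eq_True)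
  then have "A *v (matrix_inv A *v v) = v"
    by (simp only: matrix_vector_mul_assoc matrix_inv_right matrix_vector_mul_lid)
  then show ?thesis by (simp only: cramer[OF assms])
qed

lemma continuous_on_gaussian_density:
  fixes m :: "real ^ 'n \<Rightarrow> real ^ 'n" and A :: "real ^ 'n \<Rightarrow> real ^ 'n ^ 'n"
  assumes m: "continuous_on UNIV m" and A: "continuous_on UNIV A" and det: "\<And>x. 0 < det (A x)"
  shows "continuous_on UNIV (\<lambda>z. gaussian_density (m (fst z)) (A (fst z)) (snd z))"
proof -
  have m': "continuous_on UNIV (\<lambda>z :: (real ^ 'n) \<times> (real ^ 'n). m (fst z))"
    and A': "continuous_on UNIV (\<lambda>z :: (real ^ 'n) \<times> (real ^ 'n). A (fst z))"
    by (auto intro!: continuous_on_compose2[OF m] continuous_on_compose2[OF A] continuous_intros)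
  have nz: "det (A x) \<noteq> 0" for x using det[of x] by simp
  have entry: "continuous_on UNIV (\<lambda>z :: (real ^ 'n) \<times> (real ^ 'n).
      if j = k then (snd z - m (fst z)) $ i else A (fst z) $ i $ j)" for i j k
    by (cases "j = k") (auto intro!: continuous_on_component continuous_intros m' A')
  have inv: "continuous_on UNIV (\<lambda>z :: (real ^ 'n) \<times> (real ^ 'n). matrix_inv (A (fst z)) *v (snd z - m (fst z)))"
    unfolding matrix_inv_mult_cramer[OF nz]
    by (intro continuous_on_vec_lambda continuous_on_divide continuous_on_det A' entry) (simp add: nz)
  have "sqrt ((2 * pi) ^ CARD('n) * det (A x)) \<noteq> 0" for x using det[of x] by simp
  then show ?thesis
    unfolding gaussian_density_def
    by (intro continuous_intros continuous_on_det A' inv m') auto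
qed

context C3_function
begin

lemma continuous_bO_mean: "continuous_on UNIV (bO_mean f h)"
  unfolding bO_mean_def[abs_def] Let_def
  by (intro continuous_intros continuous_on_matrix_vector_mult continuous_f continuous_vec_laplacian
      continuous_on_compose2[OF continuous_on_T1 continuous_J]
      continuous_on_compose2[OF continuous_on_T2 continuous_J]
      continuous_on_compose2[OF continuous_on_T3 continuous_J]) auto

lemma continuous_bO_cov: "continuous_on UNIV (\<lambda>x. T1 (J x) (2 * h) + (1 / 3) *\<^sub>R T2 (J x) (2 * h))"
  by (intro continuous_intros continuous_on_compose2[OF continuous_on_T1 continuous_J]
      continuous_on_compose2[OF continuous_on_T2 continuous_J]) auto

end

theorem theorem4p5:
  fixes p :: "real ^ 'd \<Rightarrow> real"
    and f :: "real ^ 'd \<Rightarrow> real ^ 'd"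
    and c :: "real ^ 'd \<Rightarrow> real"
    and h :: real
  assumes p_pos: "\<And>x. 0 < p x"
    and p_prob: "prob_space (density lborel (\<lambda>x. ennreal (p x)))"
    and p_C3: "C_k 3 (\<lambda>x. ln (p x))"
    and h_pos: "0 < h"
    and f_grad: "\<And>x. GDERIV (\<lambda>x. ln (p x)) x :> f x"
    and accept: "0 < Liminf at_infinity (\<lambda>x. ereal
          (\<integral>y. mh_accept p (bO_density f h) x y * bO_density f h x y \<partial>lborel))"
    and eig: "Limsup at_infinity (\<lambda>x. ereal (lambda_max (jacobian f (at x)))) < 0"
    and lap: "((\<lambda>x. mpow (matrix_inv (jacobian f (at x))) 2 *v vec_laplacian f x) \<longlongrightarrow> 0) at_infinity"
    and radial: "((\<lambda>x. norm ((1 / norm x) *\<^sub>R (matrix_inv (jacobian f (at x)) *v f x)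
          - c (x /\<^sub>R norm x) *\<^sub>R (x /\<^sub>R norm x))) \<longlongrightarrow> 0) at_infinity"
    and c_inf: "0 < (INF n\<in>sphere 0 1. ereal (c n))"
    and c_sup: "(SUP n\<in>sphere 0 1. ereal (c n)) < ereal (6 / 5)"
  shows "geometrically_ergodic (mh_kernel p (bO_density f h)) (density lborel (\<lambda>x. ennreal (p x)))"
proof -

  \<comment> \<open>Gaussian form of the proposal\<close>
  define g where "g x = ln (p x)" for x
  have p_eq: "p = (\<lambda>x. exp (g x))" using p_pos by (simp add: g_def fun_eq_iff)
  interpret C3: C3_function g f
    using p_C3 f_grad by unfold_locales (simp_all add: g_def[abs_def])
  define J where "J x = jacobian f (at x)" for x
  define A where "A x = T1 (J x) (2 * h) + (1 / 3) *\<^sub>R T2 (J x) (2 * h)" for x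
  have "\<forall>x. \<exists>bl. eigenbasis (J x) (fst bl) (snd bl)"
    using eigenbasis_exists[OF C3.J_symmetric] by (simp add: J_def)
  from choice[OF this] obtain bl where bl: "\<forall>x. eigenbasis (J x) (fst (bl x)) (snd (bl x))" ..
  define b where "b x = fst (bl x)" for x
  define l where "l x = snd (bl x)" for x
  have ebJ: "eigenbasis (J x) (b x) (l x)" for x using bl by (simp add: b_def l_def)
  have ebA: "eigenbasis (A x) (b x) (\<lambda>i. cov_eig h (l x i))" for x
    unfolding A_def by (rule eigenbasis_bO_cov[OF ebJ])
  have pos: "0 < cov_eig h t" for t by (rule cov_eig_pos[OF h_pos])
  define B where "B = bO_scale f h"
  have B_def': "B x = mat_sqrt (A x)" for x by (simp add: B_def bO_scale_def Let_def A_def J_def)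
  have ebB: "eigenbasis (B x) (b x) (\<lambda>i. sqrt (cov_eig h (l x i)))" and BB: "B x ** B x = A x" for x
    unfolding B_def' using eigenbasis_mat_sqrt[OF ebA less_imp_le[OF pos]] by auto
  have BT: "transpose (B x) = B x" for x by (rule symmetric_if_eigenbasis[OF ebB])
  have spos: "0 < sqrt (cov_eig h (l x i))" for x i using pos by simp
  have detA: "0 < det (A x)" for x unfolding eigenbasis_det[OF ebA] by (simp add: prod_pos pos)

  define q where "q = bO_density f h"
  have q_eq: "q x y = gaussian_density (bO_mean f h x) (B x ** transpose (B x)) y" for x y
    by (simp add: q_def bO_density_def B_def)
  have q_cont: "continuous_on UNIV (\<lambda>z. q (fst z) (snd z))"
    unfolding q_eq BT BB using C3.continuous_bO_cov[of h]
    by (intro continuous_on_gaussian_density C3.continuous_bO_mean detA) (simp add: A_def[abs_def] J_def)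
  have q_meas: "gaussian_density (bO_mean f h x) (B x ** transpose (B x)) \<in> borel_measurable borel" for x
  proof -
    have "continuous_on UNIV (\<lambda>y. q x y)"
      using continuous_on_compose2[OF q_cont, of UNIV "\<lambda>y. (x, y)"] by (simp add: continuous_on_Pair)
    from borel_measurable_continuous_onI[OF this] show ?thesis by (simp add: q_eq[abs_def])
  qed
  interpret MH: mh_target "\<lambda>x. exp (g x)" q
  proof (rule mh_target.intro)
    show "0 < q x y" for x y unfolding q_eq by (rule gaussian_density_pos[OF ebB spos])
    show "(\<integral>\<^sup>+y. ennreal (q x y) \<partial>lborel) = 1" for x
      unfolding q_eq by (rule nn_integral_gaussian_density[OF ebB spos q_meas])
    show "prob_space (density lborel (\<lambda>x. ennreal (exp (g x))))" using p_prob by (simp add: p_eq)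
    show "continuous_on UNIV (\<lambda>x. exp (g x))" by (intro continuous_intros C3.continuous_g)
  qed (simp, rule q_cont)

  \<comment> \<open>Constants from the spectral condition\<close>
  obtain \<delta> R0 where \<delta>: "0 < \<delta>" and lam: "\<And>x. R0 \<le> norm x \<Longrightarrow> lambda_max (J x) < - \<delta>"
  proof -
    obtain e where e: "Limsup at_infinity (\<lambda>x. ereal (lambda_max (jacobian f (at x)))) < ereal e" "ereal e < 0"
      using ereal_dense2[OF eig] by blast
    from Limsup_lessD[OF e(1)] obtain R0 where "\<forall>x. R0 \<le> norm x \<longrightarrow> lambda_max (J x) < e"
      unfolding eventually_at_infinity J_def by auto
    then show ?thesis using that[of "- e" R0] e(2) by (simp add: J_def)
  qed
  have conc: "v \<bullet> (J x *v v) \<le> - \<delta> * (v \<bullet> v)" if "R0 \<le> norm x" for x v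
  proof -
    have "transpose (J x) = J x" unfolding J_def by (rule C3.J_symmetric)
    from quadratic_le_lambda_max[OF this, of v]
    have "v \<bullet> (J x *v v) \<le> lambda_max (J x) * (v \<bullet> v)" .
    also have "\<dots> \<le> - \<delta> * (v \<bullet> v)" using lam[OF that] by (intro mult_right_mono) auto
    finally show ?thesis .
  qed
  obtain K where K: "0 \<le> K" "\<And>x v. v \<bullet> (J x *v v) \<le> K * (v \<bullet> v)"
  proof -
    have "v \<bullet> (J x *v v) \<le> 0" if "R0 \<le> norm x" for x v
    proof -
      have "0 \<le> \<delta> * (v \<bullet> v)" using \<delta> by simp
      then show ?thesis using conc[OF that, of v] by linarith
    qed
    from C3.quadratic_form_upper_bound[OF this[unfolded J_def]] show ?thesis
      using that unfolding J_def by metis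
  qed
  have l_form: "l x i = b x i \<bullet> (J x *v b x i)" for x i
    by (simp add: eigenbasis_eigen[OF ebJ] eigenbasis_inner[OF ebJ])
  have b_unit: "b x i \<bullet> b x i = 1" for x i by (simp add: eigenbasis_inner[OF ebJ])
  \<comment> \<open>A bound on the covariance eigenvalues suffices, since the squared length of
    \<open>B x *v v\<close> is the covariance form at \<open>v\<close>.\<close>
  define \<beta> where "\<beta> = 4 / 3 * h * exp (h * K)"
  have B_bound: "(B x *v v) \<bullet> (B x *v v) \<le> \<beta> * (v \<bullet> v)" for x v
  proof -
    have "(B x *v v) \<bullet> (B x *v v) = v \<bullet> (A x *v v)"
      using symmetric_inner_commute[OF BT, of v x "B x *v v"] by (simp add: matrix_vector_mul_assoc BB)
    also have "\<dots> = (\<Sum>i\<in>UNIV. cov_eig h (l x i) * (b x i \<bullet> v)\<^sup>2)" by (rule eigenbasis_quadratic[OF ebA])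
    also have "\<dots> \<le> (\<Sum>i\<in>UNIV. \<beta> * (b x i \<bullet> v)\<^sup>2)"
    proof (intro sum_mono mult_right_mono)
      show "cov_eig h (l x i) \<le> \<beta>" for i
        unfolding \<beta>_def using K(2)[of "b x i" x] by (intro cov_eig_upper h_pos K(1)) (simp add: l_form b_unit)
    qed simp
    also have "\<dots> = \<beta> * (v \<bullet> v)"
      unfolding eigenbasis_inner_eq[OF ebA[of x], of v v] sum_distrib_left power2_eq_square ..
    finally show ?thesis .
  qed
  define \<kappa> where "\<kappa> = 1 - exp (- (h * \<delta>))"
  have \<kappa>: "0 < \<kappa>" using h_pos \<delta> by (simp add: \<kappa>_def)
  \<comment> \<open>The covariance and \<open>J y\<close> share an eigenbasis, so the comparison of
    eigenvalues multiplies up to one of determinants; \<open>\<kappa>\<close> is the constant of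
    \<open>cov_eig_lower\<close> for the gap \<open>\<delta>\<close>.\<close>
  have det_bound: "1 / (det (B y))\<^sup>2 \<le> (1 / \<kappa>) ^ CARD('d) * det (- J y)" if y: "R0 \<le> norm y" for y
  proof -
    have l: "l y i \<le> - \<delta>" for i using conc[OF y, of "b y i"] by (simp add: l_form b_unit)
    have "(det (B y))\<^sup>2 = det (A y)" by (simp add: power2_eq_square BB flip: det_mul)
    then have "1 / (det (B y))\<^sup>2 = (\<Prod>i\<in>UNIV. 1 / cov_eig h (l y i))"
      by (simp add: eigenbasis_det[OF ebA] prod_dividef)
    also have "\<dots> \<le> (\<Prod>i\<in>UNIV. 1 / \<kappa> * (- l y i))"
      using cov_eig_lower[OF h_pos l \<delta>] pos by (intro prod_mono) (auto simp: \<kappa>_def less_imp_le)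
    also have "\<dots> = (1 / \<kappa>) ^ CARD('d) * det (- J y)"
      unfolding eigenbasis_det[OF eigenbasis_minus[OF ebJ]] prod.distrib by simp
    finally show ?thesis .
  qed

  \<comment> \<open>Growth of the Newton decrement\<close>
  obtain c0 where c0: "0 < c0" "\<And>n. norm n = 1 \<Longrightarrow> c0 \<le> c n"
  proof -
    obtain e where e: "0 < ereal e" "ereal e < (INF n\<in>sphere 0 1. ereal (c n))"
      using ereal_dense2[OF c_inf] by blast
    have "e \<le> c n" if "norm n = 1" for n
    proof -
      have "(INF n\<in>sphere 0 1. ereal (c n)) \<le> ereal (c n)" using that by (intro INF_lower) simp
      with e(2) have "ereal e < ereal (c n)" by (rule order.strict_trans2)
      then show ?thesis by simp
    qed
    then show ?thesis using that[of e] e(1) by simp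
  qed
  \<comment> \<open>By the radial condition the Newton step \<open>w\<close> has length at least
    \<open>c0 / 2 * norm y\<close>, since \<open>c\<close> times a unit vector has length at least
    \<open>c0\<close>. Strong concavity then gives
    \<open>- (w \<bullet> f y) \<ge> \<delta> * (w \<bullet> w)\<close>, which grows with
    \<open>norm y\<close>.\<close>
  have newton: "\<exists>R. \<forall>y. R \<le> norm y \<longrightarrow> (\<exists>w. J y *v w = f y \<and> L \<le> - (w \<bullet> f y))" for L
  proof -
    have "0 < c0 / 2" using c0 by simp
    from tendstoD[OF radial this] obtain R1 where R1: "\<And>x. R1 \<le> norm x \<Longrightarrow>
        norm ((1 / norm x) *\<^sub>R (matrix_inv (J x) *v f x) - c (x /\<^sub>R norm x) *\<^sub>R (x /\<^sub>R norm x)) < c0 / 2"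
      unfolding eventually_at_infinity J_def by auto
    \<comment> \<open>Chosen so that \<open>\<delta> * (c0 / 2)\<^sup>2 * T\<close> exceeds
      \<open>L\<close>; the square of \<open>norm y\<close> dominates \<open>T\<close> because
      \<open>norm y\<close> is at least both 1 and \<open>T\<close>.\<close>
    define T where "T = 1 + \<bar>L\<bar> / (\<delta> * (c0 / 2)\<^sup>2)"
    have T: "1 \<le> T" "L \<le> \<delta> * (c0 / 2)\<^sup>2 * T"
    proof -
      have d: "0 < \<delta> * (c0 / 2)\<^sup>2" using \<delta> c0 by simp
      then show "1 \<le> T" by (simp add: T_def)
      have "\<delta> * (c0 / 2)\<^sup>2 * T = \<delta> * (c0 / 2)\<^sup>2 + \<bar>L\<bar>"
        unfolding T_def using \<delta> c0(1) by (simp only: distrib_left) simp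
      then show "L \<le> \<delta> * (c0 / 2)\<^sup>2 * T" using d by linarith
    qed
    have "\<exists>w. J y *v w = f y \<and> L \<le> - (w \<bullet> f y)" if y: "max R0 (max R1 T) \<le> norm y" for y
    proof -
      have y': "R0 \<le> norm y" "R1 \<le> norm y" "T \<le> norm y" using y by simp_all
      then have ny: "1 \<le> norm y" using T(1) by linarith
      then have ny0: "norm y \<noteq> 0" by linarith
      define w where "w = matrix_inv (J y) *v f y"
      have l: "l y i \<noteq> 0" for i using conc[OF y'(1), of "b y i"] \<delta> by (simp add: l_form b_unit)
      then have "det (J y) \<noteq> 0" unfolding eigenbasis_det[OF ebJ] by simp
      then have "invertible (J y)" by (simp only: invertible_det_nz not_False_eq_True)
      then have Jw: "J y *v w = f y"
        unfolding w_def by (simp only: matrix_vector_mul_assoc matrix_inv_right matrix_vector_mul_lid)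
      have n: "norm (y /\<^sub>R norm y) = 1" using ny0 by simp
      have unit: "norm (t *\<^sub>R u) = \<bar>t\<bar>" if "norm u = 1" for t and u :: "real ^ 'd" using that by simp
      have "c0 \<le> norm (c (y /\<^sub>R norm y) *\<^sub>R (y /\<^sub>R norm y))"
        using c0(2)[OF n] unit[OF n, of "c (y /\<^sub>R norm y)"] by linarith
      also have "\<dots> \<le> norm ((1 / norm y) *\<^sub>R w) + norm ((1 / norm y) *\<^sub>R w - c (y /\<^sub>R norm y) *\<^sub>R (y /\<^sub>R norm y))"
        by (rule norm_triangle_sub[of _ "(1 / norm y) *\<^sub>R w", unfolded norm_minus_commute[of _ "(1 / norm y) *\<^sub>R w"]])
      finally have "c0 / 2 \<le> norm ((1 / norm y) *\<^sub>R w)" using R1[OF y'(2)] unfolding w_def by linarith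
      then have "c0 / 2 \<le> norm w / norm y" by simp
      moreover have "0 < norm y" using ny by linarith
      ultimately have "c0 / 2 * norm y \<le> norm w" by (simp only: pos_le_divide_eq)
      then have "(c0 / 2 * norm y)\<^sup>2 \<le> (norm w)\<^sup>2" using c0 by (intro power_mono) auto
      moreover have "(c0 / 2)\<^sup>2 * T \<le> (c0 / 2 * norm y)\<^sup>2"
      proof -
        have "T * 1 \<le> norm y * norm y" using y'(3) ny by (intro mult_mono) auto
        then have "(c0 / 2)\<^sup>2 * T \<le> (c0 / 2)\<^sup>2 * (norm y)\<^sup>2"
          by (intro mult_left_mono) (auto simp: power2_eq_square)
        then show ?thesis by (simp only: power_mult_distrib)
      qed
      ultimately have "\<delta> * ((c0 / 2)\<^sup>2 * T) \<le> \<delta> * (w \<bullet> w)"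
        using \<delta> by (intro mult_left_mono) (auto simp: power2_norm_eq_inner)
      moreover have "w \<bullet> f y \<le> - \<delta> * (w \<bullet> w)" using conc[OF y'(1), of w] by (simp add: Jw)
      ultimately have "L \<le> - (w \<bullet> f y)" using T(2) by (simp add: mult.assoc)
      then show ?thesis using Jw by blast
    qed
    then show ?thesis by blast
  qed

  \<comment> \<open>Acceptance rate and conclusion\<close>
  obtain a \<rho> where a: "0 < a" "\<And>x. \<rho> \<le> norm x \<Longrightarrow> a \<le> (\<integral>y. MH.flux x y \<partial>lborel)"
  proof -
    obtain e where e: "0 < ereal e" "ereal e < Liminf at_infinity (\<lambda>x. ereal
          (\<integral>y. mh_accept p (bO_density f h) x y * bO_density f h x y \<partial>lborel))"
      using ereal_dense2[OF accept] by blast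
    from less_LiminfD[OF e(2)] obtain \<rho> where "\<forall>x. \<rho> \<le> norm x \<longrightarrow>
        e < (\<integral>y. mh_accept p (bO_density f h) x y * bO_density f h x y \<partial>lborel)"
      unfolding eventually_at_infinity by auto
    then have "e \<le> (\<integral>y. MH.flux x y \<partial>lborel)" if "\<rho> \<le> norm x" for x
      using that unfolding MH.flux_def[abs_def] unfolding p_eq q_def by (simp add: less_imp_le)
    then show ?thesis using that[of e \<rho>] e(1) by simp
  qed
  interpret gaussian_mh g f q "bO_mean f h" B b "\<lambda>x i. sqrt (cov_eig h (l x i))"
    K \<beta> \<delta> R0 "(1 / \<kappa>) ^ CARD('d)" a \<rho>
  proof
    show "0 \<le> \<beta>" using h_pos by (simp add: \<beta>_def)
    show "0 < (1 / \<kappa>) ^ CARD('d)" using \<kappa> by simp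
  qed (use ebB spos q_eq K B_bound \<delta> conc det_bound newton a in \<open>simp_all add: J_def\<close>)
  show ?thesis using geometrically_ergodic by (simp add: p_eq q_def)
qed

end
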